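(* Let $T_1$ be a tree of order $n_1$ having exactly $r_1$ non-pendent vertices, and let $T_2$ be an SNS-tree of diameter $4$ of order $n_2$ that is not one of the trees $T(4;2a,2b)$, $T'$, $T''$, where $n_1\ge n_2\ge 6$. Let $T$ be a tree obtained from the disjoint union of $T_1$ and $T_2$ by adding an edge between a vertex of $T_1$ and a vertex of $T_2$, and suppose that its order $n=n_1+n_2$ satisfies $n\ge 19$. Let $\sigma_1$ be the number of Laplacian eigenvalues of $T_1$ that are greater than or equal to the average degree $\overline{d}(T_1)=2-\frac{2}{n_1}$. If $\sigma_1=r_1$ and $LE(T_1)\ge 2+\frac{4n_1}{\pi}$, then $$LE(T)\ge \frac{4n}{\pi}+2,$$ and hence $LE(T)\ge LE(P_n)$, where $P_n$ is the path on $n$ vertices.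
   Context: For a simple graph $G$ with $n$ vertices and $m$ edges, let $L(G)=D(G)-A(G)$ be its Laplacian matrix ($D(G)$ the diagonal matrix of vertex degrees, $A(G)$ the adjacency matrix), with eigenvalues (the Laplacian eigenvalues of $G$) $\mu_1(G)\ge\mu_2(G)\ge\dots\ge\mu_n(G)=0$, counted with multiplicity. The average degree is $\overline{d}(G)=\frac{2m}{n}$. The Laplacian energy is $LE(G)=\sum_{i=1}^{n}\left|\mu_i(G)-\overline{d}(G)\right|$. A vertex is pendent if its degree is $1$, and non-pendent otherwise. An SNS-tree of diameter $4$ is a tree consisting of a root vertex $v_0$, $p\ge 0$ pendent vertices attached to $v_0$, and $r\ge 2$ further neighbours $v_1,\dots,v_r$ of $v_0$ (the vertices of level $1$), where each $v_i$ has $s_i\ge 0$ pendent vertices attached to it and at least two of the $s_i$ are non-zero; its order is $p+r+1+\sum_{i=1}^{r}s_i$. The excluded trees (up to isomorphism) are those with the following parameters: - $T(4;2a,2b)$: $p=0$ and $s_i=1$ for all $i=1,\dots,r$ (with $a+b=r$); - $T'$: $p=0$, $s_1\ge 2$, and $s_i=1$ for $i=2,\dots,r$; - $T''$: $p=0$, $s_1,s_2\ge 2$, and $s_i=1$ for $i=3,\dots,r$. *)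

theory Defs
  imports
    Complex_Main
    "Graph_Theory.Graph_Theory"
    "Jordan_Normal_Form.Char_Poly"
begin

text \<open>
  Simple graphs are values of type \<open>'a pair_pre_digraph\<close> satisfying \<^const>\<open>pair_graph\<close>
  (finite, symmetric, loop-free, no parallel arcs): an undirected edge \<open>{u, v}\<close> is the pair of
  arcs \<open>(u, v)\<close>, \<open>(v, u)\<close>, so the degree of a vertex is its \<^const>\<open>out_degree\<close>.
\<close>

definition graph_order :: "'a pair_pre_digraph \<Rightarrow> nat" where
  "graph_order G = card (pverts G)"

definition graph_size :: "'a pair_pre_digraph \<Rightarrow> nat" where
  "graph_size G = card ((\<lambda>(u, v). {u, v}) ` parcs G)"

abbreviation vertex_degree :: "'a pair_pre_digraph \<Rightarrow> 'a \<Rightarrow> nat" where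
  "vertex_degree G v \<equiv> out_degree (with_proj G) v"

definition average_degree :: "'a pair_pre_digraph \<Rightarrow> real" where
  "average_degree G = 2 * real (graph_size G) / real (graph_order G)"

text \<open>
  \<^const>\<open>tree\<close> from the library forbids directed cycles, and the two arcs of any edge form one
  (of length 2); for undirected graphs the cycles to be excluded are those of length at least 3.
\<close>

definition undirected_tree :: "'a pair_pre_digraph \<Rightarrow> bool" where
  "undirected_tree G \<longleftrightarrow> pair_graph G \<and> connected (with_proj G) \<and>
     \<not> (\<exists>c. pre_digraph.cycle (with_proj G) c \<and> length c \<ge> 3)"

definition non_pendent_vertices :: "'a pair_pre_digraph \<Rightarrow> 'a set" where
  "non_pendent_vertices G = {v \<in> pverts G. vertex_degree G v \<noteq> 1}"

text \<open>
  Matrices are indexed by numbers, so the vertices are listed in an arbitrary fixed order. Another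
  order conjugates the matrices below by a permutation matrix and leaves the spectrum unchanged.
\<close>

definition vertex_list :: "'a pair_pre_digraph \<Rightarrow> 'a list" where
  "vertex_list G = (SOME vs. distinct vs \<and> set vs = pverts G)"

definition adjacency_mat :: "'a pair_pre_digraph \<Rightarrow> real mat" where
  "adjacency_mat G = mat (graph_order G) (graph_order G)
     (\<lambda>(i, j). if (vertex_list G ! i, vertex_list G ! j) \<in> parcs G then 1 else 0)"

definition degree_mat :: "'a pair_pre_digraph \<Rightarrow> real mat" where
  "degree_mat G = mat (graph_order G) (graph_order G)
     (\<lambda>(i, j). if i = j then real (vertex_degree G (vertex_list G ! i)) else 0)"

definition laplacian_mat :: "'a pair_pre_digraph \<Rightarrow> real mat" where
  "laplacian_mat G = degree_mat G - adjacency_mat G"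

text \<open>
  The eigenvalues with multiplicity. The Laplacian matrix is real symmetric, so its characteristic
  polynomial splits over the reals and this multiset has \<open>graph_order G\<close> elements.
\<close>

definition laplacian_spectrum :: "'a pair_pre_digraph \<Rightarrow> real multiset" where
  "laplacian_spectrum G = proots (char_poly (laplacian_mat G))"

definition laplacian_energy :: "'a pair_pre_digraph \<Rightarrow> real" where
  "laplacian_energy G = (\<Sum>\<mu>\<in>#laplacian_spectrum G. \<bar>\<mu> - average_degree G\<bar>)"

definition laplacian_sigma :: "'a pair_pre_digraph \<Rightarrow> nat" where
  "laplacian_sigma G = size {#\<mu> \<in># laplacian_spectrum G. \<mu> \<ge> average_degree G#}"

definition graph_isomorphic :: "'a pair_pre_digraph \<Rightarrow> 'b pair_pre_digraph \<Rightarrow> bool" where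
  "graph_isomorphic G H \<longleftrightarrow> digraph_iso (with_proj G) (with_proj H)"

definition join_by_edge ::
  "'a pair_pre_digraph \<Rightarrow> 'a pair_pre_digraph \<Rightarrow> 'a \<Rightarrow> 'a \<Rightarrow> 'a pair_pre_digraph" where
  "join_by_edge G H u v =
     \<lparr>pverts = pverts G \<union> pverts H, parcs = parcs G \<union> parcs H \<union> {(u, v), (v, u)}\<rparr>"

definition path_graph :: "nat \<Rightarrow> nat pair_pre_digraph" where
  "path_graph n =
     \<lparr>pverts = {..<n}, parcs = {(i, j). i < n \<and> j < n \<and> (j = Suc i \<or> i = Suc j)}\<rparr>"

text \<open>
  \<open>sns_graph p ss\<close> is the rooted tree with \<open>p\<close> pendent vertices \<open>Root_Leaf k\<close> at the root and
  \<open>r = length ss\<close> vertices \<open>Child i\<close> of level 1, where \<open>Child i\<close> carries the \<open>s\<^sub>i = ss ! i\<close>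
  pendent vertices \<open>Child_Leaf i j\<close>.
\<close>

datatype sns_vertex = Root | Root_Leaf nat | Child nat | Child_Leaf nat nat

definition sns_downward_arcs :: "nat \<Rightarrow> nat list \<Rightarrow> sns_vertex rel" where
  "sns_downward_arcs p ss =
     {(Root, Root_Leaf k) | k. k < p} \<union>
     {(Root, Child i) | i. i < length ss} \<union>
     {(Child i, Child_Leaf i j) | i j. i < length ss \<and> j < ss ! i}"

definition sns_graph :: "nat \<Rightarrow> nat list \<Rightarrow> sns_vertex pair_pre_digraph" where
  "sns_graph p ss =
     \<lparr>pverts = {Root} \<union> {Root_Leaf k | k. k < p} \<union> {Child i | i. i < length ss} \<union>
               {Child_Leaf i j | i j. i < length ss \<and> j < ss ! i},
      parcs = sns_downward_arcs p ss \<union> (sns_downward_arcs p ss)\<inverse>\<rparr>"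

definition sns_tree_diam4 :: "'a pair_pre_digraph \<Rightarrow> bool" where
  "sns_tree_diam4 G \<longleftrightarrow> undirected_tree G \<and>
     (\<exists>p ss. length ss \<ge> 2 \<and> card {i. i < length ss \<and> ss ! i \<noteq> 0} \<ge> 2 \<and>
             graph_isomorphic G (sns_graph p ss))"

text \<open>The excluded families \<open>T(4;2a,2b)\<close>, \<open>T'\<close> and \<open>T''\<close>, up to isomorphism.\<close>

definition is_T4_tree :: "'a pair_pre_digraph \<Rightarrow> bool" where
  "is_T4_tree G \<longleftrightarrow> (\<exists>a b. a + b \<ge> 2 \<and> graph_isomorphic G (sns_graph 0 (replicate (a + b) 1)))"

definition is_T'_tree :: "'a pair_pre_digraph \<Rightarrow> bool" where
  "is_T'_tree G \<longleftrightarrow>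
     (\<exists>s1 r. r \<ge> 2 \<and> s1 \<ge> 2 \<and> graph_isomorphic G (sns_graph 0 (s1 # replicate (r - 1) 1)))"

definition is_T''_tree :: "'a pair_pre_digraph \<Rightarrow> bool" where
  "is_T''_tree G \<longleftrightarrow>
     (\<exists>s1 s2 r. r \<ge> 2 \<and> s1 \<ge> 2 \<and> s2 \<ge> 2 \<and>
        graph_isomorphic G (sns_graph 0 (s1 # s2 # replicate (r - 2) 1)))"

end

theory Submission
  imports Defs
begin

text \<open>
  By Ky Fan's principle \<open>2 * (\<Sum>i. q i - d)\<close> is at most the Laplacian energy of a graph with average
  degree \<open>d\<close>, where the \<open>q i\<close> are the Rayleigh quotients of any orthogonal family, and the
  eigenvectors with eigenvalue at least \<open>d\<close> attain the bound. On \<open>T\<close> we take those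
    eigenvectors of
  \<open>T1\<close> together with a family on \<open>T2\<close>. The former lose energy because the average degree
    grows;
  the loss is controlled by \<open>2 * \<sigma>\<^sub>1 \<le> n\<^sub>1\<close>, which the hypothesis
    \<open>\<sigma>\<^sub>1 = r\<^sub>1\<close> implies for trees.
  The latter gains \<open>4 * n\<^sub>2 / pi\<close>: a core of at most ten vertices of \<open>T2\<close> carries an
    explicit
  rational family, each level 1 vertex outside the core with leaves contributes one more vector, and
  each further leaf raises the Rayleigh quotients enough to pay for itself. The excluded trees are
  those without leaves at the root in which fewer than three vertices of level 1 have two leaves.
\<close>

section \<open>Real symmetric matrices\<close>

text \<open>The hypothesis on \<open>T1\<close> leaves nothing to spare: the summand 2 must reach
  \<open>T\<close> intact, so \<open>T2\<close> has to pay both for its own share and for the shift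
  of the average degree from 2 - 2/n1 to 2 - 2/n. That shift costs at most 2 n2/n, which is at most
  2/19 per vertex of \<open>T2\<close>; this is where n >= 19 enters. The other obstacle is that
  nothing is known about the eigenvectors of \<open>T1\<close> near the new edge. Left as they are,
  they gain from it only their total weight \<alpha> at \<open>u\<close>, which may be 0, so a gain
  has to be produced that holds for every \<alpha> between 0 and 1. Finally \<open>T2\<close> may be
  arbitrarily large while only finitely many families can be checked. Such a check extends to
  additional children of a core vertex if the weight that the family puts on this vertex is at least
  half of the price of one vertex. All test vectors are integer and carry their norms along, so that
  every check is an inequality between rationals; pi enters only through 4/pi <= 1.27325.\<close>

lemma symmetric_real_eigenvector:
  fixes A :: "real mat"
  assumes A: "A \<in> carrier_mat n n" and sym: "transpose_mat A = A" and n: "n > 0"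
  shows "\<exists>e v. v \<in> carrier_vec n \<and> v \<bullet> v = 1 \<and> A *\<^sub>v v = e \<cdot>\<^sub>v v"
proof -
  define C where "C = map_mat complex_of_real A"
  have C: "C \<in> carrier_mat n n" using A by (simp add: C_def)
  have "degree (char_poly C) = n" using degree_monic_char_poly[OF C] by simp
  then have "\<not> constant (poly (char_poly C))" using n by (simp add: constant_degree)
  then obtain e where "poly (char_poly C) e = 0"
    using fundamental_theorem_of_algebra by blast
  then have "eigenvalue C e" using eigenvalue_root_char_poly[OF C] by simp
  then obtain v where v: "v \<in> carrier_vec n" "v \<noteq> 0\<^sub>v n" and ev: "C *\<^sub>v v = e \<cdot>\<^sub>v v"
    using C unfolding eigenvalue_def eigenvector_def by auto
  have tC: "transpose_mat C = C" using sym unfolding C_def by (metis map_mat_transpose)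
  have cC: "conjugate (C *\<^sub>v v) = C *\<^sub>v conjugate v"
  proof
    show "dim_vec (conjugate (C *\<^sub>v v)) = dim_vec (C *\<^sub>v conjugate v)" using v C by simp
    fix i assume "i < dim_vec (C *\<^sub>v conjugate v)"
    then show "conjugate (C *\<^sub>v v) $ i = (C *\<^sub>v conjugate v) $ i"
      using v C A by (auto simp: scalar_prod_def C_def)
  qed
  have "(C *\<^sub>v v) \<bullet> conjugate v = v \<bullet> (C *\<^sub>v conjugate v)"
    using transpose_vec_mult_scalar[of C n n "conjugate v" v] tC v C by simp
  then have "e * (v \<bullet> conjugate v) = conjugate e * (v \<bullet> conjugate v)"
    unfolding ev cC[symmetric] using v
    by (simp add: conjugate_smult_vec smult_scalar_prod_distrib[of _ n] scalar_prod_smult_distrib[of _ n])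
  moreover have "v \<bullet> conjugate v \<noteq> 0" using v conjugate_square_eq_0_vec by blast
  ultimately have "e = conjugate e" by simp
  then have e: "e = complex_of_real (Re e)" by (simp add: complex_eq_iff)
  \<comment> \<open>The eigenvector \<open>v\<close> of \<open>C\<close> may be genuinely complex.
    What descends to \<open>A\<close> is the eigenvalue, real by symmetry, as a root of the common
    characteristic polynomial.\<close>
  have "poly (char_poly A) (Re e) = 0"
  proof -
    have "char_poly C = map_poly complex_of_real (char_poly A)"
      unfolding C_def using of_real_hom.char_poly_hom[OF A] by simp
    then have "complex_of_real (poly (char_poly A) (Re e)) = 0"
      using \<open>poly (char_poly C) e = 0\<close> e by (metis of_real_hom.poly_map_poly)
    then show ?thesis by simp
  qed
  then have "eigenvalue A (Re e)" using eigenvalue_root_char_poly[OF A] by simp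
  then obtain w where w: "w \<in> carrier_vec n" "w \<noteq> 0\<^sub>v n" and ew:
    "A *\<^sub>v w = Re e \<cdot>\<^sub>v w"
    using A unfolding eigenvalue_def eigenvector_def by auto
  have "w \<bullet> w > 0"
    using w by (metis conjugate_square_greater_0_vec conjugate_id vec_conjugate_real)
  then have "(inverse (sqrt (w \<bullet> w)) \<cdot>\<^sub>v w) \<bullet> (inverse (sqrt (w \<bullet> w)) \<cdot>\<^sub>v w) = 1"
    using w by (simp add: smult_scalar_prod_distrib[of _ n] scalar_prod_smult_distrib[of _ n] field_simps)
  moreover have "A *\<^sub>v (inverse (sqrt (w \<bullet> w)) \<cdot>\<^sub>v w)
    = Re e \<cdot>\<^sub>v (inverse (sqrt (w \<bullet> w)) \<cdot>\<^sub>v w)"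
    using A w ew by (simp add: mult_mat_vec[OF A w(1)] smult_smult_assoc mult.commute)
  ultimately show ?thesis using w by (metis smult_carrier_vec)
qed


text \<open>The Householder reflection exchanging the first unit vector and \<open>v\<close>: the
  difference w of the two has squared length 2 (1 - v_0) = 2 c, so the reflection is 1 - w w^T / c.
  It is its own inverse and its own transpose.\<close>

lemma orthogonal_mat_with_column:
  fixes v :: "real vec"
  assumes v: "v \<in> carrier_vec n" and v1: "v \<bullet> v = 1" and n: "n > 0"
  shows "\<exists>H \<in> carrier_mat n n. transpose_mat H = H \<and> H * H = 1\<^sub>m n
    \<and> H *\<^sub>v unit_vec n 0 = v"
proof (cases "v = unit_vec n 0")
  case True
  then show ?thesis by (intro bexI[of _ "1\<^sub>m n"]) auto
next
  case False
  define c where "c = 1 - v $ 0"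
  have sq: "(\<Sum>i = 0..<n. v $ i * v $ i) = 1" using v1 v by (simp add: scalar_prod_def)
  have c: "c \<noteq> 0"
  proof
    assume "c = 0"
    then have v0: "v $ 0 = 1" by (simp add: c_def)
    have "(\<Sum>i = 0..<n. v $ i * v $ i) = v $ 0 * v $ 0 + (\<Sum>i \<in> {0..<n} - {0}. v $ i * v $ i)"
      by (rule sum.remove) (use n in auto)
    then have "(\<Sum>i \<in> {0..<n} - {0}. v $ i * v $ i) = 0" using sq v0 by simp
    then have "\<forall>i \<in> {0..<n} - {0}. v $ i * v $ i = 0"
      by (subst (asm) sum_nonneg_eq_0_iff) auto
    then have "v = unit_vec n 0" using v v0 by (intro eq_vecI) auto
    then show False using False by simp
  qed
  define w where "w i = v $ i - (if i = 0 then 1 else 0)" for i :: nat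
  have ww: "(\<Sum>i = 0..<n. w i * w i) = 2 * c"
  proof -
    have "(\<Sum>i = 0..<n. w i * w i)
        = (\<Sum>i = 0..<n. v $ i * v $ i + (if i = 0 then 1 - 2 * v $ 0 else 0))"
      by (rule sum.cong) (auto simp: w_def algebra_simps)
    also have "\<dots> = 2 * c" using n sq by (simp add: sum.distrib c_def)
    finally show ?thesis .
  qed
  define H where "H = mat n n (\<lambda>(i, j). (if i = j then 1 else 0) - w i * w j / c)"
  have "H * H = 1\<^sub>m n"
  proof (rule eq_matI)
    fix i j assume "i < dim_row (1\<^sub>m n :: real mat)" "j < dim_col (1\<^sub>m n :: real mat)"
    then have ij: "i < n" "j < n" by auto
    have "(H * H) $$ (i, j) = (\<Sum>k = 0..<n. ((if i = k then 1 else 0) - w i * w k / c)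
        * ((if k = j then 1 else 0) - w k * w j / c))"
      using ij by (simp add: H_def scalar_prod_def)
    also have "\<dots> = (\<Sum>k = 0..<n. (if i = k then (if k = j then 1 else 0) - w k * w j / c else 0)
        - (if k = j then w i * w k / c else 0) + (w i * w j / (c * c)) * (w k * w k))"
      by (rule sum.cong) (auto simp: algebra_simps)
    also have "\<dots> = (if i = j then 1 else 0) - w i * w j / c - w i * w j / c
        + (w i * w j / (c * c)) * (2 * c)"
      using ij by (simp add: sum.distrib sum_subtractf ww del: times_divide_eq_left flip: sum_distrib_left)
    also have "\<dots> = (if i = j then 1 else 0)" using c by (simp add: field_simps)
    finally show "(H * H) $$ (i, j) = 1\<^sub>m n $$ (i, j)" using ij by simp
  qed (auto simp: H_def)
  moreover have "transpose_mat H = H" by (rule eq_matI) (auto simp: H_def)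
  moreover have "H *\<^sub>v unit_vec n 0 = v"
  proof (rule eq_vecI)
    fix i assume "i < dim_vec v"
    then have i: "i < n" using v by simp
    have "(H *\<^sub>v unit_vec n 0) $ i = H $$ (i, 0)" using i n by (simp add: H_def)
    also have "\<dots> = (if i = 0 then 1 else 0) - w i * w 0 / c" using i n by (simp add: H_def)
    also have "w 0 = - c" by (simp add: w_def c_def)
    finally show "(H *\<^sub>v unit_vec n 0) $ i = v $ i" using c by (simp add: w_def)
  qed (use v in \<open>auto simp: H_def\<close>)
  ultimately show ?thesis by (intro bexI[of _ H]) (auto simp: H_def)
qed

text \<open>Deflation: conjugating by the reflection moves an eigenvector to the first coordinate.
  Symmetry then clears the first row along with the first column, and induction applies to the
  remaining block.\<close>

theorem real_spectral_theorem:
  fixes A :: "real mat"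
  assumes "A \<in> carrier_mat n n" and "transpose_mat A = A"
  shows "\<exists>Q ds. Q \<in> carrier_mat n n \<and> transpose_mat Q * Q = 1\<^sub>m n \<and> length ds = n
    \<and> A * Q = Q * mat_diag n (\<lambda>i. ds ! i)"
  using assms
proof (induction n arbitrary: A)
  case 0
  show ?case by (rule exI[of _ "1\<^sub>m 0"], rule exI[of _ "[]"]) (use 0 in \<open>auto simp: mat_diag_def\<close>)
next
  case (Suc n)
  obtain e v where v: "v \<in> carrier_vec (Suc n)" "v \<bullet> v = 1" and ev: "A *\<^sub>v v = e \<cdot>\<^sub>v v"
    using symmetric_real_eigenvector[OF Suc.prems] by blast
  obtain H where H: "H \<in> carrier_mat (Suc n) (Suc n)" "transpose_mat H = H" "H * H = 1\<^sub>m (Suc n)"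
    and H0: "H *\<^sub>v unit_vec (Suc n) 0 = v"
    using orthogonal_mat_with_column[OF v] by auto
  define B where "B = H * A * H"
  have B: "B \<in> carrier_mat (Suc n) (Suc n)" using H Suc.prems by (simp add: B_def)
  have tB: "transpose_mat B = B"
    using H Suc.prems unfolding B_def
    by (subst transpose_mult[of _ "Suc n" "Suc n" _ "Suc n"], simp_all)
       (subst transpose_mult[of _ "Suc n" "Suc n" _ "Suc n"], simp_all add: assoc_mult_mat[of _ "Suc n" "Suc n" _
         "Suc n" _ "Suc n"])
  have "B *\<^sub>v unit_vec (Suc n) 0 = H *\<^sub>v (A *\<^sub>v (H *\<^sub>v unit_vec (Suc n) 0))"
    using H Suc.prems unfolding B_def by (simp add: assoc_mult_mat_vec[of _ "Suc n" "Suc n" _ "Suc n"])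
  also have "\<dots> = e \<cdot>\<^sub>v (H *\<^sub>v v)" using H v unfolding H0 ev by (simp add: mult_mat_vec[of _
    "Suc n" "Suc n"])
  also have "H *\<^sub>v v = (H * H) *\<^sub>v unit_vec (Suc n) 0"
    using H(1) unfolding H0[symmetric] by (intro assoc_mult_mat_vec[symmetric]) auto
  also have "\<dots> = unit_vec (Suc n) 0" by (subst H(3)) simp
  finally have Be: "B *\<^sub>v unit_vec (Suc n) 0 = e \<cdot>\<^sub>v unit_vec (Suc n) 0" .
  have col0: "B $$ (i, 0) = (if i = 0 then e else 0)" if "i < Suc n" for i
  proof -
    have "B $$ (i, 0) = (B *\<^sub>v unit_vec (Suc n) 0) $ i" using that B by simp
    then show ?thesis unfolding Be using that by simp
  qed
  have row0: "B $$ (0, i) = (if i = 0 then e else 0)" if "i < Suc n" for i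
    using col0[OF that] tB B that by (metis index_transpose_mat(1) carrier_matD zero_less_Suc)
  define A' where "A' = mat n n (\<lambda>(i, j). B $$ (Suc i, Suc j))"
  have A': "A' \<in> carrier_mat n n" by (simp add: A'_def)
  have sB: "B $$ (i, j) = B $$ (j, i)" if "i < Suc n" "j < Suc n" for i j
    using tB B that by (metis index_transpose_mat(1) carrier_matD)
  have "transpose_mat A' = A'" by (rule eq_matI) (auto simp: A'_def intro!: sB)
  from Suc.IH[OF A' this] obtain Q ds where Q: "Q \<in> carrier_mat n n" "transpose_mat Q * Q = 1\<^sub>m n"
    and ds: "length ds = n" and AQ: "A' * Q = Q * mat_diag n (\<lambda>i. ds ! i)" by blast
  define E where "E = (mat 1 1 (\<lambda>_. e) :: real mat)"
  have E: "E \<in> carrier_mat 1 1" by (simp add: E_def)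
  define F where "F = four_block_mat (1\<^sub>m 1) (0\<^sub>m 1 n) (0\<^sub>m n 1) Q"
  have F: "F \<in> carrier_mat (Suc n) (Suc n)" using Q four_block_carrier_mat[of "1\<^sub>m 1" 1 1 Q n n] by (simp
    add: F_def)
  have Bb: "B = four_block_mat E (0\<^sub>m 1 n) (0\<^sub>m n 1) A'"
    by (rule eq_matI) (use B A' E col0 row0 in \<open>auto simp: E_def A'_def\<close>)
  have tF: "transpose_mat F = four_block_mat (1\<^sub>m 1) (0\<^sub>m 1 n) (0\<^sub>m n 1) (transpose_mat Q)"
    unfolding F_def by (subst transpose_four_block_mat[of _ 1 1 _ n _ n]) (use Q in auto)
  have FF: "transpose_mat F * F = 1\<^sub>m (Suc n)"
    unfolding tF unfolding F_def
    by (subst mult_four_block_mat[of _ 1 1 _ n _ n _ _ 1 _ n]) (use Q in auto)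
  define D where "D = mat_diag (Suc n) (\<lambda>i. (e # ds) ! i)"
  have Db: "D = four_block_mat E (0\<^sub>m 1 n) (0\<^sub>m n 1) (mat_diag n (\<lambda>i. ds ! i))"
    by (rule eq_matI) (auto simp: D_def E_def mat_diag_def)
  have md: "mat_diag n (\<lambda>i. ds ! i) \<in> carrier_mat n n" by (simp add: mat_diag_def)
  have BF: "B * F = F * D"
    unfolding Bb Db F_def
    by (subst mult_four_block_mat[of _ 1 1 _ n _ n _ _ 1 _ n], use Q E A' md in simp_all)
       (subst mult_four_block_mat[of _ 1 1 _ n _ n _ _ 1 _ n], use Q E A' md AQ in \<open>simp_all add:
         left_mult_zero_mat[OF md]\<close>)
  have D: "D \<in> carrier_mat (Suc n) (Suc n)" by (simp add: D_def mat_diag_def)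
  note as = assoc_mult_mat[of _ "Suc n" "Suc n" _ "Suc n" _ "Suc n"]
  have "H * (B * F) = H * (H * (A * (H * F)))"
    using H(1) F Suc.prems(1) unfolding B_def by (simp add: as)
  also have "\<dots> = (H * H) * (A * (H * F))"
    using H(1) F Suc.prems(1) by (intro assoc_mult_mat[symmetric]) auto
  also have "\<dots> = A * (H * F)"
    unfolding H(3) using H(1) F Suc.prems(1) by (intro left_mult_one_mat) auto
  finally have "A * (H * F) = H * (B * F)" by simp
  also have "\<dots> = (H * F) * D" unfolding BF using H F D by (simp add: as)
  finally have 1: "A * (H * F) = (H * F) * D" .
  have "transpose_mat (H * F) * (H * F) = transpose_mat F * (H * (H * F))"
    using H(1,2) F by (simp add: transpose_mult[of _ "Suc n" "Suc n" _ "Suc n"] as)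
  also have "H * (H * F) = H * H * F"
    using H(1) F by (intro assoc_mult_mat[symmetric]) auto
  also have "\<dots> = F" unfolding H(3) using F by simp
  finally have 2: "transpose_mat (H * F) * (H * F) = 1\<^sub>m (Suc n)" unfolding FF .
  show ?case
    by (rule exI[of _ "H * F"], rule exI[of _ "e # ds"]) (use 1 2 H F ds D_def in auto)
qed

section \<open>Eigenvalues with multiplicity from a diagonalisation\<close>

lemma proots_prod_linear: "proots (\<Prod>d\<leftarrow>ds. [:- d, 1:]) = mset (ds :: 'a :: idom list)"
proof (induction ds)
  case (Cons d ds)
  have "(\<Prod>d\<leftarrow>ds. [:- d, 1:]) \<noteq> 0" by (auto simp: prod_list_zero_iff)
  then show ?case using Cons by (simp add: proots_mult del: mult_pCons_left)
qed simp

lemma proots_char_poly_orthogonal: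
  fixes A :: "real mat"
  assumes A: "A \<in> carrier_mat n n" and Q: "Q \<in> carrier_mat n n" "transpose_mat Q * Q = 1\<^sub>m n"
    and AQ: "A * Q = Q * mat_diag n (\<lambda>i. ds ! i)" and ds: "length ds = n"
  shows "proots (char_poly A) = mset ds"
proof -
  have D: "mat_diag n (\<lambda>i. ds ! i) \<in> carrier_mat n n" by (simp add: mat_diag_def)
  have QQ: "Q * transpose_mat Q = 1\<^sub>m n" using mat_mult_left_right_inverse[of "transpose_mat Q" n Q] Q by simp
  have "A = A * (Q * transpose_mat Q)" using A by (simp add: QQ)
  also have "\<dots> = Q * mat_diag n (\<lambda>i. ds ! i) * transpose_mat Q"
    unfolding AQ[symmetric] using A Q by (intro assoc_mult_mat[symmetric]) auto
  finally have AE: "A = Q * mat_diag n (\<lambda>i. ds ! i) * transpose_mat Q" .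
  have "similar_mat A (mat_diag n (\<lambda>i. ds ! i))"
    by (rule similar_matI[OF _ QQ Q(2) AE]) (use A Q D in auto)
  then have "char_poly A = char_poly (mat_diag n (\<lambda>i. ds ! i))" by (rule char_poly_similar)
  also have "\<dots> = (\<Prod>d\<leftarrow>diag_mat (mat_diag n (\<lambda>i. ds ! i)). [:- d, 1:])"
    by (rule char_poly_upper_triangular[OF D]) (auto simp: mat_diag_def)
  also have "diag_mat (mat_diag n (\<lambda>i. ds ! i)) = ds"
    by (rule nth_equalityI) (auto simp: diag_mat_def mat_diag_def ds)
  finally show ?thesis by (simp add: proots_prod_linear)
qed

section \<open>The Laplacian quadratic form\<close>

text \<open>The Laplacian as an operator on functions of the vertices. Working with functions keeps
  the numbering by \<open>vertex_list\<close> out of the energy estimates.\<close>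

definition lap :: "'a pair_pre_digraph \<Rightarrow> ('a \<Rightarrow> real) \<Rightarrow> 'a \<Rightarrow> real" where
  "lap G x a = (\<Sum>b | (a, b) \<in> parcs G. x a - x b)"

text \<open>The quadratic form of the Laplacian. Each edge occurs as two arcs, hence the
  half.\<close>

definition edge_form :: "'a pair_pre_digraph \<Rightarrow> ('a \<Rightarrow> real) \<Rightarrow> real" where
  "edge_form G x = (\<Sum>(a, b)\<in>parcs G. (x a - x b)\<^sup>2) / 2"

lemma vertex_degree_eq: "vertex_degree G a = card {b. (a, b) \<in> parcs G}"
proof -
  have "out_arcs (with_proj G) a = (\<lambda>b. (a, b)) ` {b. (a, b) \<in> parcs G}"
    by (auto simp: out_arcs_def)
  then show ?thesis by (simp add: out_degree_def card_image inj_on_def)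
qed

context pair_graph
begin

lemma no_loop: "(a, a) \<notin> parcs G"
  using pair_no_loops[of "(a, a)"] by auto

lemma finite_nbrs [simp]: "finite {b. (a, b) \<in> parcs G}"
proof (rule finite_subset[OF _ pair_finite_verts])
  show "{b. (a, b) \<in> parcs G} \<subseteq> pverts G" using in_arcsD2 by blast
qed

lemma parcs_Sigma: "parcs G = (SIGMA a:pverts G. {b. (a, b) \<in> parcs G})"
proof (rule equalityI; rule subrelI)
  fix a b assume "(a, b) \<in> parcs G"
  then show "(a, b) \<in> (SIGMA a:pverts G. {b. (a, b) \<in> parcs G})" using in_arcsD1 by simp
qed simp

lemma sum_parcs: "(\<Sum>(a, b)\<in>parcs G. f a b) = (\<Sum>a\<in>pverts G. \<Sum>b | (a, b) \<in> parcs G. f a b)"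
proof -
  have "(\<Sum>a\<in>pverts G. \<Sum>b\<in>{b. (a, b) \<in> parcs G}. f a b)
      = (\<Sum>(a, b)\<in>(SIGMA a:pverts G. {b. (a, b) \<in> parcs G}). f a b)"
    by (rule sum.Sigma) (simp_all add: pair_finite_verts)
  then show ?thesis unfolding parcs_Sigma[symmetric] by simp
qed

lemma sum_parcs_swap: "(\<Sum>(a, b)\<in>parcs G. f a b) = (\<Sum>(a, b)\<in>parcs G. f b a)"
proof (rule sum.reindex_bij_witness[of _ prod.swap prod.swap])
  show "prod.swap p \<in> parcs G" if "p \<in> parcs G" for p
    using that arcs_symmetric[of "fst p" "snd p"] by (simp add: prod.swap_def)
  then show "prod.swap p \<in> parcs G" if "p \<in> parcs G" for p
    using that by blast
qed (auto split: prod.split)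

text \<open>Summation by parts: averaging the sum with the one over the reversed arcs symmetrises
  it.\<close>

lemma green: "(\<Sum>a\<in>pverts G. y a * lap G x a) = (\<Sum>(a, b)\<in>parcs G. (x a - x b) * (y a - y b)) / 2"
proof -
  have 1: "(\<Sum>a\<in>pverts G. y a * lap G x a) = (\<Sum>(a, b)\<in>parcs G. y a * (x a - x b))"
    by (simp add: lap_def sum_distrib_left sum_parcs)
  also have "\<dots> = (\<Sum>(a, b)\<in>parcs G. y b * (x b - x a))" by (rule sum_parcs_swap)
  finally have "2 * (\<Sum>a\<in>pverts G. y a * lap G x a)
      = (\<Sum>(a, b)\<in>parcs G. y a * (x a - x b)) + (\<Sum>(a, b)\<in>parcs G. y b * (x b - x a))"
    using 1 by simp
  also have "\<dots> = (\<Sum>(a, b)\<in>parcs G. (x a - x b) * (y a - y b))"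
    by (subst sum.distrib[symmetric], rule sum.cong) (auto simp: algebra_simps)
  finally show ?thesis by simp
qed

lemma edge_form_eq: "edge_form G x = (\<Sum>a\<in>pverts G. x a * lap G x a)"
  by (simp add: green edge_form_def power2_eq_square)

lemma card_parcs: "card (parcs G) = 2 * graph_size G"
proof -
  let ?E = "(\<lambda>(u, v). {u, v}) ` parcs G"
  have "card (parcs G) = (\<Sum>e\<in>?E. \<Sum>p | p \<in> parcs G \<and> (\<lambda>(u, v). {u, v}) p = e. 1)"
    unfolding card_eq_sum by (rule sum.image_gen) (simp add: pair_finite_arcs)
  also have "\<dots> = (\<Sum>e\<in>?E. 2)"
  proof (rule sum.cong)
    fix e assume "e \<in> ?E"
    then obtain a b where ab: "(a, b) \<in> parcs G" "e = {a, b}" by auto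
    have "{u, v} = e \<longleftrightarrow> (u, v) = (a, b) \<or> (u, v) = (b, a)" for u v
      unfolding ab(2) by (simp add: doubleton_eq_iff)
    then have "(\<lambda>(u, v). {u, v}) p = e \<longleftrightarrow> p = (a, b) \<or> p = (b, a)" for p
      by (cases p) (simp only: prod.case)
    then have "{p. p \<in> parcs G \<and> (\<lambda>(u, v). {u, v}) p = e} = {p \<in> parcs G. p = (a, b) \<or> p
      = (b, a)}"
      by simp
    also have "\<dots> = {(a, b), (b, a)}" using ab(1) arcs_symmetric[OF ab(1)] by blast
    finally have "{p. p \<in> parcs G \<and> (\<lambda>(u, v). {u, v}) p = e} = {(a, b), (b, a)}" .
    moreover have "a \<noteq> b" using ab no_loop by auto
    ultimately show "(\<Sum>p | p \<in> parcs G \<and> (\<lambda>(u, v). {u, v}) p = e. 1) = (2 :: nat)" by simp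
  qed simp
  finally show ?thesis by (simp add: graph_size_def)
qed

lemma card_parcs_degree: "card (parcs G) = (\<Sum>a\<in>pverts G. vertex_degree G a)"
proof -
  have "card (SIGMA a:pverts G. {b. (a, b) \<in> parcs G}) = (\<Sum>a\<in>pverts G. card {b. (a, b) \<in> parcs G})"
    by (rule card_SigmaI) (simp_all add: pair_finite_verts)
  then show ?thesis unfolding parcs_Sigma[symmetric] vertex_degree_eq .
qed

lemma vertex_list: "distinct (vertex_list G)" "set (vertex_list G) = pverts G"
    "length (vertex_list G) = graph_order G"
proof -
  have "\<exists>vs. distinct vs \<and> set vs = pverts G" using finite_distinct_list[OF pair_finite_verts] by blast
  then have "distinct (vertex_list G) \<and> set (vertex_list G) = pverts G"
    unfolding vertex_list_def by (rule someI_ex)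
  then show "distinct (vertex_list G)" "set (vertex_list G) = pverts G"
    "length (vertex_list G) = graph_order G"
    by (auto simp: graph_order_def distinct_card[symmetric])
qed

lemma sum_pverts: "(\<Sum>a\<in>pverts G. f a) = (\<Sum>i<graph_order G. f (vertex_list G ! i))"
  using vertex_list by (intro sum.reindex_bij_betw[symmetric] bij_betw_nth) auto

lemma laplacian_mat_carrier: "laplacian_mat G \<in> carrier_mat (graph_order G) (graph_order G)"
  unfolding laplacian_mat_def degree_mat_def adjacency_mat_def by (intro minus_carrier_mat) simp

lemma laplacian_mat_sym: "transpose_mat (laplacian_mat G) = laplacian_mat G"
proof (rule eq_matI)
  fix i j assume "i < dim_row (laplacian_mat G)" "j < dim_col (laplacian_mat G)"
  moreover have "(vertex_list G ! i, vertex_list G ! j) \<in> parcs G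
    \<longleftrightarrow> (vertex_list G ! j, vertex_list G ! i) \<in> parcs G"
    using arcs_symmetric by blast
  ultimately show "transpose_mat (laplacian_mat G) $$ (i, j) = laplacian_mat G $$ (i, j)"
    by (auto simp: laplacian_mat_def degree_mat_def adjacency_mat_def)
qed (auto simp: laplacian_mat_def degree_mat_def adjacency_mat_def)

lemma laplacian_mat_mult:
  assumes "i < graph_order G"
  shows "(\<Sum>j<graph_order G. laplacian_mat G $$ (i, j) * x (vertex_list G ! j)) = lap G x (vertex_list G ! i)"
proof -
  let ?v = "\<lambda>i. vertex_list G ! i"
  have inj: "?v i = ?v j \<longleftrightarrow> i = j" if "j < graph_order G" for j
    using vertex_list assms that by (simp add: nth_eq_iff_index_eq)
  have vi: "?v i \<in> pverts G" using vertex_list assms by (metis nth_mem)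
  have "(\<Sum>j<graph_order G. laplacian_mat G $$ (i, j) * x (?v j))
      = (\<Sum>j<graph_order G. (if ?v i = ?v j then real (vertex_degree G (?v i)) * x (?v i) else 0)
          - (if (?v i, ?v j) \<in> parcs G then x (?v j) else 0))"
    by (rule sum.cong)
       (use assms inj in \<open>auto simp: laplacian_mat_def degree_mat_def adjacency_mat_def no_loop\<close>)
  also have "\<dots> = (\<Sum>b\<in>pverts G. (if ?v i = b then real (vertex_degree G (?v i)) * x (?v i) else 0)
          - (if (?v i, b) \<in> parcs G then x b else 0))"
    by (rule sum_pverts[symmetric])
  also have "\<dots> = real (vertex_degree G (?v i)) * x (?v i) - (\<Sum>b\<in>pverts G. if (?v i, b) \<in> parcs G then x b else 0)"
    using vi pair_finite_verts by (simp add: sum_subtractf)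
  also have "(\<Sum>b\<in>pverts G. if (?v i, b) \<in> parcs G then x b else 0)
    = (\<Sum>b | (?v i, b) \<in> parcs G. x b)"
    by (rule sum.mono_neutral_cong_right) (auto simp: pair_finite_verts dest: in_arcsD2)
  finally show ?thesis by (simp add: lap_def sum_subtractf vertex_degree_eq)
qed

text \<open>Orthonormality of the columns of the diagonalising matrix gives that of the
  \<open>z i\<close>. Orthonormality of its rows is completeness, which the expansion of arbitrary
  functions and the computation of the trace rely on.\<close>

lemma spectral_decomposition:
  obtains ds :: "real list" and z :: "nat \<Rightarrow> 'a \<Rightarrow> real"
  where "length ds = graph_order G" "laplacian_spectrum G = mset ds"
    and "\<And>i j. i < graph_order G \<Longrightarrow> j < graph_order G \<Longrightarrow>
      (\<Sum>a\<in>pverts G. z i a * z j a) = (if i = j then 1 else 0)"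
    and "\<And>a b. a \<in> pverts G \<Longrightarrow> b \<in> pverts G \<Longrightarrow>
      (\<Sum>i<graph_order G. z i a * z i b) = (if a = b then 1 else 0)"
    and "\<And>i a. i < graph_order G \<Longrightarrow> a \<in> pverts G \<Longrightarrow> lap G (z i) a
      = ds ! i * z i a"
proof -
  define n where "n = graph_order G"
  let ?v = "\<lambda>i. vertex_list G ! i"
  note L = laplacian_mat_carrier[folded n_def]
  obtain Q ds where Q: "Q \<in> carrier_mat n n" "transpose_mat Q * Q = 1\<^sub>m n" and ds: "length ds = n"
    and LQ: "laplacian_mat G * Q = Q * mat_diag n (\<lambda>i. ds ! i)"
    using real_spectral_theorem[OF L laplacian_mat_sym] by blast
  have spec: "laplacian_spectrum G = mset ds"
    unfolding laplacian_spectrum_def by (rule proots_char_poly_orthogonal[OF L Q LQ ds])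
  have QQ: "Q * transpose_mat Q = 1\<^sub>m n"
    using mat_mult_left_right_inverse[of "transpose_mat Q" n Q] Q by simp
  define idx where "idx a = (THE i. i < n \<and> ?v i = a)" for a
  have idx: "idx (?v i) = i" if "i < n" for i
    unfolding idx_def using vertex_list that
    by (intro the_equality) (auto simp: nth_eq_iff_index_eq n_def)
  define z where "z i a = Q $$ (idx a, i)" for i a
  have ex: "\<exists>i<n. a = ?v i" if "a \<in> pverts G" for a
    using that vertex_list by (metis in_set_conv_nth n_def)
  show ?thesis
  proof (rule that[of ds z])
    fix i j assume ij: "i < graph_order G" "j < graph_order G"
    have "(\<Sum>a\<in>pverts G. z i a * z j a) = (\<Sum>k<n. Q $$ (k, i) * Q $$ (k, j))"
      by (simp add: sum_pverts z_def idx flip: n_def)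
    also have "\<dots> = (transpose_mat Q * Q) $$ (i, j)"
      using ij Q(1) by (simp add: scalar_prod_def n_def atLeast0LessThan)
    finally show "(\<Sum>a\<in>pverts G. z i a * z j a) = (if i = j then 1 else 0)"
      unfolding Q(2) using ij by (simp add: n_def)
  next
    fix a b assume "a \<in> pverts G" "b \<in> pverts G"
    then obtain i j where ij: "i < n" "j < n" "a = ?v i" "b = ?v j" using ex by metis
    have "(\<Sum>k<graph_order G. z k a * z k b) = (Q * transpose_mat Q) $$ (i, j)"
      using ij Q(1) by (simp add: scalar_prod_def z_def idx atLeast0LessThan flip: n_def)
    moreover have "a = b \<longleftrightarrow> i = j" using ij vertex_list by (simp add: nth_eq_iff_index_eq n_def)
    ultimately show "(\<Sum>k<graph_order G. z k a * z k b) = (if a = b then 1 else 0)"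
      unfolding QQ using ij by simp
  next
    fix i a assume i: "i < graph_order G" and "a \<in> pverts G"
    then obtain k where k: "k < n" "a = ?v k" using ex by metis
    have "lap G (z i) a = (\<Sum>j<n. laplacian_mat G $$ (k, j) * Q $$ (j, i))"
      unfolding k(2) using k by (subst laplacian_mat_mult[symmetric]) (auto simp: n_def z_def idx intro!: sum.cong)
    also have "\<dots> = (laplacian_mat G * Q) $$ (k, i)"
      using i k Q(1) L by (simp add: scalar_prod_def n_def atLeast0LessThan)
    also have "\<dots> = (Q * mat_diag n (\<lambda>i. ds ! i)) $$ (k, i)" unfolding LQ ..
    also have "\<dots> = Q $$ (k, i) * ds ! i"
      using i k by (subst mat_diag_mult_right[OF Q(1)]) (auto simp: n_def)
    finally show "lap G (z i) a = ds ! i * z i a" using k by (simp add: z_def idx)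
  qed (use ds spec in \<open>auto simp: n_def\<close>)
qed

end

section \<open>Energy and orthogonal families: Parseval, Bessel, Ky Fan\<close>

context pair_graph
begin

lemma average_degree_order:
  assumes "pverts G \<noteq> {}"
  shows "average_degree G * real (graph_order G) = real (card (parcs G))"
  using assms pair_finite_verts by (simp add: average_degree_def card_parcs graph_order_def)

lemma lap_sum:
  "lap G (\<lambda>a. \<Sum>l\<in>S. q l * z l a) a = (\<Sum>l\<in>S. q l * lap G (z l) a)"
  unfolding lap_def by (simp add: sum_subtractf[symmetric] sum_distrib_left algebra_simps)
    (subst sum.swap, simp add: sum_subtractf algebra_simps)

text \<open>Completeness makes \<open>x\<close> the sum of its components along the
  \<open>z l\<close>; both identities follow by inserting this expansion for one of the two
  factors.\<close>

lemma spectral_parseval: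
  assumes complete: "\<And>a b. a \<in> pverts G \<Longrightarrow> b \<in> pverts G \<Longrightarrow>
      (\<Sum>i<n. z i a * z i b) = (if a = b then 1 else 0)"
    and eig: "\<And>i a. i < n \<Longrightarrow> a \<in> pverts G \<Longrightarrow> lap G (z i) a = d i * z i a"
  shows "(\<Sum>a\<in>pverts G. (x a)\<^sup>2) = (\<Sum>l<n. (\<Sum>a\<in>pverts G. x a * z l a)\<^sup>2)"
    and "edge_form G x = (\<Sum>l<n. d l * (\<Sum>a\<in>pverts G. x a * z l a)\<^sup>2)"
proof -
  define q where "q l = (\<Sum>a\<in>pverts G. x a * z l a)" for l
  have x: "x a = (\<Sum>l<n. q l * z l a)" if a: "a \<in> pverts G" for a
  proof -
    have "(\<Sum>l<n. q l * z l a) = (\<Sum>l<n. \<Sum>b\<in>pverts G. x b * (z l b * z l a))"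
      by (simp add: q_def sum_distrib_right mult.assoc)
    also have "\<dots> = (\<Sum>b\<in>pverts G. x b * (\<Sum>l<n. z l b * z l a))"
      by (subst sum.swap) (simp add: sum_distrib_left)
    also have "\<dots> = (\<Sum>b\<in>pverts G. if b = a then x b else 0)"
      by (rule sum.cong) (auto simp: complete a)
    also have "\<dots> = x a" using a pair_finite_verts by simp
    finally show ?thesis by simp
  qed
  have "(\<Sum>a\<in>pverts G. (x a)\<^sup>2) = (\<Sum>a\<in>pverts G. x a * (\<Sum>l<n. q l * z l a))"
    by (rule sum.cong) (auto simp: power2_eq_square simp flip: x)
  also have "\<dots> = (\<Sum>l<n. q l * (\<Sum>a\<in>pverts G. x a * z l a))"
    by (simp add: sum_distrib_left) (subst sum.swap, simp add: mult.left_commute)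
  finally show "(\<Sum>a\<in>pverts G. (x a)\<^sup>2) = (\<Sum>l<n. (\<Sum>a\<in>pverts G. x a * z l a)\<^sup>2)"
    by (simp add: q_def power2_eq_square)
  have lx: "lap G x a = (\<Sum>l<n. q l * (d l * z l a))" if a: "a \<in> pverts G" for a
  proof -
    have "lap G x a = lap G (\<lambda>a. \<Sum>l<n. q l * z l a) a"
      unfolding lap_def by (rule sum.cong) (use x a in \<open>auto dest: in_arcsD2\<close>)
    also have "\<dots> = (\<Sum>l<n. q l * (d l * z l a))" unfolding lap_sum using eig a by simp
    finally show ?thesis .
  qed
  have "edge_form G x = (\<Sum>a\<in>pverts G. x a * (\<Sum>l<n. q l * (d l * z l a)))"
    unfolding edge_form_eq by (rule sum.cong) (auto simp: lx)
  also have "\<dots> = (\<Sum>l<n. d l * q l * (\<Sum>a\<in>pverts G. x a * z l a))"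
    by (simp add: sum_distrib_left) (subst sum.swap, simp add: mult_ac)
  finally show "edge_form G x = (\<Sum>l<n. d l * (\<Sum>a\<in>pverts G. x a * z l a)\<^sup>2)"
    by (simp add: q_def power2_eq_square mult.assoc)
qed

text \<open>The squared distance from \<open>z\<close> to its projection onto the family is
  nonnegative. Norms \<open>N i\<close> are carried along instead of normalising, so that integer
  test vectors need no square roots.\<close>

lemma bessel:
  fixes x :: "'i \<Rightarrow> 'a \<Rightarrow> real"
  assumes I: "finite I" and pos: "\<And>i. i \<in> I \<Longrightarrow> N i > 0"
    and N: "\<And>i. i \<in> I \<Longrightarrow> (\<Sum>a\<in>V. (x i a)\<^sup>2) = N i"
    and orth: "\<And>i j. i \<in> I \<Longrightarrow> j \<in> I \<Longrightarrow> i \<noteq> j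
      \<Longrightarrow> (\<Sum>a\<in>V. x i a * x j a) = 0"
  shows "(\<Sum>i\<in>I. (\<Sum>a\<in>V. x i a * z a)\<^sup>2 / N i) \<le> (\<Sum>a\<in>V. (z a)\<^sup>2)"
proof -
  define c where "c i = (\<Sum>a\<in>V. x i a * z a) / N i" for i
  have c: "(\<Sum>a\<in>V. x i a * z a) = c i * N i" if "i \<in> I" for i using pos[OF that] by (simp add: c_def)
  have "0 \<le> (\<Sum>a\<in>V. (z a - (\<Sum>i\<in>I. c i * x i a))\<^sup>2)" by (simp add: sum_nonneg)
  also have "\<dots> = (\<Sum>a\<in>V. (z a)\<^sup>2) - 2 * (\<Sum>a\<in>V. \<Sum>i\<in>I. c i * (x i a * z a))
      + (\<Sum>a\<in>V. (\<Sum>i\<in>I. c i * x i a)\<^sup>2)"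
    by (simp add: power2_diff sum.distrib sum_subtractf sum_distrib_left mult_ac)
  also have "(\<Sum>a\<in>V. \<Sum>i\<in>I. c i * (x i a * z a)) = (\<Sum>i\<in>I. c i * (\<Sum>a\<in>V. x i a * z a))"
    by (subst sum.swap) (simp add: sum_distrib_left)
  also have "\<dots> = (\<Sum>i\<in>I. (c i)\<^sup>2 * N i)"
    by (rule sum.cong) (auto simp: c power2_eq_square)
  also have "(\<Sum>a\<in>V. (\<Sum>i\<in>I. c i * x i a)\<^sup>2)
    = (\<Sum>a\<in>V. \<Sum>i\<in>I. \<Sum>j\<in>I. c i * c j * (x i a * x j a))"
    by (simp add: power2_eq_square sum_product mult_ac)
  also have "\<dots> = (\<Sum>i\<in>I. \<Sum>j\<in>I. c i * c j * (\<Sum>a\<in>V. x i a * x j a))"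
    by (subst sum.swap, rule sum.cong, simp, subst sum.swap) (simp add: sum_distrib_left)
  also have "\<dots> = (\<Sum>i\<in>I. \<Sum>j\<in>I. if i = j then (c i)\<^sup>2 * N i else 0)"
    by (intro sum.cong refl) (auto simp: orth N[symmetric] power2_eq_square)
  also have "\<dots> = (\<Sum>i\<in>I. (c i)\<^sup>2 * N i)" using I by simp
  finally have "(\<Sum>i\<in>I. (c i)\<^sup>2 * N i) \<le> (\<Sum>a\<in>V. (z a)\<^sup>2)" by simp
  moreover have "(\<Sum>i\<in>I. (c i)\<^sup>2 * N i) = (\<Sum>i\<in>I. (\<Sum>a\<in>V. x i a * z a)\<^sup>2 / N i)"
    by (rule sum.cong) (use pos in \<open>force simp: c_def power2_eq_square\<close>)+
  ultimately show ?thesis by simp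
qed

text \<open>The trace of the Laplacian, computed through completeness: for an arc (a, b) the sum of
  z a * (z a - z b) over all eigenvectors is 1, and the number of arcs is the average degree times
  the order.\<close>

lemma sum_eigenvalues:
  assumes ne: "pverts G \<noteq> {}" and ds: "length ds = graph_order G"
    and orth: "\<And>i. i < graph_order G \<Longrightarrow> (\<Sum>a\<in>pverts G. z i a * z i a) = 1"
    and complete: "\<And>a b. a \<in> pverts G \<Longrightarrow> b \<in> pverts G \<Longrightarrow>
      (\<Sum>i<graph_order G. z i a * z i b) = (if a = b then 1 else 0)"
    and eig: "\<And>i a. i < graph_order G \<Longrightarrow> a \<in> pverts G \<Longrightarrow> lap G (z i) a
      = ds ! i * z i a"
  shows "(\<Sum>i<graph_order G. ds ! i - average_degree G) = 0"
proof -
  let ?n = "graph_order G"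
  have "(\<Sum>i<?n. ds ! i) = (\<Sum>i<?n. ds ! i * (\<Sum>a\<in>pverts G. z i a * z i a))"
    by (rule sum.cong) (auto simp: orth)
  also have "\<dots> = (\<Sum>i<?n. \<Sum>a\<in>pverts G. z i a * lap G (z i) a)"
    by (rule sum.cong) (auto simp: eig sum_distrib_left mult_ac)
  also have "\<dots> = (\<Sum>a\<in>pverts G. \<Sum>i<?n. \<Sum>b | (a, b) \<in> parcs G. z i a * z i a - z i a * z i b)"
    by (subst sum.swap) (simp add: lap_def sum_distrib_left algebra_simps)
  also have "\<dots> = (\<Sum>a\<in>pverts G. \<Sum>b | (a, b) \<in> parcs G. \<Sum>i<?n. z i a * z i a - z i a * z i b)"
    by (rule sum.cong[OF refl], rule sum.swap)
  also have "\<dots> = (\<Sum>a\<in>pverts G. \<Sum>b | (a, b) \<in> parcs G. 1)"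
  proof (intro sum.cong refl)
    fix a b assume "a \<in> pverts G" "b \<in> {b. (a, b) \<in> parcs G}"
    then have "a \<noteq> b" "a \<in> pverts G" "b \<in> pverts G" using no_loop by (auto dest: in_arcsD2)
    then show "(\<Sum>i<?n. z i a * z i a - z i a * z i b) = 1" by (simp add: sum_subtractf complete)
  qed
  also have "\<dots> = real (card (parcs G))"
    by (simp add: card_parcs_degree vertex_degree_eq)
  finally show ?thesis using average_degree_order[OF ne] by (simp add: sum_subtractf mult.commute)
qed

text \<open>By Bessel's inequality the total weight that the family puts on a single eigenvector
  lies between 0 and 1, so the sum on the left is at most the sum of the positive deviations from
  the average degree. That sum is half the energy because all deviations add up to zero.\<close>

theorem laplacian_energy_ge:
  assumes ne: "pverts G \<noteq> {}" and I: "finite I" and pos: "\<And>i. i \<in> I \<Longrightarrow> N i > 0"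
    and N: "\<And>i. i \<in> I \<Longrightarrow> (\<Sum>a\<in>pverts G. (x i a)\<^sup>2) = N i"
    and orth: "\<And>i j. i \<in> I \<Longrightarrow> j \<in> I \<Longrightarrow> i \<noteq> j
      \<Longrightarrow> (\<Sum>a\<in>pverts G. x i a * x j a) = 0"
  shows "2 * (\<Sum>i\<in>I. edge_form G (x i) / N i - average_degree G) \<le> laplacian_energy G"
proof -
  obtain ds z where ds: "length ds = graph_order G" "laplacian_spectrum G = mset ds"
    and on: "\<And>i j. i < graph_order G \<Longrightarrow> j < graph_order G \<Longrightarrow>
      (\<Sum>a\<in>pverts G. z i a * z j a) = (if i = j then 1 else 0)"
    and complete: "\<And>a b. a \<in> pverts G \<Longrightarrow> b \<in> pverts G \<Longrightarrow>
      (\<Sum>i<graph_order G. z i a * z i b) = (if a = b then 1 else 0)"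
    and eig: "\<And>i a. i < graph_order G \<Longrightarrow> a \<in> pverts G \<Longrightarrow> lap G (z i) a
      = ds ! i * z i a"
    by (rule spectral_decomposition) (rule that)
  let ?n = "graph_order G" and ?d = "average_degree G"
  define c where "c i l = (\<Sum>a\<in>pverts G. x i a * z l a)\<^sup>2 / N i" for i l
  have LE: "laplacian_energy G = (\<Sum>l<?n. \<bar>ds ! l - ?d\<bar>)"
    unfolding laplacian_energy_def ds(2)
    by (simp add: sum_mset_sum_list sum_list_sum_nth ds(1) atLeast0LessThan flip: mset_map)
  have "(\<Sum>l<?n. ds ! l - ?d) = 0"
    by (rule sum_eigenvalues[OF ne ds(1) _ complete eig]) (auto simp: on)
  moreover have "(\<Sum>l<?n. \<bar>ds ! l - ?d\<bar>) = (\<Sum>l<?n. 2 * max (ds ! l - ?d) 0 - (ds ! l - ?d))"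
    by (rule sum.cong) (auto simp: max_def abs_if)
  ultimately have LE2: "laplacian_energy G = 2 * (\<Sum>l<?n. max (ds ! l - ?d) 0)"
    unfolding LE by (simp only: sum_subtractf sum_distrib_left diff_0_right)
  have "(\<Sum>i\<in>I. edge_form G (x i) / N i - ?d) = (\<Sum>i\<in>I. \<Sum>l<?n. (ds ! l - ?d) * c i l)"
  proof (rule sum.cong[OF refl])
    fix i assume i: "i \<in> I"
    have "N i = (\<Sum>l<?n. (\<Sum>a\<in>pverts G. x i a * z l a)\<^sup>2)"
      using spectral_parseval(1)[OF complete eig] N[OF i] by simp
    moreover have "edge_form G (x i) = (\<Sum>l<?n. ds ! l * (\<Sum>a\<in>pverts G. x i a * z l a)\<^sup>2)"
      using spectral_parseval(2)[OF complete eig] by simp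
    ultimately have "edge_form G (x i) - ?d * N i
      = (\<Sum>l<?n. (ds ! l - ?d) * (\<Sum>a\<in>pverts G. x i a * z l a)\<^sup>2)"
      by (simp only: sum_distrib_left left_diff_distrib sum_subtractf)
    then have "(edge_form G (x i) - ?d * N i) / N i = (\<Sum>l<?n. (ds ! l - ?d) * c i l)"
      by (simp add: c_def sum_divide_distrib)
    then show "edge_form G (x i) / N i - ?d = (\<Sum>l<?n. (ds ! l - ?d) * c i l)"
      using pos[OF i] by (simp add: diff_divide_distrib)
  qed
  also have "\<dots> = (\<Sum>l<?n. (ds ! l - ?d) * (\<Sum>i\<in>I. c i l))"
    by (subst sum.swap) (simp add: sum_distrib_left)
  also have "\<dots> \<le> (\<Sum>l<?n. max (ds ! l - ?d) 0)"
  proof (rule sum_mono)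
    fix l assume l: "l \<in> {..<?n}"
    have "(\<Sum>i\<in>I. c i l) \<le> (\<Sum>a\<in>pverts G. (z l a)\<^sup>2)"
      unfolding c_def by (rule bessel[OF I pos N orth])
    then have "(\<Sum>i\<in>I. c i l) \<le> 1" using on[of l l] l by (simp add: power2_eq_square)
    moreover have "(\<Sum>i\<in>I. c i l) \<ge> 0"
      unfolding c_def by (rule sum_nonneg) (use pos less_imp_le in fastforce)
    ultimately show "(ds ! l - ?d) * (\<Sum>i\<in>I. c i l) \<le> max (ds ! l - ?d) 0"
      by (cases "ds ! l - ?d \<ge> 0")
         (auto simp: max_def mult_left_le mult_nonpos_nonneg)
  qed
  finally show ?thesis unfolding LE2 by simp
qed

theorem laplacian_energy_eigenvectors:
  assumes ne: "pverts G \<noteq> {}"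
  obtains I :: "nat set" and \<mu> :: "nat \<Rightarrow> real" and y :: "nat \<Rightarrow> 'a \<Rightarrow> real"
  where "finite I" "card I = laplacian_sigma G"
    and "\<And>i j. i \<in> I \<Longrightarrow> j \<in> I \<Longrightarrow> (\<Sum>a\<in>pverts G. y i a * y j a)
      = (if i = j then 1 else 0)"
    and "\<And>i a. i \<in> I \<Longrightarrow> a \<in> pverts G \<Longrightarrow> lap G (y i) a = \<mu> i * y i a"
    and "\<And>i. i \<in> I \<Longrightarrow> \<mu> i \<ge> average_degree G"
    and "laplacian_energy G = 2 * (\<Sum>i\<in>I. \<mu> i - average_degree G)"
proof -
  obtain ds z where ds: "length ds = graph_order G" "laplacian_spectrum G = mset ds"
    and on: "\<And>i j. i < graph_order G \<Longrightarrow> j < graph_order G \<Longrightarrow>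
      (\<Sum>a\<in>pverts G. z i a * z j a) = (if i = j then 1 else 0)"
    and complete: "\<And>a b. a \<in> pverts G \<Longrightarrow> b \<in> pverts G \<Longrightarrow>
      (\<Sum>i<graph_order G. z i a * z i b) = (if a = b then 1 else 0)"
    and eig: "\<And>i a. i < graph_order G \<Longrightarrow> a \<in> pverts G \<Longrightarrow> lap G (z i) a
      = ds ! i * z i a"
    by (rule spectral_decomposition) (rule that)
  let ?n = "graph_order G" and ?d = "average_degree G"
  define I where "I = {i. i < ?n \<and> ds ! i \<ge> ?d}"
  have "laplacian_sigma G = length (filter (\<lambda>\<mu>. \<mu> \<ge> ?d) ds)"
    unfolding laplacian_sigma_def ds(2) by (simp flip: mset_filter)
  also have "\<dots> = card I" by (simp add: length_filter_conv_card I_def ds(1))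
  finally have card: "card I = laplacian_sigma G" by simp
  have LE: "laplacian_energy G = (\<Sum>l<?n. \<bar>ds ! l - ?d\<bar>)"
    unfolding laplacian_energy_def ds(2)
    by (simp add: sum_mset_sum_list sum_list_sum_nth ds(1) atLeast0LessThan flip: mset_map)
  have "(\<Sum>l<?n. ds ! l - ?d) = 0"
    by (rule sum_eigenvalues[OF ne ds(1) _ complete eig]) (auto simp: on)
  moreover have "(\<Sum>l<?n. \<bar>ds ! l - ?d\<bar>)
      = (\<Sum>l<?n. 2 * (if ds ! l \<ge> ?d then ds ! l - ?d else 0) - (ds ! l - ?d))"
    by (rule sum.cong) auto
  ultimately have "laplacian_energy G = 2 * (\<Sum>l<?n. if ds ! l \<ge> ?d then ds ! l - ?d else 0)"
    unfolding LE by (simp only: sum_subtractf sum_distrib_left diff_0_right)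
  also have "(\<Sum>l<?n. if ds ! l \<ge> ?d then ds ! l - ?d else 0) = (\<Sum>l\<in>I. ds ! l - ?d)"
    by (rule sum.mono_neutral_cong_right) (auto simp: I_def)
  finally have "laplacian_energy G = 2 * (\<Sum>i\<in>I. ds ! i - ?d)" .
  then show ?thesis
    using card on eig by (intro that[of I z "\<lambda>i. ds ! i"]) (auto simp: I_def)
qed

end

section \<open>Trees\<close>

context pair_graph
begin

lemma connected_exit_arc:
  assumes con: "connected (with_proj G)" and S: "S \<subseteq> pverts G" "S \<noteq> {}" "S \<noteq> pverts G"
  shows "\<exists>a b. (a, b) \<in> parcs G \<and> a \<in> S \<and> b \<in> pverts G - S"
proof (rule ccontr)
  assume "\<not> ?thesis"
  then have closed: "b \<in> S" if "(a, b) \<in> parcs G" "a \<in> S" for a b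
    using that in_arcsD2 by blast
  obtain a b where ab: "a \<in> S" "b \<in> pverts G" "b \<notin> S" using S by blast
  have "strongly_connected (with_proj G)"
    using symmetric_connected_imp_strongly_connected[OF pair_sym_arcs con] .
  then have "a \<rightarrow>\<^sup>*\<^bsub>with_proj G\<^esub> b" using ab S(1) by (auto simp: strongly_connected_def)
  then have "b \<in> S" using ab(1)
    by (induction rule: reachable_induct) (auto intro: closed)
  then show False using ab by simp
qed

lemma finite_inner_arcs [simp]: "finite {(a, b) \<in> parcs G. a \<in> S \<and> b \<in> S}"
  by (rule finite_subset[OF _ pair_finite_arcs]) blast

lemma card_inner_arcs_insert:
  assumes "a \<notin> S"
  shows "card {(x, y) \<in> parcs G. x \<in> insert a S \<and> y \<in> insert a S}
    = card {(x, y) \<in> parcs G. x \<in> S \<and> y \<in> S} + 2 * card {b \<in> S. (a, b) \<in> parcs G}"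
proof -
  let ?N = "{b \<in> S. (a, b) \<in> parcs G}"
  have fin: "finite ?N" by (rule finite_subset[OF _ finite_nbrs[of a]]) blast
  have "{(x, y) \<in> parcs G. x \<in> insert a S \<and> y \<in> insert a S}
      = {(x, y) \<in> parcs G. x \<in> S \<and> y \<in> S} \<union> (Pair a ` ?N \<union> (\<lambda>b. (b, a)) ` ?N)"
  proof (rule equalityI; rule subrelI)
    fix x y assume *: "(x, y) \<in> {(x, y) \<in> parcs G. x \<in> insert a S \<and> y \<in> insert a S}"
    then have "x = a \<longrightarrow> y \<noteq> a" using no_loop by blast
    then show "(x, y) \<in> {(x, y) \<in> parcs G. x \<in> S \<and> y \<in> S} \<union> (Pair a ` ?N
      \<union> (\<lambda>b. (b, a)) ` ?N)"
      using * arcs_symmetric[of x y] by blast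
  next
    fix x y assume "(x, y) \<in> {(x, y) \<in> parcs G. x \<in> S \<and> y \<in> S} \<union> (Pair a ` ?N
      \<union> (\<lambda>b. (b, a)) ` ?N)"
    then show "(x, y) \<in> {(x, y) \<in> parcs G. x \<in> insert a S \<and> y \<in> insert a S}"
      using arcs_symmetric[of y x] by blast
  qed
  moreover have "card (Pair a ` ?N \<union> (\<lambda>b. (b, a)) ` ?N) = card (Pair a ` ?N)
    + card ((\<lambda>b. (b, a)) ` ?N)"
    using fin assms by (intro card_Un_disjoint) auto
  moreover have "card ({(x, y) \<in> parcs G. x \<in> S \<and> y \<in> S} \<union> (Pair a ` ?N
    \<union> (\<lambda>b. (b, a)) ` ?N))
      = card {(x, y) \<in> parcs G. x \<in> S \<and> y \<in> S} + card (Pair a ` ?N \<union> (\<lambda>b. (b, a)) ` ?N)"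
    using fin assms by (intro card_Un_disjoint) auto
  moreover have "card (Pair a ` ?N) = card ?N" "card ((\<lambda>b. (b, a)) ` ?N) = card ?N"
    by (auto intro!: card_image inj_onI)
  ultimately show ?thesis by simp
qed

text \<open>Growing a vertex set along arcs that leave it brings with each new vertex at least two
  arcs, one in each direction.\<close>

lemma connected_card_arcs:
  assumes con: "connected (with_proj G)" and ne: "pverts G \<noteq> {}"
  shows "2 * graph_order G \<le> card (parcs G) + 2"
proof -
  have grow: "\<exists>S \<subseteq> pverts G. card S = Suc k \<and> 2 * k \<le> card {(x, y) \<in> parcs G. x \<in> S
    \<and> y \<in> S}"
    if "k < graph_order G" for k
    using that
  proof (induction k)
    case 0
    obtain a where "a \<in> pverts G" using ne by blast
    then show ?case by (intro exI[of _ "{a}"]) auto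
  next
    case (Suc k)
    then obtain S where S: "S \<subseteq> pverts G" "card S = Suc k"
      "2 * k \<le> card {(x, y) \<in> parcs G. x \<in> S \<and> y \<in> S}" by auto
    have "S \<noteq> pverts G" using S(2) Suc.prems by (auto simp: graph_order_def)
    then obtain a b where ab: "(a, b) \<in> parcs G" "a \<in> S" "b \<in> pverts G" "b \<notin> S"
      using connected_exit_arc[OF con S(1)] S(2) by fastforce
    have fS: "finite S" using S(2) card.infinite by fastforce
    have "a \<in> {c \<in> S. (b, c) \<in> parcs G}" using ab arcs_symmetric by blast
    then have "card {c \<in> S. (b, c) \<in> parcs G} > 0" using fS by (intro card_gt_0_iff[THEN iffD2]) auto
    then show ?case using S ab fS card_inner_arcs_insert[OF ab(4)]
      by (intro exI[of _ "insert b S"]) auto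
  qed
  moreover have "graph_order G > 0"
    using ne pair_finite_verts by (simp add: graph_order_def card_gt_0_iff)
  ultimately obtain S where S: "S \<subseteq> pverts G"
    "2 * (graph_order G - 1) \<le> card {(x, y) \<in> parcs G. x \<in> S \<and> y \<in> S}"
    using grow[of "graph_order G - 1"] by auto
  have "card {(x, y) \<in> parcs G. x \<in> S \<and> y \<in> S} \<le> card (parcs G)"
    by (rule card_mono[OF pair_finite_arcs]) blast
  then show ?thesis using S(2) by simp
qed

lemma cycle_of_walk:
  fixes x :: "nat \<Rightarrow> 'a"
  assumes arc: "\<And>k. (x k, x (Suc k)) \<in> parcs G" and ij: "i < j" and x: "x i = x j"
    and inj: "inj_on x {i..<j}"
  shows "pre_digraph.cycle (with_proj G) (map (\<lambda>k. (x k, x (Suc k))) [i..<j])"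
proof -
  let ?c = "\<lambda>j. map (\<lambda>k. (x k, x (Suc k))) [i..<j]"
  have cas: "pcas a (p @ [e]) b \<longleftrightarrow> pcas a p (fst e) \<and> snd e = b" for a b p and e ::
    "'a \<times> 'a"
    by (induction p arbitrary: a) auto
  have 1: "pcas (x i) (?c j) (x j)" if "i \<le> j" for j
    using that by (induction j rule: dec_induct) (simp_all add: cas del: cas_append_iff)
  have vs: "pawalk_verts a (p @ [e]) = pawalk_verts a p @ [snd e]"
    if "pcas a p (fst e)" for a p and e :: "'a \<times> 'a"
    using that by (induction p arbitrary: a) auto
  have 2: "pawalk_verts (x i) (?c j) = map x [i..<Suc j]" if "i \<le> j" for j
    using that
  proof (induction j rule: dec_induct)
    case (step j)
    have "pawalk_verts (x i) (?c (Suc j)) = pawalk_verts (x i) (?c j) @ [x (Suc j)]"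
      using vs[of "x i" "?c j" "(x j, x (Suc j))"] 1[of j] step.hyps by simp
    then show ?case using step by simp
  qed simp
  have "set (?c j) \<subseteq> parcs G" using arc by auto
  then have aw: "awalk (x i) (?c j) (x i)"
    using 1[of j] ij arc[of i] in_arcsD1 unfolding awalk_def by (simp add: x)
  \<comment> \<open>A cycle must have distinct vertices after its first one, so the window of
    injectivity moves from i, ..., j - 1 to i + 1, ..., j. The two dropped and added ends carry the
    same vertex.\<close>
  have "inj_on x {Suc i..<Suc j}"
  proof (rule inj_onI)
    fix a b assume "a \<in> {Suc i..<Suc j}" "b \<in> {Suc i..<Suc j}" "x a = x b"
    moreover have "x (if a = j then i else a) = x (if b = j then i else b)"
      using \<open>x a = x b\<close> x by (cases "a = j"; cases "b = j") auto
    ultimately have "(if a = j then i else a) = (if b = j then i else b)"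
      using inj ij by (intro inj_onD[OF inj]) auto
    then show "a = b" using \<open>a \<in> _\<close> \<open>b \<in> _\<close> by (auto split: if_splits)
  qed
  moreover have "tl (pawalk_verts (x i) (?c j)) = map x [Suc i..<Suc j]"
    using ij unfolding 2[OF less_imp_le[OF ij]] by (simp only: map_tl[symmetric] tl_upt)
  ultimately have "distinct (tl (pawalk_verts (x i) (?c j)))"
    by (simp add: distinct_map del: upt_Suc)
  then show ?thesis unfolding cycle_def using aw ij by auto
qed

text \<open>If every vertex of \<open>S\<close> had two neighbours in \<open>S\<close>, one could
  walk in \<open>S\<close> forever without turning back. The first repetition closes a cycle, of
  length at least 3 because there are neither loops nor immediate returns.\<close>

lemma acyclic_inner_leaf:
  assumes acyc: "\<nexists>c. pre_digraph.cycle (with_proj G) c \<and> length c \<ge> 3"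
    and S: "S \<subseteq> pverts G" "S \<noteq> {}"
  shows "\<exists>a \<in> S. card {b \<in> S. (a, b) \<in> parcs G} \<le> 1"
proof (rule ccontr)
  assume "\<not> ?thesis"
  then have two: "card {b \<in> S. (a, b) \<in> parcs G} \<ge> 2" if "a \<in> S" for a using that by force
  have nxt: "\<exists>b \<in> S. (a, b) \<in> parcs G \<and> b \<noteq> p" if "a \<in> S" for a p
  proof (rule ccontr)
    assume "\<not> ?thesis"
    then have "{b \<in> S. (a, b) \<in> parcs G} \<subseteq> {p}" by blast
    then have "card {b \<in> S. (a, b) \<in> parcs G} \<le> 1" using card_mono[of "{p}"] by simp
    then show False using two[OF that] by simp
  qed
  define f where "f p a = (SOME b. b \<in> S \<and> (a, b) \<in> parcs G \<and> b \<noteq> p)" for p a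
  have f: "f p a \<in> S \<and> (a, f p a) \<in> parcs G \<and> f p a \<noteq> p" if "a \<in> S" for a p
    unfolding f_def by (rule someI_ex) (use nxt[OF that] in blast)
  obtain s where s: "s \<in> S" using S by blast
  \<comment> \<open>The state of the walk is an arc, the previous and the current vertex, since the
    next vertex has to avoid the previous one.\<close>
  define st where "st k = ((\<lambda>(p, a). (a, f p a)) ^^ k) (s, f s s)" for k
  define x where "x k = fst (st k)" for k
  have st: "fst (st k) \<in> S \<and> snd (st k) \<in> S \<and> st k \<in> parcs G" for k
    by (induction k) (use s f in \<open>auto simp: st_def split: prod.splits\<close>)
  have x1: "snd (st k) = x (Suc k)" for k by (simp add: x_def st_def case_prod_beta)
  have x2: "x (Suc (Suc k)) = f (x k) (x (Suc k))" for k
    using x1[of k] by (simp add: x_def st_def case_prod_beta)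
  have xS: "x k \<in> S" for k using st by (simp add: x_def)
  have arc: "(x k, x (Suc k)) \<in> parcs G" for k
    using st[of k] x1[of k] unfolding x_def by (metis prod.collapse)
  have no_return: "x (Suc (Suc k)) \<noteq> x k" for k unfolding x2 using f[OF xS] by blast
  have finS: "finite S" using S(1) pair_finite_verts finite_subset by blast
  have "\<not> inj_on x {..card S}"
    using finS xS by (intro pigeonhole) (metis card_atMost card_mono image_subsetI less_Suc_eq_le)
  then have ex: "\<exists>j. \<exists>i<j. x i = x j" unfolding inj_on_def by (metis nat_neq_iff)
  define j where "j = (LEAST j. \<exists>i<j. x i = x j)"
  obtain i where i: "i < j" "x i = x j" using LeastI_ex[OF ex] unfolding j_def by blast
  have "inj_on x {i..<j}"
  proof (rule inj_onI)
    fix a b assume *: "a \<in> {i..<j}" "b \<in> {i..<j}" "x a = x b"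
    have "\<not> (\<exists>i<k. x i = x k)" if "k < j" for k using not_less_Least that unfolding j_def by blast
    then show "a = b" using * by (metis atLeastLessThan_iff nat_neq_iff)
  qed
  then have "pre_digraph.cycle (with_proj G) (map (\<lambda>k. (x k, x (Suc k))) [i..<j])"
    by (rule cycle_of_walk[OF arc i])
  then have "j - i < 3" using acyc by force
  moreover have "j \<noteq> Suc i" using arc[of i] i no_loop by auto
  moreover have "j \<noteq> Suc (Suc i)" using no_return[of i] i by auto
  ultimately show False using i by simp
qed

text \<open>Taking away a vertex with at most one neighbour in \<open>S\<close> removes at most two
  arcs.\<close>

lemma acyclic_card_arcs:
  assumes acyc: "\<nexists>c. pre_digraph.cycle (with_proj G) c \<and> length c \<ge> 3"
    and S: "S \<subseteq> pverts G" "S \<noteq> {}"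
  shows "card {(x, y) \<in> parcs G. x \<in> S \<and> y \<in> S} + 2 \<le> 2 * card S"
  using S
proof (induction "card S" arbitrary: S)
  case 0
  then show ?case using pair_finite_verts finite_subset by fastforce
next
  case (Suc k)
  obtain a where a: "a \<in> S" "card {b \<in> S. (a, b) \<in> parcs G} \<le> 1"
    using acyclic_inner_leaf[OF acyc Suc.prems] by blast
  have fin: "finite S" using Suc.prems(1) pair_finite_verts finite_subset by blast
  have cS: "card (S - {a}) = k" using Suc.hyps(2) a(1) fin by simp
  have ins: "insert a (S - {a}) = S" using a(1) by blast
  have "{b \<in> S - {a}. (a, b) \<in> parcs G} = {b \<in> S. (a, b) \<in> parcs G}" using no_loop by blast
  then have *: "card {(x, y) \<in> parcs G. x \<in> S \<and> y \<in> S}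
      \<le> card {(x, y) \<in> parcs G. x \<in> S - {a} \<and> y \<in> S - {a}} + 2 * card {b \<in> S. (a, b) \<in>
        parcs G}"
    using card_inner_arcs_insert[of a "S - {a}"] unfolding ins by simp
  show ?case
  proof (cases "S - {a} = {}")
    case True
    then have "S = {a}" using a(1) by blast
    then have "{(x, y) \<in> parcs G. x \<in> S \<and> y \<in> S} = {}" using no_loop by auto
    then have "card {(x, y) \<in> parcs G. x \<in> S \<and> y \<in> S} = 0" by (simp only: card.empty)
    then show ?thesis using Suc.hyps(2) by linarith
  next
    case False
    have "card {(x, y) \<in> parcs G. x \<in> S - {a} \<and> y \<in> S - {a}} + 2 \<le> 2 * card (S - {a})"
      by (rule Suc.hyps(1)) (use cS Suc.prems False in auto)
    then show ?thesis using * a(2) cS Suc.hyps(2) by linarith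
  qed
qed

end

lemma undirected_tree_card_arcs:
  assumes "undirected_tree G"
  shows "card (parcs G) + 2 = 2 * graph_order G"
proof -
  interpret pair_graph G using assms by (simp add: undirected_tree_def)
  have con: "connected (with_proj G)" using assms by (simp add: undirected_tree_def)
  have ne: "pverts G \<noteq> {}" using con by (auto simp: connected_conv)
  have acyc: "\<nexists>c. pre_digraph.cycle (with_proj G) c \<and> length c \<ge> 3"
    using assms by (simp add: undirected_tree_def)
  have "{(x, y) \<in> parcs G. x \<in> pverts G \<and> y \<in> pverts G} = parcs G"
    using in_arcsD1 in_arcsD2 by blast
  then show ?thesis
    using acyclic_card_arcs[OF acyc order_refl ne] connected_card_arcs[OF con ne]
    by (simp add: graph_order_def)
qed

lemma undirected_tree_degree_pos:
  assumes "undirected_tree G" "graph_order G \<ge> 2" "a \<in> pverts G"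
  shows "vertex_degree G a \<ge> 1"
proof -
  interpret pair_graph G using assms by (simp add: undirected_tree_def)
  have "card {a} \<noteq> card (pverts G)" using assms(2) by (simp add: graph_order_def)
  then have "{a} \<noteq> pverts G" by metis
  then obtain b where "(a, b) \<in> parcs G"
    using connected_exit_arc[of "{a}"] assms by (auto simp: undirected_tree_def)
  then have "{b. (a, b) \<in> parcs G} \<noteq> {}" by blast
  then show ?thesis unfolding vertex_degree_eq by (simp add: Suc_le_eq card_gt_0_iff)
qed

section \<open>Large eigenvalues of a tree\<close>

text \<open>Gaussian elimination, one pivot per equation. Arbitrary finite index sets allow vertices
  as equations and values of type \<open>nat option\<close> as unknowns.\<close>

lemma underdetermined_system:
  fixes M :: "'b \<Rightarrow> 'c \<Rightarrow> real"
  assumes "finite A" "finite B" "card A < card B"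
  shows "\<exists>c. (\<exists>b\<in>B. c b \<noteq> 0) \<and> (\<forall>a\<in>A. (\<Sum>b\<in>B. M a b * c b) = 0)"
  using assms
proof (induction A arbitrary: B M rule: finite_induct)
  case empty
  then have "B \<noteq> {}" by auto
  then show ?case by (intro exI[of _ "\<lambda>_. 1"]) auto
next
  case (insert a A)
  show ?case
  proof (cases "\<forall>b\<in>B. M a b = 0")
    case True
    obtain c where "\<exists>b\<in>B. c b \<noteq> 0" "\<forall>a\<in>A. (\<Sum>b\<in>B. M a b * c b) = 0"
      using insert.IH[OF insert.prems(1), of M] insert.prems insert.hyps by auto
    then show ?thesis using True by (intro exI[of _ c]) auto
  next
    case False
    then obtain b0 where b0: "b0 \<in> B" "M a b0 \<noteq> 0" by blast
    define M' where "M' a' b = M a' b - M a' b0 * M a b / M a b0" for a' b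
    have "card A < card (B - {b0})" using insert.prems insert.hyps b0 by simp
    then obtain c where c: "\<exists>b\<in>B - {b0}. c b \<noteq> 0"
      "\<forall>a\<in>A. (\<Sum>b\<in>B - {b0}. M' a b * c b) = 0"
      using insert.IH[of "B - {b0}" M'] insert.prems by auto
    define s where "s = (\<Sum>b\<in>B - {b0}. M a b * c b)"
    define c' where "c' = c(b0 := - s / M a b0)"
    have eq: "(\<Sum>b\<in>B. M a' b * c' b) = (\<Sum>b\<in>B - {b0}. M a' b * c b) - M a' b0 * s / M a b0" for a'
    proof -
      have "(\<Sum>b\<in>B. M a' b * c' b) = M a' b0 * c' b0 + (\<Sum>b\<in>B - {b0}. M a' b * c' b)"
        by (rule sum.remove) (use insert.prems b0 in auto)
      also have "(\<Sum>b\<in>B - {b0}. M a' b * c' b) = (\<Sum>b\<in>B - {b0}. M a' b * c b)"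
        by (rule sum.cong) (auto simp: c'_def)
      finally show ?thesis by (simp add: c'_def)
    qed
    have "(\<Sum>b\<in>B. M a' b * c' b) = 0" if "a' \<in> A" for a'
    proof -
      have "(\<Sum>b\<in>B - {b0}. M' a' b * c b)
        = (\<Sum>b\<in>B - {b0}. M a' b * c b - M a' b0 / M a b0 * (M a b * c b))"
        by (rule sum.cong) (auto simp: M'_def algebra_simps)
      also have "\<dots> = (\<Sum>b\<in>B - {b0}. M a' b * c b) - M a' b0 * s / M a b0"
        by (simp add: sum_subtractf s_def sum_distrib_left sum_divide_distrib)
      finally show ?thesis using c(2) that unfolding eq by simp
    qed
    moreover have "(\<Sum>b\<in>B. M a b * c' b) = 0" unfolding eq using b0 by (simp add: s_def)
    moreover have "\<exists>b\<in>B. c' b \<noteq> 0" using c(1) by (auto simp: c'_def)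
    ultimately show ?thesis by (intro exI[of _ c']) auto
  qed
qed

text \<open>Subtracting the constant \<open>k\<close> changes no difference along an edge, and
  afterwards every edge has at most one end with a nonzero value.\<close>

lemma (in pair_graph) edge_form_independent:
  assumes S: "S \<subseteq> pverts G" and ind:
    "\<And>a b. a \<in> S \<Longrightarrow> b \<in> S \<Longrightarrow> (a, b) \<notin> parcs G"
    and x: "\<And>a. a \<in> pverts G - S \<Longrightarrow> x a = k"
  shows "edge_form G x = (\<Sum>a\<in>S. real (vertex_degree G a) * (x a - k)\<^sup>2)"
proof -
  define y where "y a = x a - k" for a
  have y0: "y a = 0" if "a \<in> pverts G" "a \<notin> S" for a using x that by (simp add: y_def)
  have "edge_form G x = edge_form G y" by (simp add: edge_form_def y_def)
  also have "\<dots> = (\<Sum>a\<in>pverts G. y a * lap G y a)" by (rule edge_form_eq)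
  also have "\<dots> = (\<Sum>a\<in>S. y a * lap G y a)"
    by (rule sum.mono_neutral_right) (use S pair_finite_verts y0 in auto)
  also have "\<dots> = (\<Sum>a\<in>S. real (vertex_degree G a) * (y a)\<^sup>2)"
  proof (rule sum.cong[OF refl])
    fix a assume a: "a \<in> S"
    have "y b = 0" if "(a, b) \<in> parcs G" for b
      using y0[OF in_arcsD2[OF that]] ind[OF a] that by blast
    then have "lap G y a = (\<Sum>b | (a, b) \<in> parcs G. y a)"
      unfolding lap_def by (intro sum.cong) auto
    then show "y a * lap G y a = real (vertex_degree G a) * (y a)\<^sup>2"
      by (simp add: vertex_degree_eq power2_eq_square)
  qed
  finally show ?thesis by (simp add: y_def)
qed

lemma (in pair_graph) edge_form_eigen_combination:
  fixes y :: "nat \<Rightarrow> 'a \<Rightarrow> real" and \<mu> :: "nat \<Rightarrow> real"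
  assumes I: "finite I"
    and on: "\<And>i j. i \<in> I \<Longrightarrow> j \<in> I \<Longrightarrow> (\<Sum>a\<in>pverts G. y i a * y j a)
      = (if i = j then 1 else 0)"
    and eig: "\<And>i a. i \<in> I \<Longrightarrow> a \<in> pverts G \<Longrightarrow> lap G (y i) a = \<mu> i * y i a"
    and x: "x = (\<lambda>a. \<Sum>i\<in>I. c i * y i a)"
  shows "edge_form G x = (\<Sum>i\<in>I. \<mu> i * (c i)\<^sup>2)"
    "(\<Sum>a\<in>pverts G. (x a)\<^sup>2) = (\<Sum>i\<in>I. (c i)\<^sup>2)"
proof -
  have gen: "(\<Sum>a\<in>pverts G. x a * (\<Sum>j\<in>I. f j * y j a)) = (\<Sum>i\<in>I. c i * f i)" for f
  proof -
    have "(\<Sum>a\<in>pverts G. x a * (\<Sum>j\<in>I. f j * y j a))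
      = (\<Sum>a\<in>pverts G. \<Sum>i\<in>I. \<Sum>j\<in>I. c i * f j * (y i a * y j a))"
      by (simp add: x sum_product mult_ac)
    also have "\<dots> = (\<Sum>i\<in>I. \<Sum>j\<in>I. c i * f j * (\<Sum>a\<in>pverts G. y i a * y j a))"
      by (subst sum.swap, rule sum.cong, simp, subst sum.swap) (simp add: sum_distrib_left)
    also have "\<dots> = (\<Sum>i\<in>I. \<Sum>j\<in>I. if i = j then c i * f i else 0)"
      by (intro sum.cong refl) (auto simp: on)
    also have "\<dots> = (\<Sum>i\<in>I. c i * f i)" using I by simp
    finally show ?thesis .
  qed
  have "lap G x a = (\<Sum>i\<in>I. (c i * \<mu> i) * y i a)" if "a \<in> pverts G" for a
    unfolding x lap_sum by (rule sum.cong) (auto simp: eig that)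
  then have "edge_form G x = (\<Sum>a\<in>pverts G. x a * (\<Sum>j\<in>I. (c j * \<mu> j) * y j a))"
    unfolding edge_form_eq by (intro sum.cong) auto
  also have "\<dots> = (\<Sum>i\<in>I. c i * (c i * \<mu> i))" by (rule gen)
  finally show "edge_form G x = (\<Sum>i\<in>I. \<mu> i * (c i)\<^sup>2)" by (simp add: power2_eq_square mult_ac)
  have "(\<Sum>a\<in>pverts G. (x a)\<^sup>2) = (\<Sum>a\<in>pverts G. x a * (\<Sum>j\<in>I. c j * y j a))"
    by (simp add: power2_eq_square x)
  also have "\<dots> = (\<Sum>i\<in>I. c i * c i)" by (rule gen)
  finally show "(\<Sum>a\<in>pverts G. (x a)\<^sup>2) = (\<Sum>i\<in>I. (c i)\<^sup>2)" by (simp add: power2_eq_square)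
qed

text \<open>The Laplacian is the identity on the pendent vertices, so at most \<open>card (non_pendent_vertices G)\<close>
  eigenvalues reach the average degree. When this bound is attained, no further vector may be
  added to that negative subspace; with fewer pendent than non-pendent vertices the all-one vector
  on the non-pendent vertices, perturbed at a vertex without pendent neighbours, is one.\<close>

theorem sigma_le_half_order:
  assumes tree: "undirected_tree G" and n3: "graph_order G \<ge> 3"
    and sigma: "laplacian_sigma G = card (non_pendent_vertices G)"
  shows "2 * laplacian_sigma G \<le> graph_order G"
proof (rule ccontr)
  interpret pair_graph G using tree by (simp add: undirected_tree_def)
  have con: "connected (with_proj G)" using tree by (simp add: undirected_tree_def)
  assume "\<not> ?thesis"
  then have large: "graph_order G < 2 * laplacian_sigma G" by simp
  define V where "V = pverts G"
  define R where "R = non_pendent_vertices G"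
  define P where "P = {a \<in> V. vertex_degree G a = 1}"
  define r p n d where "r = card R" and "p = card P" and "n = graph_order G" and "d = average_degree G"
  have fV: "finite V" by (simp add: V_def pair_finite_verts)
  have VRP: "V = R \<union> P" "R \<inter> P = {}" by (auto simp: R_def P_def V_def non_pendent_vertices_def)
  have fin: "finite R" "finite P" using VRP fV by (metis finite_Un)+
  have n: "n = r + p" using VRP fin by (simp add: n_def r_def p_def graph_order_def card_Un_disjoint flip: V_def)
  have rp: "p + 1 \<le> r" using large sigma n by (simp add: n_def r_def R_def)
  have deg: "vertex_degree G a \<ge> 2" if "a \<in> R" for a
    using undirected_tree_degree_pos[OF tree, of a] that n3
    by (auto simp: R_def non_pendent_vertices_def)
  have "(\<Sum>a\<in>V. vertex_degree G a) + 2 = 2 * n"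
    using undirected_tree_card_arcs[OF tree] by (simp add: card_parcs_degree V_def n_def)
  moreover have "(\<Sum>a\<in>V. vertex_degree G a) = (\<Sum>a\<in>R. vertex_degree G a)
    + (\<Sum>a\<in>P. vertex_degree G a)"
    unfolding VRP(1) by (rule sum.union_disjoint) (use fin VRP in auto)
  moreover have "(\<Sum>a\<in>P. vertex_degree G a) = p" by (simp add: p_def P_def)
  ultimately have degR: "(\<Sum>a\<in>R. vertex_degree G a) + 2 = 2 * r + p" using n by simp
  \<comment> \<open>The degrees of the r non-pendent vertices sum to 2 r + p - 2. The r - 1 others
    take at least 2 each, which leaves at most p for \<open>w\<close>.\<close>
  have degp: "vertex_degree G w \<le> p" if w: "w \<in> R" for w
  proof -
    have "(\<Sum>a\<in>R - {w}. 2) \<le> (\<Sum>a\<in>R - {w}. vertex_degree G a)" by (rule sum_mono) (use deg in auto)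
    then have "2 * (r - 1) \<le> (\<Sum>a\<in>R - {w}. vertex_degree G a)" using w fin by (simp add: r_def)
    moreover have "(\<Sum>a\<in>R. vertex_degree G a) = vertex_degree G w + (\<Sum>a\<in>R - {w}. vertex_degree G a)"
      by (rule sum.remove[OF fin(1) w])
    moreover have "r > 0" using w fin by (auto simp: r_def card_gt_0_iff)
    ultimately show ?thesis using degR by linarith
  qed
  have PR: "(a, b) \<notin> parcs G" if "a \<in> P" "b \<in> P" for a b
  proof
    assume ab: "(a, b) \<in> parcs G"
    have uniq: "c = b'" if "a' \<in> P" "(a', b') \<in> parcs G" "(a', c) \<in> parcs G" for a' b' c
    proof -
      have "card {b. (a', b) \<in> parcs G} = 1" using that(1) by (simp add: P_def vertex_degree_eq)
      then obtain z where "{b. (a', b) \<in> parcs G} = {z}" by (auto simp: card_1_singleton_iff)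
      then have "b' \<in> {z}" "c \<in> {z}" using that(2,3) by blast+
      then show ?thesis by simp
    qed
    have ab': "a \<noteq> b" "{a, b} \<subseteq> V" using ab no_loop that by (auto simp: P_def)
    have "card {a, b} < card V" using n3 ab' by (simp add: V_def graph_order_def)
    then have "{a, b} \<noteq> pverts G" unfolding V_def by (metis less_irrefl)
    then have "\<exists>x y. (x, y) \<in> parcs G \<and> x \<in> {a, b} \<and> y \<in> pverts G - {a, b}"
      using ab' by (intro connected_exit_arc[OF con]) (simp_all add: V_def)
    then obtain x y where xy: "(x, y) \<in> parcs G" "x \<in> {a, b}" "y \<in> V - {a, b}"
      unfolding V_def by blast
    then show False using uniq[OF that(1) ab] uniq[OF that(2) arcs_symmetric[OF ab]] by blast
  qed
  define nb where "nb l = (SOME b. (l, b) \<in> parcs G)" for l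
  have nb: "{b. (l, b) \<in> parcs G} = {nb l}" if "l \<in> P" for l
  proof -
    have "card {b. (l, b) \<in> parcs G} = 1" using that by (simp add: P_def vertex_degree_eq)
    then obtain b where "{b. (l, b) \<in> parcs G} = {b}" by (auto simp: card_1_singleton_iff)
    moreover have "(l, nb l) \<in> parcs G" unfolding nb_def by (rule someI_ex) (use calculation in blast)
    ultimately have "nb l \<in> {b}" by blast
    then show ?thesis using \<open>{b. (l, b) \<in> parcs G} = {b}\<close> by simp
  qed
  have "card (nb ` P) \<le> p" using card_image_le[OF fin(2)] by (simp add: p_def)
  then have "\<not> R \<subseteq> nb ` P" using rp fin card_mono[of "nb ` P" R] by (auto simp: r_def)
  \<comment> \<open>The neighbours of p < r pendent vertices cannot exhaust the r non-pendent
    ones.\<close>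
  then obtain w where w: "w \<in> R" "w \<notin> nb ` P" by blast
  have wP: "(l, w) \<notin> parcs G" if "l \<in> P" for l using nb[OF that] w(2) that by blast
  have ne: "pverts G \<noteq> {}" using w by (auto simp: R_def non_pendent_vertices_def)
  have dn: "d = 2 - 2 / real n" "n \<ge> 3"
  proof -
    have "real (card (parcs G)) = 2 * real n - 2"
      using undirected_tree_card_arcs[OF tree] n3 unfolding n_def by linarith
    then show "d = 2 - 2 / real n"
      using average_degree_order[OF ne] n3 by (simp add: d_def n_def field_simps)
  qed (use n3 in \<open>simp add: n_def\<close>)
  have "2 / real n < 1" using dn(2) by simp
  then have d1: "d > 1" using dn(1) by linarith
  have p2: "p \<ge> 2" using degp[OF w(1)] deg[OF w(1)] by simp
  \<comment> \<open>The perturbation at \<open>w\<close> adds at most deg(w) e^2 <= e to the edge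
    form and d (2 e + e^2) to d times the squared norm. One d e of the latter is spent on the gap
    that the pendent vertices leave, which is also 1/p; since d > 1, what remains exceeds e.\<close>
  define e where "e = 1 / real p"
  define h where "h a = 1 + (if a = w then e else 0)" for a
  obtain I :: "nat set" and \<mu> :: "nat \<Rightarrow> real" and y :: "nat \<Rightarrow> 'a \<Rightarrow> real"
    where I: "finite I" "card I = laplacian_sigma G"
      and on: "\<And>i j. i \<in> I \<Longrightarrow> j \<in> I
        \<Longrightarrow> (\<Sum>a\<in>pverts G. y i a * y j a) = (if i = j then 1 else 0)"
      and eig: "\<And>i a. i \<in> I \<Longrightarrow> a \<in> pverts G \<Longrightarrow> lap G (y i) a
        = \<mu> i * y i a"
      and \<mu>: "\<And>i. i \<in> I \<Longrightarrow> \<mu> i \<ge> average_degree G"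
      and "laplacian_energy G = 2 * (\<Sum>i\<in>I. \<mu> i - average_degree G)"
    by (rule laplacian_energy_eigenvectors[OF ne]) (rule that)
  \<comment> \<open>\<open>None\<close> is the coefficient of \<open>h\<close>. There is one unknown
    more than there are non-pendent vertices, so a nontrivial choice of coefficients makes the
    combination \<open>x\<close> of eigenvectors agree with a multiple of \<open>h\<close> on all of
    them.\<close>
  define B where "B = insert None (Some ` I)"
  define M where "M a = case_option (- h a) (\<lambda>i. y i a)" for a
  have "card R < card B" using I sigma by (simp add: B_def card_image R_def)
  then obtain c where c: "\<exists>b\<in>B. c b \<noteq> 0" "\<forall>a\<in>R. (\<Sum>b\<in>B. M a b * c b) = 0"
    using underdetermined_system[OF fin(1), of B M] I by (auto simp: B_def)
  define \<kappa> where "\<kappa> = c None"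
  define x where "x = (\<lambda>a. \<Sum>i\<in>I. c (Some i) * y i a)"
  have xR: "x a = \<kappa> * h a" if "a \<in> R" for a
  proof -
    have "(\<Sum>b\<in>B. M a b * c b) = - h a * \<kappa> + x a"
      unfolding B_def using I by (simp add: sum.reindex M_def x_def \<kappa>_def mult.commute)
    then show ?thesis using c(2) that by (simp add: mult.commute)
  qed
  have Ex: "edge_form G x = (\<Sum>i\<in>I. \<mu> i * (c (Some i))\<^sup>2)"
    and xx: "(\<Sum>a\<in>pverts G. (x a)\<^sup>2) = (\<Sum>i\<in>I. (c (Some i))\<^sup>2)"
    using edge_form_eigen_combination[OF I(1) on eig x_def] by auto
  have "d * (\<Sum>i\<in>I. (c (Some i))\<^sup>2) \<le> (\<Sum>i\<in>I. \<mu> i * (c (Some i))\<^sup>2)"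
    unfolding sum_distrib_left by (intro sum_mono mult_right_mono) (use \<mu> in \<open>auto simp: d_def\<close>)
  then have Q: "d * (\<Sum>a\<in>V. (x a)\<^sup>2) \<le> edge_form G x" by (simp add: Ex xx V_def)
  have S: "edge_form G x = real (vertex_degree G w) * (\<kappa> * e)\<^sup>2
    + (\<Sum>l\<in>P. (x l - \<kappa>)\<^sup>2)"
  proof -
    have "edge_form G x = (\<Sum>a\<in>insert w P. real (vertex_degree G a) * (x a - \<kappa>)\<^sup>2)"
    proof (rule edge_form_independent)
      show "insert w P \<subseteq> pverts G" using w VRP by (auto simp: V_def)
      show "(a, b) \<notin> parcs G" if "a \<in> insert w P" "b \<in> insert w P" for a b
        using that PR wP arcs_symmetric no_loop by blast
      show "x a = \<kappa>" if "a \<in> pverts G - insert w P" for a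
        using that VRP xR[of a] by (auto simp: V_def h_def)
    qed
    also have "\<dots> = real (vertex_degree G w) * (x w - \<kappa>)\<^sup>2
      + (\<Sum>l\<in>P. real (vertex_degree G l) * (x l - \<kappa>)\<^sup>2)"
      using fin w VRP by (subst sum.insert) auto
    also have "x w - \<kappa> = \<kappa> * e" using xR[OF w(1)] by (simp add: h_def algebra_simps)
    also have "(\<Sum>l\<in>P. real (vertex_degree G l) * (x l - \<kappa>)\<^sup>2)
      = (\<Sum>l\<in>P. (x l - \<kappa>)\<^sup>2)"
      by (rule sum.cong) (auto simp: P_def)
    finally show ?thesis .
  qed
  have VV: "(\<Sum>a\<in>V. (x a)\<^sup>2) = \<kappa>\<^sup>2 * (real r + 2 * e + e\<^sup>2)
    + (\<Sum>l\<in>P. (x l)\<^sup>2)"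
  proof -
    have "(\<Sum>a\<in>V. (x a)\<^sup>2) = (\<Sum>a\<in>R. (x a)\<^sup>2) + (\<Sum>l\<in>P. (x l)\<^sup>2)"
      unfolding VRP(1) by (rule sum.union_disjoint) (use fin VRP in auto)
    also have "(\<Sum>a\<in>R. (x a)\<^sup>2) = (\<Sum>a\<in>R. \<kappa>\<^sup>2 + (if a
      = w then \<kappa>\<^sup>2 * (2 * e + e\<^sup>2) else 0))"
      by (rule sum.cong) (auto simp: xR h_def power2_eq_square algebra_simps)
    also have "\<dots> = \<kappa>\<^sup>2 * (real r + 2 * e + e\<^sup>2)"
      using w fin by (simp add: sum.distrib r_def algebra_simps)
    finally show ?thesis .
  qed
  \<comment> \<open>The maximum over the value at a pendent vertex, by completing the square; the
    quadratic is concave because d > 1.\<close>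
  have leaf: "(z - \<kappa>)\<^sup>2 - d * z\<^sup>2 \<le> \<kappa>\<^sup>2 * (d / (d - 1))" for z
  proof -
    have "\<kappa>\<^sup>2 * (d / (d - 1)) - ((z - \<kappa>)\<^sup>2 - d * z\<^sup>2) = ((d - 1) * z
      + \<kappa>)\<^sup>2 / (d - 1)"
      using d1 by (simp add: field_simps power2_eq_square)
    also have "\<dots> \<ge> 0" using d1 by simp
    finally show ?thesis by simp
  qed
  have "0 \<le> edge_form G x - d * (\<Sum>a\<in>V. (x a)\<^sup>2)" using Q by simp
  also have "\<dots> = real (vertex_degree G w) * (\<kappa> * e)\<^sup>2 - d * (\<kappa>\<^sup>2 * (real r + 2 * e
    + e\<^sup>2))
      + (\<Sum>l\<in>P. (x l - \<kappa>)\<^sup>2 - d * (x l)\<^sup>2)"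
    unfolding S VV by (simp add: sum_subtractf sum_distrib_left algebra_simps)
  finally have 0: "0 \<le> real (vertex_degree G w) * (\<kappa> * e)\<^sup>2 - d * (\<kappa>\<^sup>2 * (real r + 2 * e
    + e\<^sup>2))
      + (\<Sum>l\<in>P. (x l - \<kappa>)\<^sup>2 - d * (x l)\<^sup>2)" .
  show False
  proof (cases "\<kappa> = 0")
    \<comment> \<open>Now \<open>x\<close> lives on the pendent vertices, where the Laplacian is the
      identity and thus below d. So \<open>x\<close> vanishes, and orthonormality of the
      eigenvectors makes all coefficients vanish.\<close>
    case True
    have "0 \<le> (\<Sum>l\<in>P. (1 - d) * (x l)\<^sup>2)" using 0 True by (simp add: algebra_simps)
    then have "0 \<le> (1 - d) * (\<Sum>l\<in>P. (x l)\<^sup>2)" by (simp add: sum_distrib_left)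
    then have "(\<Sum>l\<in>P. (x l)\<^sup>2) \<le> 0" using d1 by (simp add: zero_le_mult_iff)
    then have "(\<Sum>i\<in>I. (c (Some i))\<^sup>2) \<le> 0" using VV True xx by (simp add: V_def)
    then have "(\<Sum>i\<in>I. (c (Some i))\<^sup>2) = 0" by (intro order.antisym sum_nonneg) auto
    then have "\<forall>i\<in>I. c (Some i) = 0" using I by (simp add: sum_nonneg_eq_0_iff)
    then show False using c(1) True by (auto simp: B_def \<kappa>_def)
  next
    case False
    have "(\<Sum>l\<in>P. (x l - \<kappa>)\<^sup>2 - d * (x l)\<^sup>2)
      \<le> (\<Sum>l\<in>P. \<kappa>\<^sup>2 * (d / (d - 1)))"
      by (rule sum_mono) (rule leaf)
    also have "\<dots> = \<kappa>\<^sup>2 * (real p * (d / (d - 1)))" by (simp add: p_def)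
    finally have "0 \<le> \<kappa>\<^sup>2 * (real (vertex_degree G w) * e\<^sup>2 - d * (real r + 2 * e + e\<^sup>2)
      + real p * (d / (d - 1)))"
      using 0 by (simp add: power_mult_distrib algebra_simps)
    then have 1: "0 \<le> real (vertex_degree G w) * e\<^sup>2 - d * (real r + 2 * e + e\<^sup>2)
      + real p * (d / (d - 1))"
      using False by (simp add: zero_le_mult_iff)
    have pp: "real p \<ge> 2" "real r \<ge> real p + 1" using p2 rp by linarith+
    have n2: "real n - 2 \<ge> 2 * real p - 1" using n pp by simp
    have "d - 1 = (real n - 2) / real n" unfolding dn(1) using dn(2) by (simp add: field_simps)
    then have "1 / (d - 1) = real n / (real n - 2)" by simp
    also have "\<dots> = 1 + 2 / (real n - 2)" using dn(2) by (simp add: field_simps)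
    finally have inv: "1 / (d - 1) = 1 + 2 / (real n - 2)" .
    have "real p * (d / (d - 1)) = d * real p * (1 / (d - 1))" by simp
    also have "\<dots> = d * (real p + 2 * real p / (real n - 2))"
      unfolding inv by (simp add: distrib_left mult_ac)
    also have "\<dots> \<le> d * (real p + 2 * real p / (2 * real p - 1))"
      using d1 n2 pp by (intro mult_left_mono add_left_mono divide_left_mono) auto
    also have "2 * real p / (2 * real p - 1) = 1 + 1 / (2 * real p - 1)" using pp by (simp add: field_simps)
    also have "d * (real p + (1 + 1 / (2 * real p - 1))) \<le> d * (real p + (1 + 1 / real p))"
      using d1 pp by (intro mult_left_mono add_left_mono divide_left_mono) auto
    also have "\<dots> \<le> d * (real r + e)" using d1 pp by (intro mult_left_mono) (auto simp: e_def)
    finally have 2: "real p * (d / (d - 1)) \<le> d * (real r + e)" .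
    have "real (vertex_degree G w) * e\<^sup>2 \<le> real p * e\<^sup>2" using degp[OF w(1)] by (intro
      mult_right_mono) auto
    also have "\<dots> = e" using pp by (simp add: e_def power2_eq_square)
    finally have 3: "real (vertex_degree G w) * e\<^sup>2 \<le> e" .
    have "0 \<le> e - d * e - d * e\<^sup>2" using 1 2 3 by (simp add: algebra_simps)
    moreover have "e > 0" using pp by (simp add: e_def)
    moreover have "d * e > 1 * e" using d1 \<open>e > 0\<close> by (intro mult_strict_right_mono) auto
    moreover have "d * e\<^sup>2 \<ge> 0" using d1 by simp
    ultimately show False by linarith
  qed
qed

section \<open>Joining two trees by an edge\<close>

lemma (in pair_graph) edge_form_cong:
  "(\<And>a. a \<in> pverts G \<Longrightarrow> x a = y a) \<Longrightarrow> edge_form G x = edge_form G y"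
  unfolding edge_form_def
  by (intro arg_cong[of _ _ "\<lambda>s. s / 2"] sum.cong refl)
     (use arc_fst_in_verts arc_snd_in_verts in \<open>simp add: case_prod_beta\<close>)

lemma edge_form_scale: "edge_form G (\<lambda>a. k * x a) = k\<^sup>2 * edge_form G x"
  unfolding edge_form_def
  by (simp add: sum_distrib_left case_prod_beta power_mult_distrib flip: right_diff_distrib)

text \<open>Expansion of the form for a change at a single vertex: inside \<open>T1\<close> the
  rotated eigenvectors differ from the original ones only at \<open>u\<close>.\<close>

lemma (in pair_graph) edge_form_shift:
  assumes u: "u \<in> pverts G"
  shows "edge_form G (\<lambda>a. x a + (if a = u then k else 0))
    = edge_form G x + 2 * k * lap G x u + k\<^sup>2 * real (vertex_degree G u)"
proof -
  let ?e = "\<lambda>a. if a = u then k else (0 :: real)"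
  have sq: "(p + q - (r + s))\<^sup>2 = (p - r)\<^sup>2 + 2 * ((p - r) * (q - s)) + (q - s)\<^sup>2" for p q r s :: real
    by (simp add: power2_eq_square algebra_simps)
  have "edge_form G (\<lambda>a. x a + ?e a) = (\<Sum>(a, b)\<in>parcs G. (x a - x b)\<^sup>2
    + 2 * ((x a - x b) * (?e a - ?e b)) + (?e a - ?e b)\<^sup>2) / 2"
    unfolding edge_form_def
    by (intro arg_cong[of _ _ "\<lambda>s. s / 2"] sum.cong refl) (simp only: case_prod_beta sq)
  also have "\<dots> = edge_form G x + 2 * ((\<Sum>(a, b)\<in>parcs G. (x a - x b) * (?e a - ?e b)) / 2)
    + edge_form G ?e"
    unfolding edge_form_def by (simp add: case_prod_beta sum.distrib sum_distrib_left add_divide_distrib)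
  also have "(\<Sum>(a, b)\<in>parcs G. (x a - x b) * (?e a - ?e b)) / 2 = (\<Sum>a\<in>pverts G. ?e a * lap G x a)"
    by (rule green[symmetric])
  also have "\<dots> = (\<Sum>a\<in>pverts G. if a = u then k * lap G x u else 0)"
    by (rule sum.cong) auto
  also have "\<dots> = k * lap G x u" using u pair_finite_verts by simp
  also have "edge_form G ?e = (\<Sum>a\<in>pverts G. ?e a * lap G ?e a)" by (rule edge_form_eq)
  also have "\<dots> = (\<Sum>a\<in>pverts G. if a = u then k * lap G ?e u else 0)"
    by (rule sum.cong) auto
  also have "\<dots> = k * lap G ?e u" using u pair_finite_verts by simp
  also have "lap G ?e u = (\<Sum>b | (u, b) \<in> parcs G. k)"
    unfolding lap_def by (rule sum.cong) (use no_loop in auto)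
  also have "\<dots> = k * real (vertex_degree G u)" by (simp add: vertex_degree_eq)
  finally show ?thesis by (simp add: power2_eq_square mult.assoc)
qed

locale join_graphs =
  T1: pair_graph T1 + T2: pair_graph T2 for T1 T2 :: "'a pair_pre_digraph" +
  fixes u v :: 'a
  assumes disj: "pverts T1 \<inter> pverts T2 = {}" and u: "u \<in> pverts T1" and v: "v \<in> pverts T2"
begin

abbreviation "T \<equiv> join_by_edge T1 T2 u v"

lemma uv: "u \<notin> pverts T2" "v \<notin> pverts T1" "u \<noteq> v"
  using disj u v by blast+

lemma pair_graph_join: "pair_graph T"
proof -
  have "\<exists>a b. e = (a, b)" for e :: "'a \<times> 'a" by (cases e) auto
  show ?thesis
  proof (unfold_locales)
    fix e assume "e \<in> parcs T"
    then show "fst e \<in> pverts T" "snd e \<in> pverts T" "fst e \<noteq> snd e"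
      using u v uv T1.arc_fst_in_verts[of e] T1.arc_snd_in_verts[of e] T2.arc_fst_in_verts[of e]
        T2.arc_snd_in_verts[of e] T1.pair_no_loops[of e] T2.pair_no_loops[of e]
      by (auto simp: join_by_edge_def)
  next
    have "sym (parcs T)"
    proof (rule symI)
      fix a b assume "(a, b) \<in> parcs T"
      then show "(b, a) \<in> parcs T"
        using T1.arcs_symmetric[of a b] T2.arcs_symmetric[of a b] by (auto simp: join_by_edge_def)
    qed
    then show "symmetric (with_proj T)" by (simp add: symmetric_def)
  qed (auto simp: join_by_edge_def T1.pair_finite_verts T2.pair_finite_verts T1.pair_finite_arcs T2.pair_finite_arcs)
qed

lemma parcs_disj: "parcs T1 \<inter> parcs T2 = {}" "(parcs T1 \<union> parcs T2) \<inter> {(u, v), (v, u)} = {}"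
proof -
  have 1: "p \<notin> parcs T1 \<or> fst p \<notin> pverts T2 \<and> snd p \<notin> pverts T2" for p
    using disj T1.arc_fst_in_verts[of p] T1.arc_snd_in_verts[of p] by blast
  have 2: "p \<notin> parcs T2 \<or> fst p \<in> pverts T2 \<and> snd p \<in> pverts T2" for p
    using T2.arc_fst_in_verts[of p] T2.arc_snd_in_verts[of p] by blast
  show "parcs T1 \<inter> parcs T2 = {}" using 1 2 by blast
  show "(parcs T1 \<union> parcs T2) \<inter> {(u, v), (v, u)} = {}"
    using 1[of "(u, v)"] 1[of "(v, u)"] 2[of "(u, v)"] 2[of "(v, u)"] uv v by simp
qed

lemma parcs_join: "parcs T = (parcs T1 \<union> parcs T2) \<union> {(u, v), (v, u)}"
  by (simp add: join_by_edge_def)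

lemma sum_parcs_join: "(\<Sum>e\<in>parcs T. f e) = (\<Sum>e\<in>parcs T1. f e) + (\<Sum>e\<in>parcs T2. f e)
  + (f (u, v) + f (v, u))"
  for f :: "_ \<Rightarrow> 'c :: comm_monoid_add"
proof -
  have "sum f (parcs T) = sum f (parcs T1 \<union> parcs T2) + sum f {(u, v), (v, u)}"
    unfolding parcs_join using parcs_disj
    by (intro sum.union_disjoint) (simp_all add: T1.pair_finite_arcs T2.pair_finite_arcs)
  also have "sum f (parcs T1 \<union> parcs T2) = sum f (parcs T1) + sum f (parcs T2)"
    using parcs_disj by (intro sum.union_disjoint T1.pair_finite_arcs T2.pair_finite_arcs)
  finally show ?thesis using uv by simp
qed

lemma sum_pverts_join: "(\<Sum>a\<in>pverts T. f a) = (\<Sum>a\<in>pverts T1. f a) + (\<Sum>a\<in>pverts T2. f a)"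
  for f :: "_ \<Rightarrow> 'c :: comm_monoid_add"
  unfolding join_by_edge_def using disj
  by (simp add: sum.union_disjoint T1.pair_finite_verts T2.pair_finite_verts)

lemma edge_form_join: "edge_form T x = edge_form T1 x + edge_form T2 x + (x u - x v)\<^sup>2"
  unfolding edge_form_def sum_parcs_join by (simp add: power2_commute[of "x v"] field_simps)

lemma order_join: "graph_order T = graph_order T1 + graph_order T2"
  unfolding graph_order_def join_by_edge_def using disj
  by (simp add: card_Un_disjoint T1.pair_finite_verts T2.pair_finite_verts)

lemma card_parcs_join: "card (parcs T) = card (parcs T1) + card (parcs T2) + 2"
  unfolding card_eq_sum sum_parcs_join by simp

end

text \<open>\<open>P\<close> is the row at \<open>u\<close> of the orthogonal projection onto the
  span of the \<open>y i\<close>. Its squared length is \<alpha>, of which the diagonal entry takes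
  \<alpha>^2. The deviation that is squared in the second claim is minus the sum of \<open>P\<close>
  over the neighbours of \<open>u\<close>, so Cauchy-Schwarz applies with the remaining mass
  \<alpha> (1 - \<alpha>).\<close>

lemma (in pair_graph) projection_row_bound:
  fixes y :: "nat \<Rightarrow> 'a \<Rightarrow> real" and \<mu> :: "nat \<Rightarrow> real"
  assumes I: "finite I" and u: "u \<in> pverts G"
    and on: "\<And>i j. i \<in> I \<Longrightarrow> j \<in> I \<Longrightarrow> (\<Sum>a\<in>pverts G. y i a * y j a)
      = (if i = j then 1 else 0)"
    and eig: "\<And>i. i \<in> I \<Longrightarrow> lap G (y i) u = \<mu> i * y i u"
  defines "\<alpha> \<equiv> \<Sum>i\<in>I. (y i u)\<^sup>2"
  shows "\<alpha> \<le> 1"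
    and "((\<Sum>i\<in>I. \<mu> i * (y i u)\<^sup>2) - real (vertex_degree G u) * \<alpha>)\<^sup>2
      \<le> real (vertex_degree G u) * \<alpha> * (1 - \<alpha>)"
proof -
  define P where "P b = (\<Sum>i\<in>I. y i u * y i b)" for b
  have Pu: "P u = \<alpha>" by (simp add: P_def \<alpha>_def power2_eq_square)
  have "(\<Sum>b\<in>pverts G. (P b)\<^sup>2)
    = (\<Sum>b\<in>pverts G. \<Sum>i\<in>I. \<Sum>j\<in>I. y i u * y j u * (y i b * y j b))"
    by (simp add: P_def power2_eq_square sum_product mult_ac)
  also have "\<dots> = (\<Sum>i\<in>I. \<Sum>j\<in>I. y i u * y j u * (\<Sum>b\<in>pverts G. y i b * y j b))"
    by (subst sum.swap, rule sum.cong, simp, subst sum.swap) (simp add: sum_distrib_left)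
  also have "\<dots> = (\<Sum>i\<in>I. \<Sum>j\<in>I. if i = j then (y i u)\<^sup>2 else 0)"
    by (intro sum.cong refl) (auto simp: on power2_eq_square)
  also have "\<dots> = \<alpha>" using I by (simp add: \<alpha>_def)
  finally have PP: "(\<Sum>b\<in>pverts G. (P b)\<^sup>2) = \<alpha>" .
  have \<alpha>: "(\<Sum>b\<in>pverts G - {u}. (P b)\<^sup>2) = \<alpha> - \<alpha>\<^sup>2"
    using sum.remove[OF pair_finite_verts u, of "\<lambda>b. (P b)\<^sup>2"] PP Pu by simp
  have "0 \<le> \<alpha> - \<alpha>\<^sup>2" unfolding \<alpha>[symmetric] by (simp add: sum_nonneg)
  then have "\<alpha> * \<alpha> \<le> \<alpha> * 1" by (simp add: power2_eq_square)
  moreover have "\<alpha> \<ge> 0" by (simp add: \<alpha>_def sum_nonneg)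
  ultimately show "\<alpha> \<le> 1" by (cases "\<alpha> = 0") (auto simp: mult_le_cancel_left)
  let ?N = "{b. (u, b) \<in> parcs G}"
  have "(\<Sum>i\<in>I. \<mu> i * (y i u)\<^sup>2) = (\<Sum>i\<in>I. y i u * lap G (y i) u)"
    by (rule sum.cong) (auto simp: eig power2_eq_square)
  also have "\<dots> = (\<Sum>i\<in>I. \<Sum>b\<in>?N. (y i u)\<^sup>2 - y i u * y i b)"
    by (simp add: lap_def sum_distrib_left right_diff_distrib power2_eq_square)
  also have "\<dots> = real (vertex_degree G u) * \<alpha> - (\<Sum>b\<in>?N. P b)"
    by (simp add: sum_subtractf vertex_degree_eq \<alpha>_def P_def sum_distrib_left) (rule sum.swap)
  finally have "((\<Sum>i\<in>I. \<mu> i * (y i u)\<^sup>2) - real (vertex_degree G u) * \<alpha>)\<^sup>2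
    = (\<Sum>b\<in>?N. P b * 1)\<^sup>2"
    by simp
  also have "\<dots> \<le> (\<Sum>b\<in>?N. (P b)\<^sup>2) * (\<Sum>b\<in>?N. 1\<^sup>2)"
  proof (cases "?N = {}")
    case False
    then have card: "real (card ?N) > 0" by (simp add: card_gt_0_iff)
    \<comment> \<open>Cauchy-Schwarz as Bessel's inequality for a family of one element, the
      constant 1 on the neighbours.\<close>
    have "(\<Sum>i\<in>{0 :: nat}. (\<Sum>b\<in>?N. 1 * P b)\<^sup>2 / real (card ?N))
      \<le> (\<Sum>b\<in>?N. (P b)\<^sup>2)"
      by (rule bessel) (use card in auto)
    then show ?thesis using card by (simp add: field_simps)
  qed simp
  also have "\<dots> \<le> (\<Sum>b\<in>pverts G - {u}. (P b)\<^sup>2) * (\<Sum>b\<in>?N. 1\<^sup>2)"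
    by (intro mult_right_mono sum_mono2) (use pair_finite_verts no_loop in_arcsD2 in auto)
  also have "\<dots> = real (vertex_degree G u) * \<alpha> * (1 - \<alpha>)"
    unfolding \<alpha> by (simp add: vertex_degree_eq power2_eq_square algebra_simps)
  finally show "((\<Sum>i\<in>I. \<mu> i * (y i u)\<^sup>2) - real (vertex_degree G u) * \<alpha>)\<^sup>2
      \<le> real (vertex_degree G u) * \<alpha> * (1 - \<alpha>)" .
qed

text \<open>\<alpha> is the unknown weight of the eigenvectors of \<open>T1\<close> at
  \<open>u\<close>, and \<open>N\<close> the off-diagonal term bounded by
  \<open>projection_row_bound\<close>. AM-GM with weight \<open>t\<close> splits the cross term into
  a multiple of 1 - \<alpha> and a multiple of \<alpha>. The resulting lower bound is linear in
  \<alpha>, and the two hypotheses on \<open>m\<close> control its ends \<alpha> = 0, where d >= 1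
  is used, and \<alpha> = 1.\<close>

lemma rotation_gain:
  fixes W \<tau> t c h d \<alpha> N m A :: real
  assumes W: "W \<ge> 0" and t: "0 < t" "t < 1" and d: "d \<ge> 1" and \<alpha>: "0 \<le> \<alpha>" "\<alpha> \<le> 1"
    and c: "c = (1 - W * \<tau>\<^sup>2) / (1 + W * \<tau>\<^sup>2)" and h: "h = 2 * \<tau> / (1 + W * \<tau>\<^sup>2)"
    and N: "N\<^sup>2 \<le> d * \<alpha> * (1 - \<alpha>)"
    and m: "m \<le> (1 - t) * (W * h\<^sup>2)" "m \<le> A - W * \<tau>\<^sup>2 / t"
  shows "m \<le> d * (W * h\<^sup>2) * (1 - \<alpha>) - 2 * (1 - c) * N + \<alpha> * A"
proof -
  define q where "q = W * \<tau>\<^sup>2"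
  have q: "q \<ge> 0" using W by (simp add: q_def)
  have c': "1 - c = 2 * q / (1 + q)" using q by (simp add: c q_def[symmetric] field_simps)
  define s where "s = W * h\<^sup>2"
  have s: "s = 4 * q / (1 + q)\<^sup>2" by (simp add: s_def h q_def power_divide power_mult_distrib)
  have s0: "s \<ge> 0" using q by (simp add: s)
  have cs: "(1 - c)\<^sup>2 = q * s"
    unfolding c' s by (simp add: power_divide power_mult_distrib power2_eq_square)
  let ?a = "t * s * d * (1 - \<alpha>)" and ?b = "\<alpha> * q / t"
  have ab: "?a \<ge> 0" "?b \<ge> 0" using t d \<alpha> q s0 by auto
  have "(2 * (1 - c) * N)\<^sup>2 = 4 * (q * s) * N\<^sup>2" unfolding cs[symmetric] by (simp add: power2_eq_square
    algebra_simps)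
  also have "\<dots> \<le> 4 * (q * s) * (d * \<alpha> * (1 - \<alpha>))"
    using N q s0 by (intro mult_left_mono) auto
  also have "\<dots> = 4 * (?a * ?b)" using t by simp
  also have "\<dots> \<le> (?a + ?b)\<^sup>2"
  proof -
    have "4 * (a * b) \<le> (a + b)\<^sup>2" for a b :: real
      using zero_le_power2[of "a - b"] by (simp add: power2_eq_square algebra_simps)
    then show ?thesis .
  qed
  finally have "2 * (1 - c) * N \<le> ?a + ?b"
    using ab by (metis abs_le_square_iff abs_ge_self order_trans abs_of_nonneg add_nonneg_nonneg)
  moreover have "m * (1 - \<alpha>) \<le> (1 - t) * s * d * (1 - \<alpha>)"
  proof -
    have "m \<le> (1 - t) * s * 1" using m(1) by (simp add: s_def)
    also have "\<dots> \<le> (1 - t) * s * d" using t d s0 by (intro mult_left_mono) auto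
    finally show ?thesis using \<alpha> by (intro mult_right_mono) auto
  qed
  moreover have "m * \<alpha> \<le> (A - q / t) * \<alpha>" using m(2) \<alpha> by (intro mult_right_mono) (auto simp:
    q_def)
  moreover have "m = m * (1 - \<alpha>) + m * \<alpha>" by (simp add: algebra_simps)
  moreover have "d * s * (1 - \<alpha>) = (1 - t) * s * d * (1 - \<alpha>) + ?a" by (simp add: algebra_simps)
  moreover have "(A - q / t) * \<alpha> = \<alpha> * A - ?b" by (simp add: algebra_simps)
  ultimately show ?thesis unfolding s_def[symmetric] by linarith
qed

text \<open>Testing \<open>T\<close> on the eigenvectors of \<open>T1\<close> alone loses what the new edge gives, so
the coordinate \<open>u\<close> is rotated towards \<open>w\<close>: \<open>e\<^sub>u\<close> becomes \<open>c
  e\<^sub>u + h w\<close> and \<open>w\<close> becomes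
\<open>c w - h \<bar>w\<bar>\<^sup>2 e\<^sub>u\<close>. The parameter \<open>\<tau>\<close> gives the rational points
  of \<open>c\<^sup>2 + W h\<^sup>2 = 1\<close>,
and \<open>t\<close> is the weight in the AM-GM inequality that absorbs the off-diagonal terms of
  \<open>T1\<close>.\<close>

theorem (in join_graphs) laplacian_energy_join:
  fixes w :: "'a \<Rightarrow> real" and x :: "nat \<Rightarrow> 'a \<Rightarrow> real"
  assumes arcs1: "card (parcs T1) + 2 = 2 * graph_order T1"
    and arcs2: "card (parcs T2) + 2 = 2 * graph_order T2"
    and deg: "vertex_degree T1 u \<ge> 1"
    and sigma: "2 * laplacian_sigma T1 \<le> graph_order T1"
    and W: "(\<Sum>a\<in>pverts T2. (w a)\<^sup>2) = W" "W > 0" and w0: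
      "\<And>a. a \<notin> pverts T2 \<Longrightarrow> w a = 0"
    and N: "\<And>j. j < k \<Longrightarrow> (\<Sum>a\<in>pverts T2. (x j a)\<^sup>2) = N j"
      "\<And>j. j < k \<Longrightarrow> N j > 0"
    and x0: "\<And>j a. j < k \<Longrightarrow> a \<notin> pverts T2 \<Longrightarrow> x j a = 0"
    and orth: "\<And>i j. i < k \<Longrightarrow> j < k \<Longrightarrow> i \<noteq> j
      \<Longrightarrow> (\<Sum>a\<in>pverts T2. x i a * x j a) = 0"
    and worth: "\<And>j. j < k \<Longrightarrow> (\<Sum>a\<in>pverts T2. w a * x j a) = 0"
    and t: "0 < t" "t < 1"
    and c: "c = (1 - W * \<tau>\<^sup>2) / (1 + W * \<tau>\<^sup>2)" and h: "h = 2 * \<tau> / (1 + W * \<tau>\<^sup>2)"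
    and m: "m \<le> (1 - t) * (W * h\<^sup>2)"
      "m \<le> h\<^sup>2 * edge_form T2 w + (c - h * w v)\<^sup>2 - W * \<tau>\<^sup>2 / t"
  shows "laplacian_energy T \<ge> laplacian_energy T1
    + 2 * ((\<Sum>j<k. (edge_form T2 (x j) + (x j v)\<^sup>2) / N j)
      + (c\<^sup>2 * edge_form T2 w + (c * w v + h * W)\<^sup>2) / W + m - 2 * real (k + 1))
    + (4 * real (k + 1) - 2 * real (graph_order T2)) / real (graph_order T)"
proof -
  interpret T: pair_graph T by (rule pair_graph_join)
  define n1 n2 n where "n1 = real (graph_order T1)" and "n2 = real (graph_order T2)"
    and "n = real (graph_order T)"
  have ne1: "pverts T1 \<noteq> {}" and neT: "pverts T \<noteq> {}" using u by (auto simp: join_by_edge_def)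
  have n1: "n1 > 0" using ne1 T1.pair_finite_verts by (simp add: n1_def graph_order_def card_gt_0_iff)
  have nn: "n = n1 + n2" by (simp add: n_def n1_def n2_def order_join)
  have n2: "n2 \<ge> 0" by (simp add: n2_def)
  obtain I :: "nat set" and \<mu> :: "nat \<Rightarrow> real" and y :: "nat \<Rightarrow> 'a \<Rightarrow> real"
    where I: "finite I" "card I = laplacian_sigma T1"
      and on: "\<And>i j. i \<in> I \<Longrightarrow> j \<in> I
        \<Longrightarrow> (\<Sum>a\<in>pverts T1. y i a * y j a) = (if i = j then 1 else 0)"
      and eig: "\<And>i a. i \<in> I \<Longrightarrow> a \<in> pverts T1 \<Longrightarrow> lap T1 (y i) a
        = \<mu> i * y i a"
      and "\<And>i. i \<in> I \<Longrightarrow> \<mu> i \<ge> average_degree T1"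
      and LE: "laplacian_energy T1 = 2 * (\<Sum>i\<in>I. \<mu> i - average_degree T1)"
    by (rule T1.laplacian_energy_eigenvectors[OF ne1]) (rule that)
  have d1: "average_degree T1 = 2 - 2 / n1"
    using T1.average_degree_order[OF ne1] arcs1 n1 by (simp add: n1_def field_simps)
  have dT: "average_degree T = 2 - 2 / n"
    using T.average_degree_order[OF neT] arcs1 arcs2 n1 n2 nn card_parcs_join
    by (simp add: n_def n1_def n2_def field_simps)
  define q where "q = W * \<tau>\<^sup>2"
  have q: "q \<ge> 0" using W(2) by (simp add: q_def)
  have ch: "c\<^sup>2 + W * h\<^sup>2 = 1"
  proof -
    have "c\<^sup>2 + W * h\<^sup>2 = ((1 - q)\<^sup>2 + 4 * q) / (1 + q)\<^sup>2"
      by (simp add: c h q_def power_divide power_mult_distrib add_divide_distrib)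
    also have "(1 - q)\<^sup>2 + 4 * q = (1 + q)\<^sup>2" by (simp add: power2_eq_square algebra_simps)
    finally show ?thesis using q by simp
  qed
  then have hW: "h\<^sup>2 * W = 1 - c\<^sup>2" by (simp add: mult.commute)
  define Y where "Y i a = (if a = u then c * y i u else if a \<in> pverts T1 then y i a else h * y i u * w a)" for i a
  define X0 where "X0 a = (if a = u then - h * W else c * w a)" for a
  \<comment> \<open>\<open>Inl i\<close> is a rotated eigenvector of \<open>T1\<close>,
    \<open>Inr k\<close> the rotated \<open>w\<close>, and \<open>Inr j\<close> with j < k the
    vector \<open>x j\<close>, which the rotation leaves alone.\<close>
  define J where "J = Inl ` I \<union> (Inr ` {..k} :: (nat + nat) set)"
  define Z where "Z = case_sum Y (\<lambda>j. if j = k then X0 else x j)"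
  define M where "M = case_sum (\<lambda>_ :: nat. 1) (\<lambda>j. if j = k then W else N j)"
  have sum1: "(\<Sum>a\<in>pverts T1. f a * g a) = f u * g u + (\<Sum>a\<in>pverts T1 - {u}. f a * g a)" for f g ::
    "'a \<Rightarrow> real"
    using sum.remove[OF T1.pair_finite_verts u] .
  have z1: "w a = 0" "\<And>j. j < k \<Longrightarrow> x j a = 0" if "a \<in> pverts T1" for a
    using that disj w0 x0 by blast+
  have YY: "(\<Sum>a\<in>pverts T. Y i a * Y j a) = (if i = j then 1 else 0)" if "i \<in> I" "j \<in> I" for i j
  proof -
    have "(\<Sum>a\<in>pverts T1. Y i a * Y j a)
      = (\<Sum>a\<in>pverts T1. y i a * y j a) - (1 - c\<^sup>2) * (y i u * y j u)"
      unfolding sum1 by (simp add: Y_def power2_eq_square algebra_simps)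
    moreover have "(\<Sum>a\<in>pverts T2. Y i a * Y j a)
      = (\<Sum>a\<in>pverts T2. h\<^sup>2 * (y i u * y j u) * (w a)\<^sup>2)"
      by (rule sum.cong) (use disj uv in \<open>auto simp: Y_def power2_eq_square\<close>)
    ultimately show ?thesis unfolding sum_pverts_join using on[OF that] hW W(1)
      by (simp add: sum_distrib_left[symmetric])
  qed
  have YX0: "(\<Sum>a\<in>pverts T. Y i a * X0 a) = 0" if "i \<in> I" for i
  proof -
    have "(\<Sum>a\<in>pverts T1. Y i a * X0 a) = - (c * y i u * h * W)"
      unfolding sum1 by (simp add: Y_def X0_def z1)
    moreover have "(\<Sum>a\<in>pverts T2. Y i a * X0 a) = (\<Sum>a\<in>pverts T2. (h * y i u * c) * (w a)\<^sup>2)"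
      by (rule sum.cong) (use disj uv in \<open>auto simp: Y_def X0_def power2_eq_square\<close>)
    ultimately show ?thesis unfolding sum_pverts_join using W(1)
      by (simp add: sum_distrib_left[symmetric])
  qed
  have Yx: "(\<Sum>a\<in>pverts T. Y i a * x j a) = 0" if "i \<in> I" "j < k" for i j
  proof -
    have "(\<Sum>a\<in>pverts T1. Y i a * x j a) = 0" by (rule sum.neutral) (use that z1 in auto)
    moreover have "(\<Sum>a\<in>pverts T2. Y i a * x j a) = (\<Sum>a\<in>pverts T2. (h * y i u) * (w a * x j a))"
      by (rule sum.cong) (use disj uv in \<open>auto simp: Y_def\<close>)
    ultimately show ?thesis unfolding sum_pverts_join using worth[OF that(2)]
      by (simp add: sum_distrib_left[symmetric])
  qed
  have X0X0: "(\<Sum>a\<in>pverts T. X0 a * X0 a) = W"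
  proof -
    have "(\<Sum>a\<in>pverts T1. X0 a * X0 a) = h\<^sup>2 * W\<^sup>2"
      unfolding sum1 by (simp add: X0_def z1 power2_eq_square)
    moreover have "(\<Sum>a\<in>pverts T2. X0 a * X0 a) = (\<Sum>a\<in>pverts T2. c\<^sup>2 * (w a)\<^sup>2)"
      by (rule sum.cong) (use uv in \<open>auto simp: X0_def power2_eq_square\<close>)
    ultimately have "(\<Sum>a\<in>pverts T. X0 a * X0 a) = (c\<^sup>2 + W * h\<^sup>2) * W"
      unfolding sum_pverts_join using W(1) by (simp add: sum_distrib_left[symmetric] power2_eq_square algebra_simps)
    then show ?thesis unfolding ch by simp
  qed
  have X0x: "(\<Sum>a\<in>pverts T. X0 a * x j a) = 0" if "j < k" for j
  proof -
    have "(\<Sum>a\<in>pverts T1. X0 a * x j a) = 0" by (rule sum.neutral) (use that z1 in auto)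
    moreover have "(\<Sum>a\<in>pverts T2. X0 a * x j a) = (\<Sum>a\<in>pverts T2. c * (w a * x j a))"
      by (rule sum.cong) (use uv in \<open>auto simp: X0_def\<close>)
    ultimately show ?thesis unfolding sum_pverts_join using worth[OF that]
      by (simp add: sum_distrib_left[symmetric])
  qed
  have xx: "(\<Sum>a\<in>pverts T. x i a * x j a) = (\<Sum>a\<in>pverts T2. x i a * x j a)" if "i < k" for i j
    unfolding sum_pverts_join by (simp add: z1 that)
  have X0Y: "(\<Sum>a\<in>pverts T. X0 a * Y i a) = 0" if "i \<in> I" for i
    using YX0[OF that] by (simp add: mult.commute)
  have xY: "(\<Sum>a\<in>pverts T. x j a * Y i a) = 0" if "i \<in> I" "j < k" for i j
    using Yx[OF that] by (simp add: mult.commute)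
  have xX0: "(\<Sum>a\<in>pverts T. x j a * X0 a) = 0" if "j < k" for j
    using X0x[OF that] by (simp add: mult.commute)
  have orth': "i = j" if "i < k" "j < k" "(\<Sum>a\<in>pverts T2. x i a * x j a) \<noteq> 0" for i j
    using orth[OF that(1,2)] that(3) by blast
  have main: "2 * (\<Sum>i\<in>J. edge_form T (Z i) / M i - average_degree T) \<le> laplacian_energy T"
  proof (rule T.laplacian_energy_ge[OF neT])
    show "finite J" using I by (simp add: J_def)
    show "M i > 0" if "i \<in> J" for i using that W N by (auto simp: J_def M_def)
    show "(\<Sum>a\<in>pverts T. (Z i a)\<^sup>2) = M i" if "i \<in> J" for i
      using that YY X0X0 xx N by (auto simp: J_def Z_def M_def power2_eq_square)
    show "(\<Sum>a\<in>pverts T. Z i a * Z j a) = 0" if "i \<in> J" "j \<in> J" "i \<noteq> j" for i j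
      using that YY YX0 Yx X0x X0Y xY xX0 xx
      by (auto simp: J_def Z_def le_less split: if_splits intro: orth')
  qed
  \<comment> \<open>Apart from their eigenvalues, the eigenvectors of \<open>T1\<close> enter the
    total only through these two moments at \<open>u\<close>.\<close>
  define \<alpha> where "\<alpha> = (\<Sum>i\<in>I. (y i u)\<^sup>2)"
  define \<Lambda> where "\<Lambda> = (\<Sum>i\<in>I. \<mu> i * (y i u)\<^sup>2)"
  define d where "d = real (vertex_degree T1 u)"
  define A where "A = h\<^sup>2 * edge_form T2 w + (c - h * w v)\<^sup>2"
  have EY: "edge_form T (Y i) = \<mu> i - 2 * (1 - c) * (\<mu> i * (y i u)\<^sup>2)
    + (1 - c)\<^sup>2 * d * (y i u)\<^sup>2 + A * (y i u)\<^sup>2"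
    if "i \<in> I" for i
  proof -
    have "edge_form T1 (Y i) = edge_form T1 (\<lambda>a. y i a + (if a = u then - (1 - c) * y i u else 0))"
      by (rule T1.edge_form_cong) (auto simp: Y_def algebra_simps)
    also have "\<dots> = edge_form T1 (y i) + 2 * (- (1 - c) * y i u) * lap T1 (y i) u
      + (- (1 - c) * y i u)\<^sup>2 * d"
      unfolding d_def by (rule T1.edge_form_shift[OF u])
    also have "edge_form T1 (y i) = (\<Sum>a\<in>pverts T1. \<mu> i * (y i a * y i a))"
      unfolding T1.edge_form_eq by (rule sum.cong) (auto simp: eig that)
    also have "\<dots> = \<mu> i" using on[OF that that] by (simp flip: sum_distrib_left)
    finally have 1: "edge_form T1 (Y i) = \<mu> i + 2 * (- (1 - c) * y i u) * (\<mu> i * y i u)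
      + (- (1 - c) * y i u)\<^sup>2 * d"
      using eig[OF that u] by simp
    have "edge_form T2 (Y i) = edge_form T2 (\<lambda>a. (h * y i u) * w a)"
      by (rule T2.edge_form_cong) (use disj uv in \<open>auto simp: Y_def\<close>)
    then have 2: "edge_form T2 (Y i) = (h * y i u)\<^sup>2 * edge_form T2 w" by (simp add: edge_form_scale)
    have 3: "Y i u - Y i v = (c - h * w v) * y i u" using uv by (simp add: Y_def algebra_simps)
    show ?thesis unfolding edge_form_join 1 2 3 A_def by (simp add: power2_eq_square algebra_simps)
  qed
  have EX0: "edge_form T X0 = h\<^sup>2 * W\<^sup>2 * d + c\<^sup>2 * edge_form T2 w + (c * w v + h * W)\<^sup>2"
  proof -
    have "edge_form T1 X0 = edge_form T1 (\<lambda>a. 0 + (if a = u then - h * W else 0))"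
      by (rule T1.edge_form_cong) (auto simp: X0_def z1)
    also have "\<dots> = h\<^sup>2 * W\<^sup>2 * d"
      unfolding T1.edge_form_shift[OF u] d_def by (simp add: edge_form_def lap_def power_mult_distrib)
    finally have 1: "edge_form T1 X0 = h\<^sup>2 * W\<^sup>2 * d" .
    have "edge_form T2 X0 = edge_form T2 (\<lambda>a. c * w a)"
      by (rule T2.edge_form_cong) (use uv in \<open>auto simp: X0_def\<close>)
    then have 2: "edge_form T2 X0 = c\<^sup>2 * edge_form T2 w" by (simp add: edge_form_scale)
    have 3: "X0 u - X0 v = - (c * w v + h * W)" using uv by (simp add: X0_def)
    show ?thesis unfolding edge_form_join 1 2 3 by (simp only: power2_minus)
  qed
  have Ex: "edge_form T (x j) = edge_form T2 (x j) + (x j v)\<^sup>2" if "j < k" for j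
  proof -
    have "edge_form T1 (x j) = edge_form T1 (\<lambda>a. 0)"
      by (rule T1.edge_form_cong) (use z1 that in auto)
    then have "edge_form T1 (x j) = 0" by (simp add: edge_form_def)
    then show ?thesis unfolding edge_form_join using z1(2)[OF u that] by simp
  qed
  have "(\<Sum>i\<in>J. edge_form T (Z i) / M i - average_degree T)
      = (\<Sum>i\<in>I. edge_form T (Y i) - average_degree T) + (\<Sum>j\<le>k. (if j = k then edge_form T X0 / W else
        edge_form T (x j) / N j) - average_degree T)"
    unfolding J_def using I(1)
    by (subst sum.union_disjoint) (auto simp: sum.reindex Z_def M_def if_distrib intro!: sum.cong)
  also have "(\<Sum>j\<le>k. (if j = k then edge_form T X0 / W else edge_form T (x j) / N j) - average_degree T)
      = (\<Sum>j<k. (edge_form T2 (x j) + (x j v)\<^sup>2) / N j) + edge_form T X0 / W - real (k + 1) * average_degree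
        T"
    by (simp add: lessThan_Suc_atMost[symmetric] sum_subtractf Ex algebra_simps cong: sum.cong_simp)
  also have "(\<Sum>i\<in>I. edge_form T (Y i) - average_degree T)
      = (\<Sum>i\<in>I. \<mu> i) - 2 * (1 - c) * \<Lambda> + (1 - c)\<^sup>2 * d * \<alpha> + A * \<alpha> - real
        (card I) * average_degree T"
    by (simp add: EY sum.distrib sum_subtractf \<Lambda>_def \<alpha>_def sum_distrib_left)
  also have "edge_form T X0 / W = d * (W * h\<^sup>2) + (c\<^sup>2 * edge_form T2 w + (c * w v + h * W)\<^sup>2) / W"
    using W(2) unfolding EX0 by (simp add: field_simps power2_eq_square)
  finally have S: "(\<Sum>i\<in>J. edge_form T (Z i) / M i - average_degree T)
    = (\<Sum>i\<in>I. \<mu> i) - 2 * (1 - c) * \<Lambda> + (1 - c)\<^sup>2 * d * \<alpha> + A * \<alpha> - real (card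
      I) * average_degree T
     + ((\<Sum>j<k. (edge_form T2 (x j) + (x j v)\<^sup>2) / N j)
      + (d * (W * h\<^sup>2) + (c\<^sup>2 * edge_form T2 w + (c * w v + h * W)\<^sup>2) / W) - real (k + 1) *
        average_degree T)" .
  have "m \<le> d * (W * h\<^sup>2) * (1 - \<alpha>) - 2 * (1 - c) * (\<Lambda> - d * \<alpha>) + \<alpha> * A"
  proof (rule rotation_gain[OF less_imp_le[OF W(2)] t _ _ _ c h])
    show "1 \<le> d" using deg by (simp add: d_def)
    show "0 \<le> \<alpha>" by (simp add: \<alpha>_def sum_nonneg)
    show "\<alpha> \<le> 1" unfolding \<alpha>_def by (rule T1.projection_row_bound(1)[OF I(1) u on eig[OF _ u]])
    show "(\<Lambda> - d * \<alpha>)\<^sup>2 \<le> d * \<alpha> * (1 - \<alpha>)" unfolding \<alpha>_def \<Lambda>_def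
      d_def
      by (rule T1.projection_row_bound(2)[OF I(1) u on eig[OF _ u]])
  qed (use m in \<open>auto simp: A_def\<close>)
  also have "\<dots> = d * (W * h\<^sup>2) - 2 * (1 - c) * \<Lambda> + (1 - c)\<^sup>2 * d * \<alpha> + A * \<alpha>"
  proof -
    have Wh: "W * h\<^sup>2 = 1 - c\<^sup>2" using ch by simp
    show ?thesis unfolding Wh by (simp add: power2_eq_square algebra_simps)
  qed
  finally have m': "m \<le> d * (W * h\<^sup>2) - 2 * (1 - c) * \<Lambda> + (1 - c)\<^sup>2 * d * \<alpha>
    + A * \<alpha>" .
  define B where "B = (\<Sum>j<k. (edge_form T2 (x j) + (x j v)\<^sup>2) / N j)
      + (c\<^sup>2 * edge_form T2 w + (c * w v + h * W)\<^sup>2) / W"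
  define K K1 where "K = real (card I) * average_degree T" and "K1 = real (card I) * average_degree T1"
  have 1: "laplacian_energy T \<ge> 2 * ((\<Sum>i\<in>I. \<mu> i) + m + B - K - real (k + 1) * average_degree T)"
    using main m' unfolding S B_def K_def
    by (simp add: algebra_simps)
  have 2: "laplacian_energy T1 = 2 * (\<Sum>i\<in>I. \<mu> i) - 2 * K1"
    by (simp add: LE sum_subtractf K1_def)
  \<comment> \<open>The price of the larger average degree: each eigenvector of \<open>T1\<close> in
    the family loses 2 n2 / (n1 n), and at most n1 / 2 of them are used.\<close>
  have "average_degree T - average_degree T1 = 2 * n2 / (n1 * n)"
    using n1 n2 by (simp add: d1 dT nn field_simps)
  then have "2 * K - 2 * K1 = (2 * real (card I)) * (2 * n2 / (n1 * n))"
    unfolding K_def K1_def by (simp add: algebra_simps flip: right_diff_distrib)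
  also have "\<dots> \<le> n1 * (2 * n2 / (n1 * n))"
  proof (rule mult_right_mono)
    show "2 * real (card I) \<le> n1"
      using sigma I(2) unfolding n1_def by (metis of_nat_le_iff of_nat_mult of_nat_numeral)
  qed (use n1 n2 nn in simp)
  also have "\<dots> = 2 * n2 / n" using n1 by simp
  finally have 3: "2 * K - 2 * K1 \<le> 2 * n2 / n" .
  have 4: "real (k + 1) * average_degree T = 2 * real (k + 1) - 2 * real (k + 1) / n"
    by (simp add: dT algebra_simps)
  have 5: "(4 * real (k + 1) - 2 * n2) / n = 2 * (2 * real (k + 1) / n) - 2 * n2 / n"
    by (simp add: diff_divide_distrib)
  define p1 p2 p3 p4 where "p1 = real (k + 1) * average_degree T" and "p2 = 2 * real (k + 1) / n"
    and "p3 = 2 * n2 / n" and "p4 = 2 * real (k + 1)"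
  have p: "p1 = p4 - p2" by (simp only: p1_def p2_def p4_def 4)
  have "laplacian_energy T \<ge> laplacian_energy T1 + 2 * (B + m - p4) + (2 * p2 - p3)"
    using 1 2 3 p unfolding p1_def[symmetric] p3_def[symmetric] by argo
  then show ?thesis unfolding p2_def p3_def p4_def 5[symmetric] unfolding B_def n_def n2_def .
qed

section \<open>Paths\<close>

lemma arctan_ge_taylor:
  fixes x :: real
  assumes "0 \<le> x"
  shows "x - x ^ 3 / 3 + x ^ 5 / 5 - x ^ 7 / 7 \<le> arctan x"
proof -
  define f where "f y = arctan y - (y - y ^ 3 / 3 + y ^ 5 / 5 - y ^ 7 / 7)" for y :: real
  have "\<exists>d. (f has_real_derivative d) (at y) \<and> d \<ge> 0" for y
  proof -
    have "1 + y\<^sup>2 > 0" by (simp add: add_pos_nonneg)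
    then have "inverse (1 + y\<^sup>2) - (1 - y\<^sup>2 + y ^ 4 - y ^ 6) = y ^ 8 / (1 + y\<^sup>2)"
      by (simp add: field_simps power_numeral_reduce)
    moreover have "(f has_real_derivative inverse (1 + y\<^sup>2) - (1 - y\<^sup>2 + y ^ 4 - y ^ 6)) (at y)"
      unfolding f_def by (auto intro!: derivative_eq_intros)
    ultimately show ?thesis by (intro exI[of _ "y ^ 8 / (1 + y\<^sup>2)"]) auto
  qed
  then have "f 0 \<le> f x" using DERIV_nonneg_imp_nondecreasing[OF assms, of f] by blast
  then show ?thesis by (simp add: f_def)
qed

lemma arctan_le_self:
  fixes x :: real
  assumes "0 \<le> x"
  shows "arctan x \<le> x"
proof -
  define f where "f y = y - arctan y" for y :: real
  have "(f has_real_derivative 1 - inverse (1 + y\<^sup>2)) (at y)" for y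
    unfolding f_def by (auto intro!: derivative_eq_intros)
  moreover have "1 - inverse (1 + y\<^sup>2) \<ge> 0" for y :: real by (simp add: inverse_le_1_iff)
  ultimately have "f 0 \<le> f x" using DERIV_nonneg_imp_nondecreasing[OF assms, of f] by blast
  then show ?thesis by (simp add: f_def)
qed

text \<open>Machin's formula; the small arctangent is subtracted, so a crude upper bound for it is
  enough. The accuracy is chosen to give 4 / pi <= 1.27325.\<close>

lemma pi_ge: "3.14158 \<le> pi"
proof -
  have "pi = 16 * arctan (1 / 5) - 4 * arctan (1 / 239)" using machin by simp
  moreover have "arctan (1 / 239) \<le> 1 / 239" by (rule arctan_le_self) simp
  ultimately show ?thesis using arctan_ge_taylor[of "1 / 5"] by (simp add: power_divide)
qed


section \<open>The Laplacian spectrum of the path\<close>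

lemma proots_distinct:
  fixes p :: "real poly"
  assumes p: "p \<noteq> 0" and S: "finite S" "\<And>x. x \<in> S \<Longrightarrow> poly p x = 0" "card S = degree p"
  shows "proots p = mset_set S"
proof -
  have "mset_set S \<subseteq># proots p"
  proof (rule mset_subset_eqI)
    fix x
    show "count (mset_set S) x \<le> count (proots p) x"
      using S p by (cases "x \<in> S") (auto simp: order_root Suc_le_eq)
  qed
  moreover have "size (proots p) \<le> size (mset_set S)"
    using size_proots_le[of p] S(3) by simp
  ultimately show ?thesis
    using mset_subset_size[of "mset_set S" "proots p"] unfolding subset_mset.le_less by auto
qed

lemma pair_graph_path: "pair_graph (path_graph n)"
proof
  show "finite (pverts (path_graph n))" by (simp add: path_graph_def)
  show "finite (parcs (path_graph n))"
    by (rule finite_subset[of _ "{..<n} \<times> {..<n}"]) (auto simp: path_graph_def)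
  have "sym (parcs (path_graph n))" by (rule symI) (auto simp: path_graph_def)
  then show "symmetric (with_proj (path_graph n))" by (simp add: symmetric_def)
qed (auto simp: path_graph_def)

lemma card_parcs_path:
  assumes "n > 0"
  shows "card (parcs (path_graph n)) + 2 = 2 * n"
proof -
  have "parcs (path_graph n) = (\<lambda>i. (i, Suc i)) ` {..<n - 1} \<union> (\<lambda>i. (Suc i, i)) ` {..<n - 1}"
    by (auto simp: path_graph_def)
  moreover have "card ((\<lambda>i. (i, Suc i)) ` {..<n - 1} \<union> (\<lambda>i. (Suc i, i)) ` {..<n - 1})
      = card ((\<lambda>i. (i, Suc i)) ` {..<n - 1}) + card ((\<lambda>i. (Suc i, i)) ` {..<n - 1})"
    by (rule card_Un_disjoint) auto
  ultimately show ?thesis using assms by (simp add: card_image inj_on_def)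
qed

text \<open>The shift by 1/2 makes the cosine symmetric about the points -1/2 and n - 1/2 of the
  index line. Fictitious neighbours beyond both ends then contribute nothing, and the recurrence of
  the inner vertices holds everywhere.\<close>

lemma path_eigenvector:
  assumes n: "n > 0" and a: "a < n"
    and \<theta>: "\<theta> = pi * real k / real n"
  shows "lap (path_graph n) (\<lambda>j. cos ((real j + 1 / 2) * \<theta>)) a = (2 - 2 * cos \<theta>) * cos ((real a
    + 1 / 2) * \<theta>)"
proof -
  define x where "x j = cos ((real j + 1 / 2) * \<theta>)" for j
  define g where "g j = cos ((of_int j + 1 / 2) * \<theta>)" for j :: int
  have gx: "x j = g (int j)" for j by (simp add: x_def g_def)
  have rec: "g (j + 1) + g (j - 1) = 2 * cos \<theta> * g j" for j
  proof -
    have "g (j + 1) = cos ((of_int j + 1 / 2) * \<theta> + \<theta>)"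
      "g (j - 1) = cos ((of_int j + 1 / 2) * \<theta> - \<theta>)"
      by (simp_all add: g_def algebra_simps)
    then show ?thesis by (simp add: cos_add cos_diff g_def)
  qed
  have left: "g (-1) = g 0" by (simp add: g_def)
  have right: "g (int n) = g (int n - 1)"
  proof -
    have "g (int n) = cos (real n * \<theta> + \<theta> / 2)" "g (int n - 1) = cos (real n * \<theta> - \<theta> / 2)"
      by (simp_all add: g_def algebra_simps)
    moreover have "real n * \<theta> = pi * real k" using n by (simp add: \<theta>)
    ultimately show ?thesis by (simp add: cos_add cos_diff sin_npi2 mult.commute[of pi])
  qed
  have nb: "{b. (a, b) \<in> parcs (path_graph n)} = {b. b < n \<and> (b = Suc a \<or> a = Suc b)}"
    using a by (auto simp: path_graph_def)
  define A where "A = (if Suc a < n then x a - x (Suc a) else 0)"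
  define B where "B = (if a > 0 then x a - x (a - 1) else 0)"
  have "lap (path_graph n) x a = A + B"
  proof -
    have "{b. b < n \<and> (b = Suc a \<or> a = Suc b)} = (if Suc a < n then {Suc a} else {})
      \<union> (if a > 0 then {a - 1} else {})"
      using a by auto
    then show ?thesis unfolding lap_def nb A_def B_def by auto
  qed
  moreover have "A = x a - g (int a + 1)"
  proof (cases "Suc a < n")
    case False
    then have "int n = int a + 1" using a by simp
    then show ?thesis using False right by (simp add: A_def gx)
  qed (simp add: A_def gx add.commute)
  moreover have "B = x a - g (int a - 1)"
  proof (cases "a > 0")
    case False
    then show ?thesis using left by (simp add: B_def gx)
  qed (simp add: B_def gx of_nat_diff)
  ultimately have "lap (path_graph n) x a = 2 * x a - (g (int a + 1) + g (int a - 1))" by simp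
  also have "\<dots> = (2 - 2 * cos \<theta>) * x a" unfolding rec by (simp add: gx algebra_simps)
  finally show ?thesis unfolding x_def[abs_def] .
qed

text \<open>The n eigenvalues are distinct and hence exhaust the roots; no multiplicity has to be
  computed.\<close>

lemma laplacian_spectrum_path:
  assumes n: "n > 0"
  shows "laplacian_spectrum (path_graph n) = mset_set ((\<lambda>k. 2 - 2 * cos (pi * real k / real n)) ` {..<n})"
    and "inj_on (\<lambda>k. 2 - 2 * cos (pi * real k / real n)) {..<n}"
proof -
  interpret pair_graph "path_graph n" by (rule pair_graph_path)
  let ?G = "path_graph n" and ?f = "\<lambda>k. 2 - 2 * cos (pi * real k / real n)"
  have ord: "graph_order ?G = n" by (simp add: graph_order_def path_graph_def)
  note L = laplacian_mat_carrier[unfolded ord]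
  show inj: "inj_on ?f {..<n}"
  proof (rule inj_onI)
    fix k l assume kl: "k \<in> {..<n}" "l \<in> {..<n}" "?f k = ?f l"
    have r: "0 \<le> pi * real k / real n \<and> pi * real k / real n \<le> pi" if "k < n" for k
      using that by (simp add: field_simps)
    have "pi * real k / real n = pi * real l / real n"
      by (rule cos_inj_pi) (use r kl in auto)
    then show "k = l" using n by simp
  qed
  show "laplacian_spectrum ?G = mset_set (?f ` {..<n})"
    unfolding laplacian_spectrum_def
  proof (rule proots_distinct)
    have dm: "degree (char_poly (laplacian_mat ?G)) = n" "monic (char_poly (laplacian_mat ?G))"
      using degree_monic_char_poly[OF L] by auto
    then show "char_poly (laplacian_mat ?G) \<noteq> 0" by auto
    show "card (?f ` {..<n}) = degree (char_poly (laplacian_mat ?G))"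
      using inj dm by (simp add: card_image)
    fix z assume "z \<in> ?f ` {..<n}"
    then obtain k where k: "k < n" "z = ?f k" by blast
    define x where "x j = cos ((real j + 1 / 2) * (pi * real k / real n))" for j
    let ?v = "\<lambda>i. vertex_list ?G ! i"
    define y where "y = vec n (\<lambda>i. x (?v i))"
    have vl: "?v i < n" if "i < n" for i
    proof -
      have "?v i \<in> set (vertex_list ?G)" using vertex_list(3) that unfolding ord by (intro nth_mem) simp
      then show ?thesis unfolding vertex_list(2) by (simp add: path_graph_def)
    qed
    have "laplacian_mat ?G *\<^sub>v y = z \<cdot>\<^sub>v y"
    proof (rule eq_vecI)
      fix i assume "i < dim_vec (z \<cdot>\<^sub>v y)"
      then have i: "i < n" by (simp add: y_def)
      have "(laplacian_mat ?G *\<^sub>v y) $ i = (\<Sum>j<n. laplacian_mat ?G $$ (i, j) * x (?v j))"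
        using i L by (simp add: scalar_prod_def y_def atLeast0LessThan)
      also have "\<dots> = lap ?G x (?v i)"
        using laplacian_mat_mult[of i x] i unfolding ord .
      also have "\<dots> = z * x (?v i)"
        unfolding x_def k(2) by (rule path_eigenvector[OF n vl[OF i] refl])
      finally show "(laplacian_mat ?G *\<^sub>v y) $ i = (z \<cdot>\<^sub>v y) $ i" using i by (simp add: y_def)
    qed (use L in \<open>simp add: y_def\<close>)
    moreover have "y \<noteq> 0\<^sub>v n"
    proof -
      have "0 \<in> set (vertex_list ?G)" using vertex_list(2) n by (simp add: path_graph_def)
      then obtain i where i: "i < n" "?v i = 0" using vertex_list(3) unfolding ord in_set_conv_nth by auto
      have "x 0 \<noteq> 0"
      proof -
        have "0 \<le> 1 / 2 * (pi * real k / real n)" "1 / 2 * (pi * real k / real n) < pi / 2"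
          using k n by (auto simp: field_simps)
        then have "cos (1 / 2 * (pi * real k / real n)) > 0" by (intro cos_gt_zero_pi) (use pi_gt_zero in linarith)+
        then show ?thesis by (simp add: x_def)
      qed
      then have "y $ i \<noteq> 0" using i by (simp add: y_def)
      then show ?thesis using i by auto
    qed
    ultimately have "eigenvalue (laplacian_mat ?G) z"
      using L unfolding eigenvalue_def eigenvector_def by (intro exI[of _ y]) (simp add: y_def)
    then show "poly (char_poly (laplacian_mat ?G)) z = 0"
      using eigenvalue_root_char_poly[OF L] by simp
  qed simp
qed

section \<open>The energy of the path\<close>

lemma cos_le_sin_diff:
  fixes x :: real
  assumes "0 \<le> a" "a \<le> x" "x \<le> pi"
  shows "(x - a) * cos x \<le> sin x - sin a"
proof (cases "a = x")
  case False
  then have ax: "a < x" using assms by simp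
  have "\<exists>z>a. z < x \<and> sin x - sin a = (x - a) * cos z"
    by (rule MVT2[OF ax]) (auto intro!: derivative_eq_intros)
  then obtain z where z: "a < z" "z < x" "sin x - sin a = (x - a) * cos z" by blast
  have "cos x \<le> cos z" by (rule cos_monotone_0_pi_le) (use z assms in auto)
  then show ?thesis unfolding z(3) using ax by (intro mult_left_mono) auto
qed simp

text \<open>A Riemann sum with right endpoints for a decreasing function: each term is at most n /
  pi times an increment of the sine, and the increments telescope.\<close>

lemma sum_cos_le:
  assumes n: "n > 0" and m: "2 * m \<le> n"
  shows "(\<Sum>k=1..m. cos (pi * real k / real n)) \<le> real n / pi"
proof -
  have step: "(\<Sum>k=1..m. cos (pi * real k / real n)) \<le> real n / pi * sin (pi * real m / real n)"
    if "m \<le> n" for m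
    using that
  proof (induction m)
    case (Suc m)
    let ?x = "pi * real (Suc m) / real n" and ?a = "pi * real m / real n"
    have "pi * (real (Suc m) / real n) \<le> pi * 1"
      by (rule mult_left_mono) (use Suc.prems n in \<open>auto simp: field_simps\<close>)
    then have "(?x - ?a) * cos ?x \<le> sin ?x - sin ?a"
      by (intro cos_le_sin_diff) (auto simp: divide_right_mono)
    moreover have "?x - ?a = pi / real n" using n by (simp add: field_simps)
    ultimately have "real n / pi * (pi / real n * cos ?x) \<le> real n / pi * (sin ?x - sin ?a)"
      by (intro mult_left_mono) auto
    then have "cos ?x \<le> real n / pi * (sin ?x - sin ?a)" using n by simp
    then show ?case using Suc by (simp add: algebra_simps)
  qed simp
  have "real n / pi * sin (pi * real m / real n) \<le> real n / pi * 1"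
    by (intro mult_left_mono) auto
  then show ?thesis using step[of m] m by simp
qed

text \<open>The indices k and n - k are paired: their deviations 2 cos - 2/n and 2 cos + 2/n add up
  to 4 cos. Left over are k = 0 with 2 - 2/n and, for even n, k = n/2 with 2/n; together they
  account for the summand 2.\<close>

lemma laplacian_energy_path_le:
  assumes n: "n \<ge> 2"
  shows "laplacian_energy (path_graph n) \<le> 4 * real n / pi + 2"
proof -
  interpret pair_graph "path_graph n" by (rule pair_graph_path)
  let ?G = "path_graph n" and ?f = "\<lambda>k. 2 - 2 * cos (pi * real k / real n)"
  have ord: "graph_order ?G = n" by (simp add: graph_order_def path_graph_def)
  have ne: "pverts ?G \<noteq> {}" using n by (auto simp: path_graph_def lessThan_empty_iff)
  have d: "average_degree ?G = 2 - 2 / real n"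
  proof -
    have "real (card (parcs ?G)) = 2 * real n - 2" using card_parcs_path[of n] n by linarith
    then show ?thesis using average_degree_order[OF ne] n unfolding ord by (simp add: field_simps)
  qed
  define g where "g k = \<bar>2 / real n - 2 * cos (pi * real k / real n)\<bar>" for k
  have "laplacian_energy ?G = (\<Sum>k<n. \<bar>?f k - average_degree ?G\<bar>)"
    using laplacian_spectrum_path[of n] n
    by (simp add: laplacian_energy_def sum_unfold_sum_mset[symmetric] sum.reindex)
  also have "\<dots> = (\<Sum>k<n. g k)" by (simp add: d g_def algebra_simps)
  finally have LE: "laplacian_energy ?G = (\<Sum>k<n. g k)" .
  define m where "m = (n - 1) div 2"
  have refl: "cos (pi * real (n - k) / real n) = - cos (pi * real k / real n)" if "k \<le> n" for k
  proof -
    have "pi * real (n - k) / real n = pi - pi * real k / real n"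
      using that n by (simp add: of_nat_diff field_simps)
    then show ?thesis by (simp add: cos_pi_minus)
  qed
  have pair: "g k + g (n - k) \<le> 4 * cos (pi * real k / real n)" if k: "1 \<le> k" "k \<le> m" for k
  proof -
    have k2: "2 * k + 1 \<le> n" using k unfolding m_def by linarith
    \<comment> \<open>This removes the absolute value for every k < n/2. The worst angle is at
      distance y = pi / (2 n) from the right angle, where sin y >= 0.7 y and 0.7 * pi / 2 > 1
      suffice.\<close>
    have "1 / real n \<le> cos (pi * real k / real n)"
    proof -
      have "pi * real k / real n = pi / 2 - pi * (real n - 2 * real k) / (2 * real n)"
        using n by (simp add: field_simps)
      then have "cos (pi * real k / real n) = sin (pi * (real n - 2 * real k) / (2 * real n))"
        by (simp add: cos_diff)
      moreover have "sin (pi / (2 * real n)) \<le> sin (pi * (real n - 2 * real k) / (2 * real n))"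
      proof (rule sin_monotone_2pi_le)
        have r: "1 \<le> real n - 2 * real k" using k2 by linarith
        show "- (pi / 2) \<le> pi / (2 * real n)" using n by (smt (verit) divide_nonneg_nonneg of_nat_0_le_iff
          pi_ge_zero)
        show "pi / (2 * real n) \<le> pi * (real n - 2 * real k) / (2 * real n)"
          using r n by (simp add: divide_right_mono)
        show "pi * (real n - 2 * real k) / (2 * real n) \<le> pi / 2"
          using n by (simp add: field_simps)
      qed
      moreover have "1 / real n \<le> sin (pi / (2 * real n))"
      proof -
        let ?x = "pi / (2 * real n)"
        have x: "0 \<le> ?x" "?x \<le> pi / 4" using n by (auto simp: field_simps)
        have "cos (pi / 4) \<le> cos ?x" by (rule cos_monotone_0_pi_le) (use x pi_gt_zero in linarith)+
        moreover have "(1.4 :: real) \<le> sqrt 2" by (rule real_le_rsqrt) (simp add: power2_eq_square)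
        ultimately have "0.7 \<le> cos ?x" by (simp add: cos_45)
        then have "?x * 0.7 \<le> ?x * cos ?x" using x by (intro mult_left_mono)
        also have "\<dots> \<le> sin ?x" using cos_le_sin_diff[of 0 ?x] x by simp
        finally have "?x * 0.7 \<le> sin ?x" .
        moreover have "1 / real n \<le> ?x * 0.7" using pi_ge n by (simp add: field_simps)
        ultimately show ?thesis by linarith
      qed
      ultimately show ?thesis by linarith
    qed
    then have c: "2 / real n \<le> 2 * cos (pi * real k / real n)" by simp
    have "g (n - k) = \<bar>2 / real n + 2 * cos (pi * real k / real n)\<bar>"
      unfolding g_def by (subst refl) (use k2 in auto)
    then show ?thesis using c zero_le_divide_iff[of 2 "real n"] unfolding g_def by linarith
  qed
  define E where "E = (if even n then {n div 2} else {})"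
  have split: "{..<n} = {0} \<union> ({1..m} \<union> ((\<lambda>k. n - k) ` {1..m} \<union> E))"
  proof (rule Set.set_eqI)
    fix j
    have "j \<in> (\<lambda>k. n - k) ` {1..m} \<longleftrightarrow> n - m \<le> j \<and> j < n"
    proof
      assume "n - m \<le> j \<and> j < n"
      then have "j = n - (n - j)" "n - j \<in> {1..m}" by auto
      then show "j \<in> (\<lambda>k. n - k) ` {1..m}" by blast
    qed (use n in \<open>auto simp: m_def\<close>)
    then have *: "j \<in> {0} \<union> ({1..m} \<union> ((\<lambda>k. n - k) ` {1..m} \<union> E))
        \<longleftrightarrow> j \<le> m \<or> n - m \<le> j \<and> j < n \<or> j \<in> E" by auto
    show "j \<in> {..<n} \<longleftrightarrow> j \<in> {0} \<union> ({1..m} \<union> ((\<lambda>k. n - k) ` {1..m}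
      \<union> E))"
    proof (cases "even n")
      case True
      then obtain h where h: "n = 2 * h" by blast
      then have "m = h - 1" "E = {h}" by (auto simp: m_def E_def)
      then show ?thesis unfolding * using n h by auto
    next
      case False
      then obtain h where h: "n = 2 * h + 1" by (auto elim: oddE)
      then have "m = h" "E = {}" by (auto simp: m_def E_def)
      then show ?thesis unfolding * using n h by auto
    qed
  qed
  have "(\<Sum>k<n. g k) = g 0 + (sum g {1..m} + (sum g ((\<lambda>k. n - k) ` {1..m}) + sum g E))"
  proof -
    have m2: "2 * m < n" using n by (auto simp: m_def)
    have E: "m < j \<and> j < n - m" if "j \<in> E" for j
      using that n by (auto simp: E_def m_def split: if_splits elim!: evenE)
    have E': "n - k \<notin> E" "k \<notin> E" if "k \<le> m" for k
      using E[of "n - k"] E[of k] that m2 by (linarith, auto)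
    have fin: "finite E" by (simp add: E_def)
    have "sum g ((\<lambda>k. n - k) ` {1..m} \<union> E) = sum g ((\<lambda>k. n - k) ` {1..m}) + sum g E"
      by (rule sum.union_disjoint) (use m2 fin E' in auto)
    moreover have "sum g ({1..m} \<union> ((\<lambda>k. n - k) ` {1..m} \<union> E)) = sum g {1..m}
      + sum g ((\<lambda>k. n - k) ` {1..m} \<union> E)"
      by (rule sum.union_disjoint) (use m2 fin E' in auto)
    moreover have "sum g ({0} \<union> ({1..m} \<union> ((\<lambda>k. n - k) ` {1..m} \<union> E)))
        = sum g {0} + sum g ({1..m} \<union> ((\<lambda>k. n - k) ` {1..m} \<union> E))"
      by (rule sum.union_disjoint) (use m2 fin E' in auto)
    ultimately show ?thesis unfolding split by simp
  qed
  also have "sum g ((\<lambda>k. n - k) ` {1..m}) = (\<Sum>k=1..m. g (n - k))"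
    by (subst sum.reindex) (use n in \<open>auto simp: inj_on_def m_def\<close>)
  also have "sum g E \<le> 2 / real n"
  proof (cases "even n")
    case True
    then obtain h where h: "n = 2 * h" by blast
    then have "pi * real (n div 2) / real n = pi / 2" using n by simp
    then have "g (n div 2) = 2 / real n" unfolding g_def by (simp only: cos_pi_half) simp
    then show ?thesis using True by (simp add: E_def)
  qed (simp add: E_def)
  also have "g 0 = 2 - 2 / real n" using n by (simp add: g_def field_simps)
  finally have "(\<Sum>k<n. g k) \<le> 2 + (\<Sum>k=1..m. g k + g (n - k))"
    by (simp add: sum.distrib)
  also have "(\<Sum>k=1..m. g k + g (n - k)) \<le> (\<Sum>k=1..m. 4 * cos (pi * real k / real n))"
    by (rule sum_mono) (use pair in auto)
  also have "\<dots> = 4 * (\<Sum>k=1..m. cos (pi * real k / real n))" by (simp add: sum_distrib_left)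
  also have "\<dots> \<le> 4 * (real n / pi)"
    by (intro mult_left_mono sum_cos_le) (use n in \<open>auto simp: m_def\<close>)
  finally show ?thesis unfolding LE by simp
qed

section \<open>Trees of depth two\<close>

text \<open>The estimates on \<open>T2\<close> need a parent function but none of the labels of
  \<open>sns_graph\<close>. The value of \<open>parent\<close> at the root is arbitrary.\<close>

locale depth2_tree = pair_graph G for G :: "'a pair_pre_digraph" +
  fixes R :: 'a and parent :: "'a \<Rightarrow> 'a"
  assumes root: "R \<in> pverts G"
    and parcs_eq: "parcs G = (\<lambda>z. (parent z, z)) ` (pverts G - {R})
      \<union> (\<lambda>z. (z, parent z)) ` (pverts G - {R})"
    and depth: "\<And>z. z \<in> pverts G \<Longrightarrow> z \<noteq> R \<Longrightarrow> parent z \<noteq> R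
      \<Longrightarrow> parent (parent z) = R"
begin

lemma parent_in: "z \<in> pverts G \<Longrightarrow> z \<noteq> R \<Longrightarrow> parent z \<in> pverts G"
proof -
  assume "z \<in> pverts G" "z \<noteq> R"
  then have "(parent z, z) \<in> parcs G" unfolding parcs_eq by blast
  then show ?thesis by (rule in_arcsD1)
qed

lemma parent_neq:
  assumes "z \<in> pverts G" "z \<noteq> R"
  shows "parent z \<noteq> z"
proof
  assume z: "parent z = z"
  have "(parent z, z) \<in> parcs G" unfolding parcs_eq using assms by blast
  then show False using z no_loop by metis
qed

lemma edge_form_parent: "edge_form G x = (\<Sum>z\<in>pverts G - {R}. (x z - x (parent z))\<^sup>2)"
proof -
  let ?D = "(\<lambda>z. (parent z, z)) ` (pverts G - {R})" and ?U = "(\<lambda>z. (z, parent z)) ` (pverts G - {R})"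
  have disj: "?D \<inter> ?U = {}"
  proof (rule ccontr)
    assume "?D \<inter> ?U \<noteq> {}"
    then obtain q where q: "q \<in> ?D" "q \<in> ?U" by blast
    obtain z where z: "q = (parent z, z)" "z \<in> pverts G" "z \<noteq> R" using q(1) by blast
    obtain z' where z': "q = (z', parent z')" "z' \<noteq> R" using q(2) by blast
    have "(parent z, z) = (z', parent z')" using z(1) z'(1) by metis
    then have "parent z = z' \<and> z = parent z'" unfolding prod.inject .
    then show False using depth[OF z(2,3)] z(3) z'(2) by metis
  qed
  have "(\<Sum>(a, b)\<in>parcs G. (x a - x b)\<^sup>2) = (\<Sum>(a, b)\<in>?D. (x a - x b)\<^sup>2)
    + (\<Sum>(a, b)\<in>?U. (x a - x b)\<^sup>2)"
    unfolding parcs_eq by (rule sum.union_disjoint) (use disj pair_finite_verts in auto)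
  also have "(\<Sum>(a, b)\<in>?D. (x a - x b)\<^sup>2) = (\<Sum>z\<in>pverts G - {R}. (x z - x (parent z))\<^sup>2)"
    by (subst sum.reindex) (auto simp: inj_on_def power2_commute intro!: sum.cong)
  also have "(\<Sum>(a, b)\<in>?U. (x a - x b)\<^sup>2) = (\<Sum>z\<in>pverts G - {R}. (x z - x (parent z))\<^sup>2)"
    by (subst sum.reindex) (auto simp: inj_on_def)
  finally show ?thesis by (simp add: edge_form_def)
qed

definition kids :: "'a \<Rightarrow> 'a set" where
  "kids c = {z \<in> pverts G - {R}. parent z = c}"

lemma finite_kids [simp]: "finite (kids c)"
  unfolding kids_def using pair_finite_verts by auto

text \<open>\<open>(8, -5)\<close> approximates the top eigenvector \<open>(\<phi>, -1)\<close>, with \<open>\<phi>\<close> the golden ratio, of the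
  Laplacian block of a vertex of degree two and its pendent neighbour.\<close>

lemma edge_form_branch:
  assumes c: "c \<in> kids R" and l: "l \<in> kids c"
  shows "edge_form G (\<lambda>z. if z = c then 8 else if z = l then - 5 else 0) = 105 + 64 * (1
    + real (card (kids c)))"
proof -
  let ?x = "\<lambda>z. if z = c then 8 else if z = l then - 5 else (0 :: real)"
  have cR: "c \<noteq> R" "l \<noteq> R" "l \<noteq> c" "c \<in> pverts G" "l \<in> pverts G" "parent c = R"
    "parent l = c"
    using c l parent_neq by (auto simp: kids_def)
  have kl: "parent z \<noteq> l" if "z \<in> pverts G" "z \<noteq> R" for z
    using depth[OF that] cR by auto
  have "edge_form G ?x = (\<Sum>z\<in>pverts G - {R}. (if z = c then 64 else 0) + (if z = l then 105 else 0)
    + (if z \<in> kids c then 64 else 0))"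
    unfolding edge_form_parent
    by (rule sum.cong) (use cR kl c l parent_neq in \<open>auto simp: kids_def\<close>)
  also have "\<dots> = 64 + 105 + 64 * real (card (kids c))"
  proof -
    have "(\<Sum>z\<in>pverts G - {R}. if z \<in> kids c then 64 else 0) = (\<Sum>z\<in>kids c. 64 :: real)"
      by (rule sum.mono_neutral_cong_right) (auto simp: kids_def pair_finite_verts)
    then show ?thesis using cR pair_finite_verts by (simp add: sum.distrib)
  qed
  finally show ?thesis by simp
qed

end

section \<open>Test vectors on a finite core\<close>

definition on_list :: "'a list \<Rightarrow> real list \<Rightarrow> 'a \<Rightarrow> real" where
  "on_list vs X z = (\<Sum>i<length vs. if z = vs ! i then X ! i else 0)"

lemma on_list_nth:
  assumes "distinct vs" "i < length vs"
  shows "on_list vs X (vs ! i) = X ! i"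
proof -
  have "on_list vs X (vs ! i) = (\<Sum>j<length vs. if j = i then X ! j else 0)"
    unfolding on_list_def by (rule sum.cong) (use assms in \<open>auto simp: nth_eq_iff_index_eq\<close>)
  then show ?thesis using assms by simp
qed

lemma on_list_outside: "z \<notin> set vs \<Longrightarrow> on_list vs X z = 0"
  unfolding on_list_def by (rule sum.neutral) auto

text \<open>The edge form of the core by itself, \<open>par\<close> giving the position of each
  parent. Position 0 is the root, hence the \<open>tl\<close>. With \<open>dotp\<close> it turns
  conditions on test vectors into list arithmetic that the simplifier evaluates.\<close>

definition list_form :: "nat list \<Rightarrow> real list \<Rightarrow> real" where
  "list_form par X = (\<Sum>(a, k)\<leftarrow>zip (tl X) (tl par). (a - X ! k)\<^sup>2)"

definition dotp :: "real list \<Rightarrow> real list \<Rightarrow> real" where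
  "dotp X Y = (\<Sum>(a, b)\<leftarrow>zip X Y. a * b)"

lemma dotp_eq: "length X = m \<Longrightarrow> length Y = m \<Longrightarrow> dotp X Y = (\<Sum>i<m. X ! i * Y ! i)"
  by (simp add: dotp_def sum_list_sum_nth case_prod_beta atLeast0LessThan)

lemma list_form_eq:
  "length X = m \<Longrightarrow> length par = m \<Longrightarrow> list_form par X
    = (\<Sum>i=1..<m. (X ! i - X ! (par ! i))\<^sup>2)"
proof -
  assume *: "length X = m" "length par = m"
  have "list_form par X = (\<Sum>i<m - 1. (X ! Suc i - X ! (par ! Suc i))\<^sup>2)"
    unfolding list_form_def using *
    by (simp add: sum_list_sum_nth case_prod_beta atLeast0LessThan nth_tl)
  also have "\<dots> = (\<Sum>i=1..<m. (X ! i - X ! (par ! i))\<^sup>2)"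
    by (rule sum.reindex_bij_witness[of _ "\<lambda>i. i - 1" Suc]) auto
  finally show ?thesis .
qed

lemma sum_on_list:
  assumes "distinct vs" "set vs \<subseteq> V" "finite V"
  shows "(\<Sum>z\<in>V. on_list vs X z * g z) = (\<Sum>i<length vs. X ! i * g (vs ! i))"
proof -
  have "(\<Sum>z\<in>V. on_list vs X z * g z) = (\<Sum>z\<in>set vs. on_list vs X z * g z)"
    by (rule sum.mono_neutral_right) (use assms on_list_outside in auto)
  also have "\<dots> = (\<Sum>i<length vs. on_list vs X (vs ! i) * g (vs ! i))"
    by (rule sum.reindex_bij_betw[symmetric]) (use assms in \<open>auto intro: bij_betw_nth\<close>)
  also have "\<dots> = (\<Sum>i<length vs. X ! i * g (vs ! i))"
    by (rule sum.cong) (use assms in \<open>auto simp: on_list_nth\<close>)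
  finally show ?thesis .
qed

lemma dotp_on_list:
  assumes "distinct vs" "set vs \<subseteq> V" "finite V" "length X = length vs" "length Y = length vs"
  shows "(\<Sum>z\<in>V. on_list vs X z * on_list vs Y z) = dotp X Y"
  using assms by (simp add: sum_on_list[OF assms(1,2,3)] on_list_nth dotp_eq)

text \<open>A core contains the root, at position 0, and is closed under parents, so a vertex
  outside it is adjacent to at most one core vertex, its parent. The entry \<open>par ! 0\<close> is
  arbitrary.\<close>

locale core = depth2_tree G R parent for G :: "'a pair_pre_digraph" and R parent +
  fixes vs :: "'a list" and par :: "nat list"
  assumes vs: "distinct vs" "set vs \<subseteq> pverts G" "vs \<noteq> []" "vs ! 0 = R" "length par = length vs"
    and par: "\<And>i. 0 < i \<Longrightarrow> i < length vs \<Longrightarrow> par ! i < length vs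
      \<and> parent (vs ! i) = vs ! (par ! i)"
begin

text \<open>At the root these children include the centres of the branches, whose own leaves are
  counted separately.\<close>

definition extra :: "nat \<Rightarrow> nat" where
  "extra i = card (kids (vs ! i) - set vs)"

definition branches :: "'a set" where
  "branches = {c \<in> kids R - set vs. kids c \<noteq> {}}"

lemma finite_branches [simp]: "finite branches"
  by (simp add: branches_def)

lemma vs_R: "i < length vs \<Longrightarrow> vs ! i = R \<longleftrightarrow> i = 0"
  using vs by (metis length_greater_0_conv nth_eq_iff_index_eq)

text \<open>A child outside the core sees the value of its parent against its own value 0 and adds
  the square of that value; edges further out add nothing. This is how additional leaves enter the
  accounting.\<close>

lemma edge_form_core:
  assumes X: "length X = length vs"
  shows "edge_form G (on_list vs X) = list_form par X + (\<Sum>i<length vs. real (extra i) * (X ! i)\<^sup>2)"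
proof -
  let ?V = "pverts G - {R}" and ?x = "on_list vs X" and ?m = "length vs"
  have m: "?m > 0" using vs by simp
  have "edge_form G ?x = (\<Sum>z\<in>?V \<inter> set vs. (?x z - ?x (parent z))\<^sup>2)
    + (\<Sum>z\<in>?V - set vs. (?x z - ?x (parent z))\<^sup>2)"
    unfolding edge_form_parent by (subst sum.Int_Diff[of _ _ "set vs"]) (simp_all add: pair_finite_verts)
  also have "(\<Sum>z\<in>?V \<inter> set vs. (?x z - ?x (parent z))\<^sup>2)
    = (\<Sum>i=1..<?m. (?x (vs ! i) - ?x (parent (vs ! i)))\<^sup>2)"
  proof (rule sum.reindex_bij_betw[symmetric], unfold bij_betw_def, intro conjI)
    show "inj_on ((!) vs) {1..<?m}" using vs by (auto simp: inj_on_def nth_eq_iff_index_eq)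
    have "\<exists>i\<in>{1..<?m}. z = vs ! i" if "z \<in> set vs" "z \<noteq> R" for z
    proof -
      obtain i where i: "i < ?m" "z = vs ! i" using \<open>z \<in> set vs\<close> by (metis in_set_conv_nth)
      then have "i \<noteq> 0" using that vs by metis
      then show ?thesis using i by auto
    qed
    moreover have "vs ! i \<in> ?V \<inter> set vs" if "i \<in> {1..<?m}" for i
      using that vs(2) vs_R[of i] nth_mem[of i vs] by auto
    ultimately show "(!) vs ` {1..<?m} = ?V \<inter> set vs" by blast
  qed
  also have "\<dots> = (\<Sum>i=1..<?m. (X ! i - X ! (par ! i))\<^sup>2)"
    by (rule sum.cong) (use par vs in \<open>auto simp: on_list_nth\<close>)
  also have "\<dots> = list_form par X" by (rule list_form_eq[symmetric]) (use X vs in auto)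
  also have "(\<Sum>z\<in>?V - set vs. (?x z - ?x (parent z))\<^sup>2)
    = (\<Sum>z\<in>?V - set vs. (?x (parent z))\<^sup>2)"
    by (rule sum.cong) (auto simp: on_list_outside)
  also have "\<dots> = (\<Sum>z\<in>?V - set vs. \<Sum>i<?m. if parent z = vs ! i then (X ! i)\<^sup>2 else 0)"
  proof (rule sum.cong[OF refl])
    fix z
    show "(?x (parent z))\<^sup>2 = (\<Sum>i<?m. if parent z = vs ! i then (X ! i)\<^sup>2 else 0)"
    proof (cases "parent z \<in> set vs")
      case True
      then obtain j where j: "j < ?m" "parent z = vs ! j" by (metis in_set_conv_nth)
      have "(\<Sum>i<?m. if parent z = vs ! i then (X ! i)\<^sup>2 else 0) = (\<Sum>i<?m. if i
        = j then (X ! i)\<^sup>2 else 0)"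
        by (rule sum.cong) (use j vs in \<open>auto simp: nth_eq_iff_index_eq\<close>)
      then show ?thesis using j vs by (simp add: on_list_nth)
    next
      case False
      then have "(\<Sum>i<?m. if parent z = vs ! i then (X ! i)\<^sup>2 else 0) = 0"
        by (intro sum.neutral) auto
      then show ?thesis using False by (simp add: on_list_outside)
    qed
  qed
  also have "\<dots> = (\<Sum>i<?m. \<Sum>z\<in>?V - set vs. if parent z = vs ! i then (X ! i)\<^sup>2 else 0)"
    by (rule sum.swap)
  also have "\<dots> = (\<Sum>i<?m. real (extra i) * (X ! i)\<^sup>2)"
  proof (rule sum.cong[OF refl])
    fix i
    have "(\<Sum>z\<in>?V - set vs. if parent z = vs ! i then (X ! i)\<^sup>2 else 0)
      = (\<Sum>z\<in>kids (vs ! i) - set vs. (X ! i)\<^sup>2)"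
      by (rule sum.mono_neutral_cong_right) (auto simp: kids_def pair_finite_verts)
    then show "(\<Sum>z\<in>?V - set vs. if parent z = vs ! i then (X ! i)\<^sup>2 else 0)
      = real (extra i) * (X ! i)\<^sup>2"
      by (simp add: extra_def)
  qed
  finally show ?thesis .
qed

lemma order_core: "graph_order G = length vs + (\<Sum>i<length vs. extra i) + (\<Sum>c\<in>branches. card (kids c))"
proof -
  have U: "pverts G = set vs \<union> ((\<Union>i\<in>{..<length vs}. kids (vs ! i) - set vs)
    \<union> (\<Union>c\<in>branches. kids c))"
  proof (rule equalityI; rule subsetI)
    fix z assume z: "z \<in> pverts G"
    show "z \<in> set vs \<union> ((\<Union>i\<in>{..<length vs}. kids (vs ! i) - set vs)
      \<union> (\<Union>c\<in>branches. kids c))"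
    proof (cases "z \<in> set vs")
      case False
      then have zR: "z \<noteq> R" using vs by (metis length_greater_0_conv nth_mem)
      then have k: "z \<in> kids (parent z)" using z by (simp add: kids_def)
      show ?thesis
      proof (cases "parent z \<in> set vs")
        case True
        then obtain i where "i < length vs" "parent z = vs ! i" by (metis in_set_conv_nth)
        then show ?thesis using k False by auto
      next
        case pF: False
        then have "parent z \<noteq> R" using vs by (metis length_greater_0_conv nth_mem)
        then have "parent z \<in> branches"
          using depth[OF z zR] parent_in[OF z zR] pF k by (auto simp: branches_def kids_def)
        then show ?thesis using k by blast
      qed
    qed simp
  qed (use vs in \<open>auto simp: kids_def\<close>)
  have kd: "kids c \<inter> kids c' = {}" if "c \<noteq> c'" for c c' using that by (auto simp: kids_def)
  have sep: "kids c \<inter> set vs = {}" if "c \<notin> set vs" for c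
  proof (rule ccontr)
    assume "kids c \<inter> set vs \<noteq> {}"
    then obtain i where i: "i < length vs" "vs ! i \<in> kids c" by (metis disjoint_iff in_set_conv_nth)
    then have "i > 0" using vs by (cases "i = 0") (auto simp: kids_def)
    then have "c = vs ! (par ! i)" "par ! i < length vs" using par i by (auto simp: kids_def)
    then show False using that by auto
  qed
  have bs: "branches \<inter> set vs = {}" by (auto simp: branches_def)
  have "card (\<Union>i\<in>{..<length vs}. kids (vs ! i) - set vs) = (\<Sum>i<length vs. extra i)"
    unfolding extra_def
    by (rule card_UN_disjoint) (use kd vs in \<open>auto simp: nth_eq_iff_index_eq kids_def\<close>)
  moreover have "card (\<Union>c\<in>branches. kids c) = (\<Sum>c\<in>branches. card (kids c))"
    by (rule card_UN_disjoint) (use kd in auto)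
  moreover have "card ((\<Union>i\<in>{..<length vs}. kids (vs ! i) - set vs) \<union> (\<Union>c\<in>branches. kids c))
      = card (\<Union>i\<in>{..<length vs}. kids (vs ! i) - set vs) + card (\<Union>c\<in>branches. kids c)"
    by (rule card_Un_disjoint) (use bs in \<open>auto simp: kids_def\<close>)
  moreover have "card (pverts G) = card (set vs) + card ((\<Union>i\<in>{..<length vs}. kids (vs ! i) - set vs)
    \<union> (\<Union>c\<in>branches. kids c))"
    unfolding U by (rule card_Un_disjoint) (use sep bs in auto)
  ultimately show ?thesis using vs by (simp add: graph_order_def distinct_card)
qed

end

lemma sum_lessThan_add:
  fixes f :: "nat \<Rightarrow> 'b :: comm_monoid_add"
  shows "(\<Sum>j<a + b. f j) = (\<Sum>j<a. f j) + (\<Sum>j<b. f (a + j))"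
  by (induction b) (auto simp: add.assoc)

section \<open>Branches outside the core and the energy balance\<close>

context core
begin

text \<open>If \<open>v\<close> is a leaf at \<open>c\<close>, it is the one chosen, so that the
  branch vector does not vanish at the end of the new edge.\<close>

definition leaf_of :: "'a \<Rightarrow> 'a \<Rightarrow> 'a" where
  "leaf_of v c = (if v \<in> kids c then v else SOME l. l \<in> kids c)"

lemma leaf_of: "c \<in> branches \<Longrightarrow> leaf_of v c \<in> kids c"
  unfolding leaf_of_def branches_def using some_in_eq by auto

definition branch_vec :: "'a \<Rightarrow> 'a \<Rightarrow> 'a \<Rightarrow> real" where
  "branch_vec v c = (\<lambda>z. if z = c then 8 else if z = leaf_of v c then - 5 else 0)"

lemma branch_support: "c \<in> branches \<Longrightarrow> branch_vec v c z \<noteq> 0 \<Longrightarrow> z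
  = c \<or> z \<in> kids c"
  unfolding branch_vec_def using leaf_of by (auto split: if_splits)

lemma branch_not_core:
  assumes c: "c \<in> branches" and z: "z = c \<or> z \<in> kids c"
  shows "z \<in> pverts G" "z \<notin> set vs" "z \<noteq> R"
proof -
  show "z \<in> pverts G" "z \<noteq> R" using assms by (auto simp: branches_def kids_def)
  show "z \<notin> set vs"
  proof
    assume zs: "z \<in> set vs"
    then have zk: "z \<in> kids c" using c z by (auto simp: branches_def)
    obtain i where i: "i < length vs" "z = vs ! i" using zs by (metis in_set_conv_nth)
    then have "i > 0" using vs(4) zk by (cases "i = 0") (auto simp: kids_def)
    then have "c = vs ! (par ! i)" "par ! i < length vs" using par[of i] i zk by (auto simp: kids_def)
    then show False using c by (auto simp: branches_def)
  qed
qed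

lemma branch_disjoint:
  assumes "c \<in> branches" "c' \<in> branches" "c \<noteq> c'" "z = c \<or> z \<in> kids c"
    "z = c' \<or> z \<in> kids c'"
  shows False
  using assms branch_not_core(3)[of c c] branch_not_core(3)[of c' c'] by (auto simp: branches_def kids_def)

lemma branch_norm:
  assumes c: "c \<in> branches"
  shows "(\<Sum>z\<in>pverts G. (branch_vec v c z)\<^sup>2) = 89"
proof -
  have k: "leaf_of v c \<in> pverts G" "leaf_of v c \<noteq> R" "parent (leaf_of v c) = c"
    using leaf_of[OF c, of v] by (auto simp: kids_def)
  have l: "leaf_of v c \<noteq> c" "leaf_of v c \<in> pverts G" "c \<in> pverts G"
    using parent_neq[OF k(1,2)] k(1,3) branch_not_core(1)[OF c, of c] by metis+
  have "(\<Sum>z\<in>pverts G. (branch_vec v c z)\<^sup>2)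
      = (\<Sum>z\<in>pverts G. (if z = c then 64 else 0) + (if z = leaf_of v c then 25 else 0))"
    by (rule sum.cong) (use l in \<open>auto simp: branch_vec_def\<close>)
  then show ?thesis using l pair_finite_verts by (simp add: sum.distrib)
qed

lemma branch_form: "c \<in> branches \<Longrightarrow> edge_form G (branch_vec v c) = 105 + 64 * (1
  + real (card (kids c)))"
  unfolding branch_vec_def by (rule edge_form_branch) (use leaf_of in \<open>auto simp: branches_def\<close>)

text \<open>The value at \<open>v\<close> is 8 or -5; the smaller square yields the bonus 25 / 89 of
  the case \<open>iv = None\<close>.\<close>

lemma branch_at:
  assumes "v \<in> pverts G" "v \<noteq> R" "v \<in> branches \<or> parent v \<in> branches"
  shows "25 \<le> (\<Sum>c\<in>branches. (branch_vec v c v)\<^sup>2)"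
proof -
  obtain c where c: "c \<in> branches" "v = c \<or> v \<in> kids c" using assms by (auto simp: kids_def)
  then have "25 \<le> (branch_vec v c v)\<^sup>2" by (auto simp: branch_vec_def leaf_of_def)
  also have "\<dots> \<le> (\<Sum>c\<in>branches. (branch_vec v c v)\<^sup>2)"
    using c by (intro member_le_sum) auto
  finally show ?thesis .
qed

text \<open>A balance per vertex of \<open>T2\<close>: \<open>base\<close> pays for the core,
  \<open>P\<close> for its children outside the core, and the branch vectors for the leaves of
  branches. \<open>iv\<close> is the core position of \<open>v\<close>, or \<open>None\<close> if
  \<open>v\<close> lies in a branch.\<close>

theorem energy_gain:
  fixes T1 :: "'a pair_pre_digraph" and u v :: 'a and w :: "real list" and xs :: "real list list"
    and iv :: "nat option"
  assumes J: "join_graphs T1 G u v"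
    and arcs1: "card (parcs T1) + 2 = 2 * graph_order T1"
    and arcs2: "card (parcs G) + 2 = 2 * graph_order G"
    and deg: "vertex_degree T1 u \<ge> 1"
    and sigma: "2 * laplacian_sigma T1 \<le> graph_order T1"
    and order: "graph_order T1 + graph_order G \<ge> 19"
    and lens: "length w = length vs" "\<forall>X\<in>set xs. length X = length vs \<and> dotp X X > 0 \<and> dotp w X
      = 0"
    and W: "dotp w w = W" "W > 0"
    and orth: "\<And>i j. i < length xs \<Longrightarrow> j < i \<Longrightarrow> dotp (xs ! i) (xs ! j) = 0"
    and t: "0 < t" "t < 1"
    and c: "c = (1 - W * \<tau>\<^sup>2) / (1 + W * \<tau>\<^sup>2)" and h: "h = 2 * \<tau> / (1 + W * \<tau>\<^sup>2)"
    and iv: "case iv of None \<Rightarrow> v \<noteq> R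
      \<and> (v \<in> branches \<or> parent v \<in> branches) | Some i \<Rightarrow> i < length vs \<and> v = vs ! i"
    and ev: "ev = (\<lambda>X. case iv of None \<Rightarrow> 0 | Some i \<Rightarrow> X ! i)"
    and m: "m \<le> (1 - t) * (W * h\<^sup>2)"
      "m \<le> h\<^sup>2 * list_form par w + (c - h * ev w)\<^sup>2 - W * \<tau>\<^sup>2 / t"
    and P: "\<And>i. i < length vs \<Longrightarrow> extra i = 0 \<or>
      6893 / 10000 \<le> c\<^sup>2 * (w ! i)\<^sup>2 / W + (\<Sum>X\<leftarrow>xs. (X ! i)\<^sup>2 / dotp X X)"
    and base: "127325 / 100000 * real (length vs) + max 0 (2 * real (length vs) - 4 * real (length xs + 1)) / 19
      \<le> 2 * ((\<Sum>X\<leftarrow>xs. (list_form par X + (ev X)\<^sup>2) / dotp X X)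
          + (c\<^sup>2 * list_form par w + (c * ev w + h * W)\<^sup>2) / W + m
          + (case iv of None \<Rightarrow> 25 / 89 | Some i \<Rightarrow> 0)) - 4 * real (length xs + 1)"
  shows "laplacian_energy (join_by_edge T1 G u v) \<ge> laplacian_energy T1 + 4 * real (graph_order G) / pi"
proof -
  interpret join_graphs T1 G u v by (rule J)
  define n where "n = real (graph_order T1 + graph_order G)"
  have n: "n \<ge> 19" using order by (simp add: n_def)
  obtain qs where qs: "set qs = branches" "distinct qs" using finite_distinct_list[OF finite_branches] by blast
  define a b where "a = length xs" and "b = length qs"
  define x where "x j = (if j < a then on_list vs (xs ! j) else branch_vec v (qs ! (j - a)))" for j
  define N where "N j = (if j < a then dotp (xs ! j) (xs ! j) else 89)" for j
  have qb: "qs ! (j - a) \<in> branches" if "\<not> j < a" "j < a + b" for j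
    using that qs(1) unfolding b_def by (metis add.commute less_diff_conv2 not_less nth_mem)
  have lx: "length (xs ! j) = length vs" "dotp (xs ! j) (xs ! j) > 0" "dotp w (xs ! j) = 0" if "j < a" for j
    using lens that by (auto simp: a_def)
  have finV: "finite (pverts G)" by (rule pair_finite_verts)
  note dl = dotp_on_list[OF vs(1,2) finV]
  have core_branch: "on_list vs X z * branch_vec v c' z = 0" if "c' \<in> branches" for X z c'
    using that branch_support[OF that, of v z] branch_not_core(2)[OF that, of z] on_list_outside[of z vs X] by auto
  have ox: "(\<Sum>z\<in>pverts G. x i z * x j z) = 0" if ij: "j < i" "i < a + b" for i j
  proof -
    consider "i < a" | "\<not> i < a" "j < a" | "\<not> j < a" using ij by linarith
    then show ?thesis
    proof cases
      case 1
      then show ?thesis using ij lx[of i] lx[of j] orth[of i j] by (simp add: x_def dl a_def)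
    next
      case 2
      then have "x i z * x j z = 0" for z
        using core_branch[OF qb[OF 2(1) ij(2)], of "xs ! j" z] by (auto simp: x_def)
      then show ?thesis by (intro sum.neutral) auto
    next
      case 3
      then have i: "\<not> i < a" using ij by simp
      have "qs ! (i - a) \<noteq> qs ! (j - a)"
        using 3 ij qs(2) by (subst nth_eq_iff_index_eq) (auto simp: b_def)
      then have "branch_vec v (qs ! (i - a)) z * branch_vec v (qs ! (j - a)) z = 0" for z
        using branch_disjoint[of "qs ! (i - a)" "qs ! (j - a)" z] branch_support[of "qs ! (i - a)" v z]
          branch_support[of "qs ! (j - a)" v z] qb[OF i ij(2)] qb[OF 3] ij by auto
      then have "x i z * x j z = 0" for z using i 3 by (simp add: x_def)
      then show ?thesis by (intro sum.neutral) auto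
    qed
  qed
  have evX: "on_list vs X v = ev X" for X
  proof (cases iv)
    case None
    then have "v \<in> branches \<or> v \<in> kids (parent v)" "v \<in> branches \<or> parent v \<in> branches"
      using iv v by (auto simp: kids_def)
    then have "v \<notin> set vs" using branch_not_core(2) by blast
    then show ?thesis using None ev by (simp add: on_list_outside)
  qed (use iv ev vs in \<open>auto simp: on_list_nth\<close>)
  have main: "laplacian_energy (join_by_edge T1 G u v) \<ge> laplacian_energy T1
    + 2 * ((\<Sum>j<a + b. (edge_form G (x j) + (x j v)\<^sup>2) / N j)
      + (c\<^sup>2 * edge_form G (on_list vs w) + (c * on_list vs w v + h * W)\<^sup>2) / W + m - 2 * real (a + b + 1))
    + (4 * real (a + b + 1) - 2 * real (graph_order G)) / real (graph_order (join_by_edge T1 G u v))"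
  proof (rule laplacian_energy_join[OF arcs1 arcs2 deg sigma _ W(2) _ _ _ _ _ _ t c h m(1)])
    show "(\<Sum>z\<in>pverts G. (on_list vs w z)\<^sup>2) = W"
      using dl[OF lens(1) lens(1)] W(1) by (simp add: power2_eq_square)
    show "on_list vs w z = 0" if "z \<notin> pverts G" for z using that vs(2) by (intro on_list_outside) auto
    show "N j > 0" if "j < a + b" for j using lx by (simp add: N_def)
    show "(\<Sum>z\<in>pverts G. (x j z)\<^sup>2) = N j" if "j < a + b" for j
    proof (cases "j < a")
      case True
      then show ?thesis using dl[OF lx(1) lx(1), OF True True] by (simp add: x_def N_def power2_eq_square)
    next
      case False
      then show ?thesis using branch_norm[OF qb[OF False that]] by (simp add: x_def N_def)
    qed
    show "x j z = 0" if "j < a + b" "z \<notin> pverts G" for j z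
    proof (cases "j < a")
      case True
      then show ?thesis using that vs(2) by (auto simp: x_def intro!: on_list_outside)
    next
      case False
      then show ?thesis
        using branch_support[OF qb[OF False that(1)], of v z] branch_not_core(1)[OF qb[OF False that(1)], of z] that(2)
        by (auto simp: x_def)
    qed
    show "(\<Sum>z\<in>pverts G. x i z * x j z) = 0" if "i < a + b" "j < a + b" "i \<noteq> j" for i j
      using that ox[of j i] ox[of i j] by (cases "j < i") (auto simp: mult.commute)
    show "(\<Sum>z\<in>pverts G. on_list vs w z * x j z) = 0" if "j < a + b" for j
    proof (cases "j < a")
      case True
      then show ?thesis using dl[OF lens(1) lx(1), OF True] lx(3)[OF True] by (simp add: x_def)
    next
      case False
      then have "on_list vs w z * x j z = 0" for z
        using core_branch[OF qb[OF False that], of w z] by (simp add: x_def)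
      then show ?thesis by (intro sum.neutral) auto
    qed
    have "list_form par w \<le> edge_form G (on_list vs w)"
      unfolding edge_form_core[OF lens(1)] by (simp add: sum_nonneg)
    then show "m \<le> h\<^sup>2 * edge_form G (on_list vs w)
      + (c - h * on_list vs w v)\<^sup>2 - W * \<tau>\<^sup>2 / t"
      using m(2) evX mult_left_mono[of "list_form par w" "edge_form G (on_list vs w)" "h\<^sup>2"] by simp
  qed
  define Pr where "Pr i = c\<^sup>2 * (w ! i)\<^sup>2 / W + (\<Sum>X\<leftarrow>xs. (X ! i)\<^sup>2 / dotp X X)" for i
  define E where "E = real (\<Sum>i<length vs. extra i)"
  define S where "S = real (\<Sum>c\<in>branches. card (kids c))"
  define \<beta> where "\<beta> = (\<Sum>c\<in>branches. (branch_vec v c v)\<^sup>2)"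
  define B1 where "B1 = (\<Sum>X\<leftarrow>xs. (list_form par X + (ev X)\<^sup>2) / dotp X X)"
  define B2 where "B2 = (c\<^sup>2 * list_form par w + (c * ev w + h * W)\<^sup>2) / W"
  have s1: "(\<Sum>j<a. (edge_form G (x j) + (x j v)\<^sup>2) / N j)
      = B1 + (\<Sum>i<length vs. real (extra i) * (\<Sum>X\<leftarrow>xs. (X ! i)\<^sup>2 / dotp X X))"
  proof -
    have "(\<Sum>j<a. (edge_form G (x j) + (x j v)\<^sup>2) / N j)
      = (\<Sum>j<a. (list_form par (xs ! j) + (ev (xs ! j))\<^sup>2) / dotp (xs ! j) (xs ! j)
          + (\<Sum>i<length vs. real (extra i) * ((xs ! j ! i)\<^sup>2 / dotp (xs ! j) (xs ! j))))"
      by (rule sum.cong) (auto simp: x_def N_def edge_form_core lx evX add_divide_distrib sum_divide_distrib)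
    then show ?thesis
      unfolding sum.distrib B1_def
      by (simp add: sum_list_sum_nth atLeast0LessThan a_def sum_distrib_left) (rule sum.swap)
  qed
  have s2: "(\<Sum>j<b. (edge_form G (x (a + j)) + (x (a + j) v)\<^sup>2) / N (a + j)) = (169 * real b + 64 * S
    + \<beta>) / 89"
  proof -
    have "(\<Sum>j<b. (edge_form G (x (a + j)) + (x (a + j) v)\<^sup>2) / N (a + j))
        = (\<Sum>j<b. (\<lambda>c. (edge_form G (branch_vec v c) + (branch_vec v c v)\<^sup>2) / 89) (qs ! j))"
      by (simp add: x_def N_def)
    also have "\<dots> = (\<Sum>c\<in>branches. (edge_form G (branch_vec v c) + (branch_vec v c v)\<^sup>2) / 89)"
      by (rule sum.reindex_bij_betw) (use qs in \<open>auto simp: b_def intro!: bij_betw_nth\<close>)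
    also have "\<dots> = (\<Sum>c\<in>branches. (169 + 64 * real (card (kids c)) + (branch_vec v c v)\<^sup>2) / 89)"
      by (rule sum.cong) (auto simp: branch_form)
    also have "\<dots> = (169 * real (card branches) + 64 * S + \<beta>) / 89"
      by (simp add: sum_divide_distrib[symmetric] sum.distrib S_def \<beta>_def sum_distrib_left mult.commute)
    also have "card branches = b" using qs distinct_card by (metis b_def)
    finally show ?thesis .
  qed
  have s3: "(c\<^sup>2 * edge_form G (on_list vs w) + (c * on_list vs w v + h * W)\<^sup>2) / W
      = B2 + (\<Sum>i<length vs. real (extra i) * (c\<^sup>2 * (w ! i)\<^sup>2 / W))"
    unfolding edge_form_core[OF lens(1)] evX B2_def
    by (simp add: add_divide_distrib sum_divide_distrib distrib_left sum_distrib_left mult_ac)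
  have tot: "(\<Sum>j<a + b. (edge_form G (x j) + (x j v)\<^sup>2) / N j)
      + (c\<^sup>2 * edge_form G (on_list vs w) + (c * on_list vs w v + h * W)\<^sup>2) / W
      = B1 + B2 + (\<Sum>i<length vs. real (extra i) * Pr i) + (169 * real b + 64 * S + \<beta>) / 89"
    unfolding sum_lessThan_add s1 s2 s3 Pr_def by (simp add: distrib_left sum.distrib)
  have PE: "6893 / 10000 * E \<le> (\<Sum>i<length vs. real (extra i) * Pr i)"
  proof -
    have "(\<Sum>i<length vs. real (extra i) * (6893 / 10000)) \<le> (\<Sum>i<length vs. real (extra i) * Pr i)"
    proof (rule sum_mono)
      fix i assume "i \<in> {..<length vs}"
      then show "real (extra i) * (6893 / 10000) \<le> real (extra i) * Pr i"
        using P[of i] unfolding Pr_def[symmetric] by (cases "extra i = 0") auto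
    qed
    then have "(\<Sum>i<length vs. real (extra i)) * (6893 / 10000) \<le> (\<Sum>i<length vs. real (extra i) * Pr i)"
      by (simp only: sum_distrib_right)
    then show ?thesis by (simp add: E_def mult.commute)
  qed
  have ord: "real (graph_order G) = real (length vs) + E + S"
    using order_core by (simp add: E_def S_def)
  have bS: "real b \<le> S"
  proof -
    have "card branches = (\<Sum>c\<in>branches. 1)" by simp
    also have "\<dots> \<le> (\<Sum>c\<in>branches. card (kids c))"
      by (rule sum_mono) (auto simp: branches_def Suc_le_eq card_gt_0_iff)
    finally show ?thesis using qs distinct_card unfolding S_def b_def by (metis of_nat_le_iff)
  qed
  \<comment> \<open>The centres of branches are children of the root outside the core, and the root
    is position 0.\<close>
  have bE: "real b \<le> E"
  proof -
    have "card branches \<le> extra 0"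
      unfolding extra_def using vs(4) by (intro card_mono) (auto simp: branches_def)
    also have "extra 0 \<le> (\<Sum>i<length vs. extra i)"
      by (rule member_le_sum) (use vs in auto)
    finally show ?thesis using qs distinct_card unfolding E_def b_def by (metis of_nat_le_iff)
  qed
  define \<gamma> where "\<gamma> = 4 / pi"
  have \<gamma>: "\<gamma> \<le> 127325 / 100000" using pi_ge by (simp add: \<gamma>_def field_simps)
  have \<gamma>0: "\<gamma> > 0" by (simp add: \<gamma>_def)
  define i where "i = 1 / n"
  have i: "0 < i" "i \<le> 1 / 19" using n by (auto simp: i_def field_simps)
  have \<beta>: "(case iv of None \<Rightarrow> 25 / 89 | Some i \<Rightarrow> 0) \<le> \<beta> / 89"
  proof (cases iv)
    case None
    then show ?thesis using branch_at[of v] iv v by (auto simp: \<beta>_def)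
  qed (auto simp: \<beta>_def sum_nonneg)
  \<comment> \<open>The term in 1 / n is worst at 1 / 19 if its coefficient is positive and is
    dropped otherwise; this is the origin of the \<open>max 0\<close>.\<close>
  have base': "\<gamma> * real (length vs) + i * (2 * real (length vs) - 4 * real (a + 1))
      \<le> 2 * (B1 + B2 + m + \<beta> / 89) - 4 * real (a + 1)"
  proof -
    have "\<gamma> * real (length vs) \<le> 127325 / 100000 * real (length vs)" using \<gamma> by (intro
      mult_right_mono) auto
    moreover have "i * (2 * real (length vs) - 4 * real (a + 1)) \<le> i * max 0 (2 * real (length vs) - 4 * real (a
      + 1))"
      using i by (intro mult_left_mono) auto
    moreover have "i * max 0 (2 * real (length vs) - 4 * real (a + 1))
      \<le> 1 / 19 * max 0 (2 * real (length vs) - 4 * real (a + 1))"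
      using i by (intro mult_right_mono) auto
    ultimately show ?thesis using base \<beta> unfolding B1_def[symmetric] B2_def[symmetric] a_def by simp
  qed
  define g where "g = 127325 / 100000 - \<gamma>"
  have g: "g \<ge> 0" using \<gamma> by (simp add: g_def)
  \<comment> \<open>A leaf of a branch beyond its first raises the Rayleigh quotient by 64 / 89,
    hence the energy bound by 128 / 89, which exceeds 4 / pi + 2 / 19.\<close>
  have eS: "(\<gamma> + 2 * i) * (S - real b) \<le> 128 / 89 * (S - real b)"
    by (rule mult_right_mono) (use \<gamma> i bS in auto)
  have eE: "(\<gamma> + 2 * i) * (E - real b) \<le> 13786 / 10000 * (E - real b)"
    by (rule mult_right_mono) (use \<gamma> i bE in auto)
  \<comment> \<open>A branch with one leaf: 466 / 89 is twice its Rayleigh quotient 233 / 89, 13786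
    / 10000 comes from its centre as a child of the root, and 4 is the price of another vector. The
    terms in 1 / n cancel, since one vector returns 4 / n and each of two vertices costs 2 /
    n.\<close>
  have eb: "(2 * \<gamma>) * real b \<le> (13786 / 10000 + 466 / 89 - 4) * real b"
    by (rule mult_right_mono) (use \<gamma> in auto)
  have "laplacian_energy (join_by_edge T1 G u v) \<ge> laplacian_energy T1
     + 2 * (B1 + B2 + (\<Sum>i<length vs. real (extra i) * Pr i) + (169 * real b + 64 * S + \<beta>) / 89 + m - 2 *
       real (a + b + 1))
     + i * (4 * real (a + b + 1) - 2 * (real (length vs) + E + S))"
    using main unfolding tot ord order_join by (simp add: i_def n_def)
  moreover have "2 * (B1 + B2 + (\<Sum>i<length vs. real (extra i) * Pr i) + (169 * real b + 64 * S + \<beta>) / 89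
    + m - 2 * real (a + b + 1))
     + i * (4 * real (a + b + 1) - 2 * (real (length vs) + E + S)) \<ge> \<gamma> * (real (length vs) + E + S)"
    using base' eS eE eb PE by (simp add: algebra_simps add_divide_distrib)
  moreover have "4 * real (graph_order G) / pi = \<gamma> * (real (length vs) + E + S)"
    by (simp add: ord \<gamma>_def)
  ultimately show ?thesis by linarith
qed

end

text \<open>The numerical hypotheses of \<open>energy_gain\<close>. The list \<open>ad\<close> contains the core vertices
  to which further leaves or branches may be attached. The constant \<open>127325 / 100000\<close> exceeds
  \<open>4 / pi\<close>, and \<open>6893 / 10000\<close> exceeds half of \<open>4 / pi + 2 / 19\<close>, the cost of
    one more leaf
  when \<open>n \<ge> 19\<close>.\<close>

definition certificate ::
  "nat list \<Rightarrow> real list \<Rightarrow> real list list \<Rightarrow> nat option \<Rightarrow> real \<Rightarrow> real \<Rightarrow> real \<Rightarrow> nat list \<Rightarrow> bool" where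
  "certificate par w xs iv \<tau> t m ad \<longleftrightarrow>
    (let W = dotp w w; c = (1 - W * \<tau>\<^sup>2) / (1 + W * \<tau>\<^sup>2); h = 2 * \<tau> / (1 + W *
      \<tau>\<^sup>2);
         ev = (\<lambda>X. case iv of None \<Rightarrow> 0 | Some i \<Rightarrow> X ! i)
     in length w = length par \<and> W > 0 \<and>
        list_all (\<lambda>X. length X = length par \<and> dotp X X > 0 \<and> dotp w X = 0) xs \<and>
        sorted_wrt (\<lambda>X Y. dotp Y X = 0) xs \<and> 0 < t \<and> t < 1 \<and>
        m \<le> (1 - t) * (W * h\<^sup>2) \<and> m \<le> h\<^sup>2 * list_form par w + (c - h * ev w)\<^sup>2 - W *
          \<tau>\<^sup>2 / t \<and>
        list_all (\<lambda>i. 6893 / 10000 \<le> c\<^sup>2 * (w ! i)\<^sup>2 / W + (\<Sum>X\<leftarrow>xs. (X !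
          i)\<^sup>2 / dotp X X)) ad \<and>
        127325 / 100000 * real (length par) + max 0 (2 * real (length par) - 4 * real (length xs + 1)) / 19
          \<le> 2 * ((\<Sum>X\<leftarrow>xs. (list_form par X + (ev X)\<^sup>2) / dotp X X)
              + (c\<^sup>2 * list_form par w + (c * ev w + h * W)\<^sup>2) / W + m
              + (case iv of None \<Rightarrow> 25 / 89 | Some i \<Rightarrow> 0)) - 4 * real (length xs + 1))"

definition joinable :: "'a pair_pre_digraph \<Rightarrow> 'a pair_pre_digraph \<Rightarrow> 'a \<Rightarrow> 'a \<Rightarrow> bool" where
  "joinable T1 T2 u v \<longleftrightarrow> join_graphs T1 T2 u v \<and> card (parcs T1) + 2 = 2 * graph_order T1 \<and>
     card (parcs T2) + 2 = 2 * graph_order T2 \<and> vertex_degree T1 u \<ge> 1 \<and>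
     2 * laplacian_sigma T1 \<le> graph_order T1 \<and> graph_order T1 + graph_order T2 \<ge> 19"

lemma (in core) certificate_gain:
  assumes J: "joinable T1 G u v" and cert: "certificate par w xs iv \<tau> t m ad"
    and ex: "\<forall>i<length vs. i \<in> set ad \<or> kids (vs ! i) \<subseteq> set vs"
    and iv: "case iv of None \<Rightarrow> v \<noteq> R
      \<and> (v \<in> branches \<or> parent v \<in> branches) | Some i \<Rightarrow> i < length vs \<and> v = vs ! i"
  shows "laplacian_energy (join_by_edge T1 G u v) \<ge> laplacian_energy T1 + 4 * real (graph_order G) / pi"
proof (rule energy_gain[where m = m, OF _ _ _ _ _ _ _ _ refl _ _ _ _ refl refl iv refl])
  note C = cert[unfolded certificate_def Let_def, unfolded vs(5)]
  show "join_graphs T1 G u v" "card (parcs T1) + 2 = 2 * graph_order T1"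
    "card (parcs G) + 2 = 2 * graph_order G" "vertex_degree T1 u \<ge> 1"
    "2 * laplacian_sigma T1 \<le> graph_order T1" "graph_order T1 + graph_order G \<ge> 19"
    using J by (auto simp: joinable_def)
  show "length w = length vs" "0 < dotp w w" "0 < t" "t < 1" using C by blast+
  show "\<forall>X\<in>set xs. length X = length vs \<and> dotp X X > 0 \<and> dotp w X = 0"
    using C by (simp add: list_all_iff)
  show "dotp (xs ! i) (xs ! j) = 0" if "i < length xs" "j < i" for i j
    using C that by (simp add: sorted_wrt_iff_nth_less)
  fix i assume i: "i < length vs"
  show "extra i = 0 \<or> 6893 / 10000 \<le> ((1 - dotp w w * \<tau>\<^sup>2) / (1
    + dotp w w * \<tau>\<^sup>2))\<^sup>2 * (w ! i)\<^sup>2 / dotp w w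
      + (\<Sum>X\<leftarrow>xs. (X ! i)\<^sup>2 / dotp X X)"
  proof (cases "i \<in> set ad")
    case True
    then show ?thesis using C by (simp add: list_all_iff)
  next
    case False
    then have "kids (vs ! i) - set vs = {}" using ex i by blast
    then show ?thesis by (simp add: extra_def)
  qed
qed (use cert[unfolded certificate_def Let_def, unfolded vs(5)] in blast)+

lemma (in depth2_tree) core_intro:
  assumes "distinct vs" "set vs \<subseteq> pverts G" "vs \<noteq> []" "vs ! 0 = R" "length par = length vs"
    and "\<forall>i<length vs. 0 < i \<longrightarrow> par ! i < length vs \<and> parent (vs ! i) = vs ! (par ! i)"
  shows "core G R parent vs par"
  using assms depth2_tree_axioms by (auto simp: core_def core_axioms_def)

text \<open>The test vectors come from a numerical optimisation followed by rounding. In the names,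
  \<open>l\<close> and \<open>g\<close> mean that the new edge ends in a leaf at the root or in a grandchild of the
    root; the
  digits count the leaves at the root and then the leaves at each vertex of level 1 in the core.\<close>

lemma certificate_R: "certificate [0, 0, 0, 2, 0, 4] [4, -1, 1, -1, 1, -1]
    [[2, 0, -3, 1, -3, 1], [0, 0, 7, -3, -7, 3]] (Some 0) (1/20) (1/10) (341/2000) [0, 2, 4]"
  unfolding certificate_def by (simp add: dotp_def list_form_def power2_eq_square)

text \<open>In the certificates with \<tau> > 0 no entry of \<open>w\<close> exceeds in absolute
  value the one at the end of the new edge, which is positive: the rotation acts there through the
  square of \<open>c * w v + h * W\<close>.\<close>

lemma certificate_child: "certificate [0, 0, 0, 2, 0, 4] [1, -1, 5, -2, 0, 0]
    [[4, -1, -1, 0, 0, -1], [1, 1, 0, 0, -6, 3]] (Some 2) (1/40) (1/10) (67/1000) [0, 2, 4]"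
  unfolding certificate_def by (simp add: dotp_def list_form_def power2_eq_square)

lemma certificate_l111: "certificate [0, 0, 0, 2, 0, 4] [-1, 3, -1, 1, -1, 1]
    [[8, -2, -5, 2, -5, 2], [0, 0, 5, -3, -5, 3]] (Some 1) (3/40) (1/5) (433/2000) []"
  unfolding certificate_def by (simp add: dotp_def list_form_def power2_eq_square)

lemma certificate_l211: "certificate [0, 0, 0, 0, 3, 0, 5] [-2, 6, 1, -4, 2, -4, 2]
    [[814, -174, -164, -316, 77, -316, 77], [0, 0, 0, 7, -3, -7, 3]] (Some 1) (1/40) (1/10) (33/200) [0]"
  unfolding certificate_def by (simp add: dotp_def list_form_def power2_eq_square)

lemma certificate_l1111: "certificate [0, 0, 0, 2, 0, 4, 0, 6] [-1, 3, -1, 1, -1, 1, -1, 1]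
    [[57, -11, -23, 7, -23, 7, -23, 7], [0, 0, 6, -3, -4, 2, -2, 1], [0, 0, -2, 1, -8, 4, 10, -5]] (Some 1) (1/20)
      (1/10) (133/1000) [0]"
  unfolding certificate_def by (simp add: dotp_def list_form_def power2_eq_square)

lemma certificate_l121: "certificate [0, 0, 0, 2, 2, 0, 5] [-3, 4, -2, 1, 1, -3, 2]
    [[69, -4, -174, 65, 65, 69, -24], [2199, -520, -198, -97, -97, -2241, 876]] (Some 1) (1/40) (1/10) (187/2000) [0,
      2, 5]"
  unfolding certificate_def by (simp add: dotp_def list_form_def power2_eq_square)

lemma certificate_g111: "certificate [0, 0, 0, 2, 0, 4] [-1, 1, -1, 3, -1, 1]
    [[-8, 1, -1, 3, 13, -6], [3, -1, -3, 1, 1, -1]] (Some 3) (1/12) (1/4) (121/500) []"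
  unfolding certificate_def by (simp add: dotp_def list_form_def power2_eq_square)

lemma certificate_g211: "certificate [0, 0, 0, 0, 3, 0, 5] [-1, 0, 0, -1, 2, -1, 1]
    [[7, -2, -2, -3, 1, -2, 0], [0, 0, 0, 1, -1, -2, 1]] (Some 4) (1/8) (1/5) (453/2000) [0]"
  unfolding certificate_def by (simp add: dotp_def list_form_def power2_eq_square)

lemma certificate_g1111: "certificate [0, 0, 0, 2, 0, 4, 0, 6] [-1, 1, 0, 3, -1, 1, -1, 1]
    [[6, -1, -2, 1, -2, 0, -2, 0], [0, 0, 3, -2, -2, 1, -2, 1], [0, 0, 0, 0, 2, -1, -2, 1]] (Some 3) (1/12) (1/5)
      (217/2000) [0]"
  unfolding certificate_def by (simp add: dotp_def list_form_def power2_eq_square)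

lemma certificate_g112: "certificate [0, 0, 0, 2, 0, 4, 4] [-1, 0, -1, 2, 0, 0, 0]
    [[7, -2, -3, 2, -4, 0, 0], [1, -1, -1, 0, 3, -1, -1]] (Some 3) (1/8) (1/6) (3/20) [0, 4]"
  unfolding certificate_def by (simp add: dotp_def list_form_def power2_eq_square)

lemma certificate_g121: "certificate [0, 0, 0, 2, 2, 0, 5] [-2, 1, -1, 4, 0, -2, 2]
    [[1, 0, -4, 1, 1, 2, -1], [95, -24, -20, -1, -1, -74, 25]] (Some 3) (1/20) (1/6) (27/125) [0, 2]"
  unfolding certificate_def by (simp add: dotp_def list_form_def power2_eq_square)

lemma certificate_g122: "certificate [0, 0, 0, 2, 2, 0, 5, 5] [-3, 2, -3, 3, 1, -1, 1, 1]
    [[5, -2, -5, 1, 1, 0, 0, 0], [1, 0, 1, 0, 0, -4, 1, 1]] (Some 3) (1/40) (1/10) (3/40) [0, 2, 5]"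
  unfolding certificate_def by (simp add: dotp_def list_form_def power2_eq_square)

text \<open>With \<tau> = 0 nothing is rotated: c = 1 and h = m = 0. The squares that the new edge
  adds to the vectors on \<open>T2\<close> are enough at each of these ends, so a single family
  serves all of them. Two of its vectors are invariant under permuting the three level 1 vertices
  with their leaves; the other two are differences between them.\<close>

lemma certificate_no_leaf:
  assumes "iv \<in> {None, Some 0, Some 1, Some 2}"
  shows "certificate [0, 0, 1, 1, 0, 4, 4, 0, 7, 7] [6, -4, 1, 1, -4, 1, 1, -4, 1, 1]
    [[3, 1, -1, -1, 1, -1, -1, 1, -1, -1], [0, 11, -4, -4, -11, 4, 4, 0, 0, 0],
     [0, 11, -4, -4, 11, -4, -4, -22, 8, 8]] iv 0 (1/2) 0 [0, 1, 4, 7]"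
  using assms unfolding certificate_def
  by (auto simp: dotp_def list_form_def power2_eq_square)

section \<open>Case analysis on the tree and on the end of the new edge\<close>

context depth2_tree
begin

lemma kidsD: "z \<in> kids c \<Longrightarrow> z \<in> pverts G \<and> z \<noteq> R \<and> parent z = c"
  by (auto simp: kids_def)

lemma grandkids: "c \<in> kids R \<Longrightarrow> z \<in> kids c \<Longrightarrow> kids z = {}"
proof (rule ccontr)
  assume c: "c \<in> kids R" and z: "z \<in> kids c" and "kids z \<noteq> {}"
  then obtain y where "y \<in> kids z" by blast
  then show False using depth[of y] kidsD[OF c] kidsD[OF z] kidsD[of y z] by blast
qed

text \<open>A level 1 vertex with s_i = 0 counts as a leaf at the root: the case split concerns the
  tree itself, which does not determine the parameters p and s_i.\<close>

definition leaves :: "'a set" where "leaves = {c \<in> kids R. kids c = {}}"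

definition inner :: "'a set" where "inner = {c \<in> kids R. kids c \<noteq> {}}"

lemma innerD: "a \<in> inner \<Longrightarrow> a \<in> kids R \<and> (\<exists>a'. a' \<in> kids a)"
  by (auto simp: inner_def)

lemma leavesD: "l \<in> leaves \<Longrightarrow> l \<in> kids R \<and> kids l = {}"
  by (auto simp: leaves_def)

lemma finite_inner [simp]: "finite inner" by (simp add: inner_def)

lemma vertex_cases:
  assumes "v \<in> pverts G"
  obtains "v = R" | "v \<in> leaves" | "v \<in> inner" | a where "a \<in> inner" "v \<in> kids a"
proof (cases "v = R")
  case False
  then have v: "v \<in> kids (parent v)" using assms by (simp add: kids_def)
  show ?thesis
  proof (cases "parent v = R")
    case True
    then show ?thesis using v that(2,3) by (auto simp: inner_def leaves_def)
  next
    case pR: False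
    then have "parent v \<in> kids R" using parent_in[OF assms False] depth[OF assms False] by (simp add: kids_def)
    then show ?thesis using v that(4)[of "parent v"] by (auto simp: inner_def)
  qed
qed (rule that(1))

lemma singleton_kids: "a' \<in> kids a \<Longrightarrow> \<not> card (kids a) \<ge> 2 \<Longrightarrow> kids a = {a'}"
  by (rule ccontr) (metis Suc_1 card_1_singleton_iff card_gt_0_iff empty_iff finite_kids le_neq_implies_less
    less_Suc_eq_le not_less_eq_eq singleton_iff One_nat_def Suc_leI)

lemma other_element:
  assumes "finite S" "card S \<ge> 2" "a \<in> S"
  obtains b where "b \<in> S" "b \<noteq> a"
proof -
  have "\<not> S \<subseteq> {a}" using assms card_mono[of "{a}" S] by auto
  then show thesis using that by blast
qed

lemma third_element:
  assumes "finite S" "card S \<ge> 3" "a \<in> S" "b \<in> S"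
  obtains c where "c \<in> S" "c \<noteq> a" "c \<noteq> b"
proof -
  have "card {a, b} \<le> 2" by (simp add: card_insert_if)
  then have "\<not> S \<subseteq> {a, b}" using assms card_mono[of "{a, b}" S] by auto
  then show thesis using that by blast
qed

lemma subset_if_card:
  assumes "finite S" "card S \<le> card B" "B \<subseteq> S"
  shows "S \<subseteq> B"
  using assms card_subset_eq[of S B] card_mono[of S B] by force

lemmas core_simps = eval_nat_numeral All_less_Suc

text \<open>If the new edge ends at the root or at a level 1 vertex with leaves, one core of six
  vertices tolerates further children at the root and at both its level 1 vertices. If it ends in a
  leaf or a grandchild of the root, the smaller certificates tolerate fewer of them. A child that
  could sit at a position not tolerated is then taken into the core, until no such child is
  left.\<close>

theorem depth2_gain_leaf:
  assumes J: "joinable T1 G u v" and v: "v \<in> pverts G" and two: "card inner \<ge> 2"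
    and ne: "leaves \<noteq> {}"
  shows "laplacian_energy (join_by_edge T1 G u v) \<ge> laplacian_energy T1 + 4 * real (graph_order G) / pi"
proof -
  note gain = core.certificate_gain[OF _ J]
  have core111: "core G R parent [R, l, a, a', b, b'] [0, 0, 0, 2, 0, 4]"
    if "l \<in> leaves" "a \<in> inner" "b \<in> inner" "a \<noteq> b" "a' \<in> kids a" "b' \<in> kids b" for l a a'
      b b'
    using that leavesD[OF that(1)] kidsD[of a R] kidsD[of b R] kidsD[of l R] kidsD[OF that(5)] kidsD[OF that(6)]
      innerD[OF that(2)] innerD[OF that(3)] root
    by (intro core_intro) (auto simp: core_simps)
  have core211: "core G R parent [R, l, k, a, a', b, b'] [0, 0, 0, 0, 3, 0, 5]"
    if "l \<in> leaves" "a \<in> inner" "b \<in> inner" "a \<noteq> b" "a' \<in> kids a" "b' \<in> kids b"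
      "k \<in> leaves" "k \<noteq> l" for l k a a' b b'
    using that leavesD[OF that(1)] leavesD[OF that(7)] kidsD[of a R] kidsD[of b R] kidsD[of l R] kidsD[of k R]
      kidsD[OF that(5)] kidsD[OF that(6)]
      innerD[OF that(2)] innerD[OF that(3)] root
    by (intro core_intro) (auto simp: core_simps)
  have core1111: "core G R parent [R, l, a, a', b, b', c, c'] [0, 0, 0, 2, 0, 4, 0, 6]"
    if "l \<in> leaves" "a \<in> inner" "b \<in> inner" "a \<noteq> b" "a' \<in> kids a" "b' \<in> kids b"
      "c \<in> inner" "c \<noteq> a" "c \<noteq> b" "c' \<in> kids c" for l a a' b b' c c'
    using that leavesD[OF that(1)] kidsD[of a R] kidsD[of b R] kidsD[of c R] kidsD[of l R] kidsD[OF that(5)]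
      kidsD[OF that(6)] kidsD[OF that(10)]
      innerD[OF that(2)] innerD[OF that(3)] innerD[OF that(7)] root
    by (intro core_intro) (auto simp: core_simps)
  have core121: "core G R parent [R, l, a, a', a'', b, b'] [0, 0, 0, 2, 2, 0, 5]"
    if "l \<in> leaves" "a \<in> inner" "b \<in> inner" "a \<noteq> b" "a' \<in> kids a" "b' \<in> kids b"
      "a'' \<in> kids a" "a'' \<noteq> a'" for l a a' a'' b b'
    using that leavesD[OF that(1)] kidsD[of a R] kidsD[of b R] kidsD[of l R] kidsD[OF that(5)] kidsD[OF that(6)]
      kidsD[OF that(7)]
      innerD[OF that(2)] innerD[OF that(3)] root
    by (intro core_intro) (auto simp: core_simps)
  have core112: "core G R parent [R, l, a, a', b, b', b''] [0, 0, 0, 2, 0, 4, 4]"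
    if "l \<in> leaves" "a \<in> inner" "b \<in> inner" "a \<noteq> b" "a' \<in> kids a" "b' \<in> kids b"
      "b'' \<in> kids b" "b'' \<noteq> b'" for l a a' b b' b''
    using that leavesD[OF that(1)] kidsD[of a R] kidsD[of b R] kidsD[of l R] kidsD[OF that(5)] kidsD[OF that(6)]
      kidsD[OF that(7)]
      innerD[OF that(2)] innerD[OF that(3)] root
    by (intro core_intro) (auto simp: core_simps)
  have core122: "core G R parent [R, l, a, a', a'', b, b', b''] [0, 0, 0, 2, 2, 0, 5, 5]"
    if "l \<in> leaves" "a \<in> inner" "b \<in> inner" "a \<noteq> b" "a' \<in> kids a" "b' \<in> kids b"
      "a'' \<in> kids a" "a'' \<noteq> a'" "b'' \<in> kids b" "b'' \<noteq> b'" for l a a' a'' b b' b''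
    using that leavesD[OF that(1)] kidsD[of a R] kidsD[of b R] kidsD[of l R] kidsD[OF that(5)] kidsD[OF that(6)]
      kidsD[OF that(7)] kidsD[OF that(9)]
      innerD[OF that(2)] innerD[OF that(3)] root
    by (intro core_intro) (auto simp: core_simps)
  have noK: "kids z = {}" if "z \<in> leaves \<or> (\<exists>a\<in>inner. z \<in> kids a)" for z
    using that grandkids leavesD innerD by blast
  have noI: "a \<in> inner \<Longrightarrow> z \<in> kids a \<Longrightarrow> kids z = {}" for a z
    using grandkids innerD by blast
  obtain l0 where l0: "l0 \<in> leaves" using ne by blast
  have fl: "finite leaves" by (simp add: leaves_def)
  have kR: "kids R = leaves \<union> inner" by (auto simp: leaves_def inner_def)
  from v show ?thesis
  proof (cases rule: vertex_cases)
    case 1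
    obtain a where a: "a \<in> inner" using two by fastforce
    obtain b where b: "b \<in> inner" "b \<noteq> a" using other_element[OF finite_inner two a] .
    obtain a' b' where ab: "a' \<in> kids a" "b' \<in> kids b" using innerD a b by blast
    show ?thesis
      by (rule gain[OF core111[OF l0 a b(1) b(2)[symmetric] ab] certificate_R])
         (use 1 a b ab l0 noK in \<open>auto simp: core_simps\<close>)
  next
    case 3
    obtain b where b: "b \<in> inner" "b \<noteq> v" using other_element[OF finite_inner two 3] .
    obtain a' b' where ab: "a' \<in> kids v" "b' \<in> kids b" using innerD 3 b by blast
    show ?thesis
      by (rule gain[OF core111[OF l0 3 b(1) b(2)[symmetric] ab] certificate_child])
         (use 3 b ab l0 noK in \<open>auto simp: core_simps\<close>)
  next
    case 2
    show ?thesis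
    proof (cases "\<exists>a\<in>inner. card (kids a) \<ge> 2")
      case True
      then obtain a where a: "a \<in> inner" "card (kids a) \<ge> 2" by blast
      obtain b where b: "b \<in> inner" "b \<noteq> a" using other_element[OF finite_inner two a(1)] .
      obtain a' b' where ab: "a' \<in> kids a" "b' \<in> kids b" using innerD a b by blast
      obtain a'' where a'': "a'' \<in> kids a" "a'' \<noteq> a'" using other_element[OF finite_kids a(2) ab(1)] .
      show ?thesis
        by (rule gain[OF core121[OF 2 a(1) b(1) b(2)[symmetric] ab a''] certificate_l121])
           (use 2 a b ab a'' noK in \<open>auto simp: core_simps\<close>)
    next
      case small: False
      obtain a where a: "a \<in> inner" using two by fastforce
      obtain b where b: "b \<in> inner" "b \<noteq> a" using other_element[OF finite_inner two a] .
      obtain a' b' where ab: "a' \<in> kids a" "b' \<in> kids b" using innerD a b by blast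
      have ka: "kids a = {a'}" "kids b = {b'}" using singleton_kids ab small a b by blast+
      show ?thesis
      proof (cases "card inner \<ge> 3")
        case True
        obtain c where c: "c \<in> inner" "c \<noteq> a" "c \<noteq> b" using third_element[OF finite_inner True a
          b(1)] .
        obtain c' where c': "c' \<in> kids c" using innerD c by blast
        have kc: "kids c = {c'}" using singleton_kids c' small c by blast
        show ?thesis
          by (rule gain[OF core1111[OF 2 a b(1) b(2)[symmetric] ab c c'] certificate_l1111])
             (use 2 a b ab c c' ka kc noK noI[OF a ab(1)] noI[OF b(1) ab(2)] noI[OF c(1) c'] in \<open>auto simp:
               core_simps\<close>)
      next
        case in2: False
        have inn: "inner \<subseteq> {a, b}" by (rule subset_if_card) (use in2 a b in auto)
        show ?thesis
        proof (cases "card leaves \<ge> 2")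
          case True
          obtain k where k: "k \<in> leaves" "k \<noteq> v" using other_element[OF fl True 2] .
          show ?thesis
            by (rule gain[OF core211[OF 2 a b(1) b(2)[symmetric] ab k] certificate_l211])
               (use 2 a b ab k ka noK noI[OF a ab(1)] noI[OF b(1) ab(2)] in \<open>auto simp: core_simps\<close>)
        next
          \<comment> \<open>The tree now coincides with the six-vertex core, which is why
            \<open>certificate_l111\<close> gets by without any admissible position.\<close>
          case False
          have "leaves \<subseteq> {v}" by (rule subset_if_card) (use fl False 2 in auto)
          then have "kids R \<subseteq> set [R, v, a, a', b, b']" unfolding kR using inn by auto
          then show ?thesis
            by (intro gain[OF core111[OF 2 a b(1) b(2)[symmetric] ab] certificate_l111])
               (use 2 a b ab ka noK noI[OF a ab(1)] noI[OF b(1) ab(2)] in \<open>auto simp: core_simps\<close>)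
        qed
      qed
    qed
  next
    case (4 a)
    show ?thesis
    proof (cases "card (kids a) \<ge> 2")
      case True
      obtain a'' where a'': "a'' \<in> kids a" "a'' \<noteq> v" using other_element[OF finite_kids True 4(2)] .
      show ?thesis
      proof (cases "\<exists>b\<in>inner - {a}. card (kids b) \<ge> 2")
        case True
        then obtain b where b: "b \<in> inner" "b \<noteq> a" "card (kids b) \<ge> 2" by blast
        obtain b' where b': "b' \<in> kids b" using innerD b by blast
        obtain b'' where b'': "b'' \<in> kids b" "b'' \<noteq> b'" using other_element[OF finite_kids b(3) b'] .
        show ?thesis
          by (rule gain[OF core122[OF l0 4(1) b(1) b(2)[symmetric] 4(2) b' a'' b''] certificate_g122])
             (use 4 b b' a'' b'' l0 noK in \<open>auto simp: core_simps\<close>)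
      next
        case False
        obtain b where b: "b \<in> inner" "b \<noteq> a" using other_element[OF finite_inner two 4(1)] .
        obtain b' where b': "b' \<in> kids b" using innerD b by blast
        have kb: "kids b = {b'}" using singleton_kids[OF b'] False b by blast
        show ?thesis
          by (rule gain[OF core121[OF l0 4(1) b(1) b(2)[symmetric] 4(2) b' a''] certificate_g121])
             (use 4 b b' a'' kb l0 noK noI[OF b(1) b'] in \<open>auto simp: core_simps\<close>)
      qed
    next
      case sa: False
      have ka: "kids a = {v}" using singleton_kids[OF 4(2) sa] .
      show ?thesis
      proof (cases "\<exists>b\<in>inner - {a}. card (kids b) \<ge> 2")
        case True
        then obtain b where b: "b \<in> inner" "b \<noteq> a" "card (kids b) \<ge> 2" by blast
        obtain b' where b': "b' \<in> kids b" using innerD b by blast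
        obtain b'' where b'': "b'' \<in> kids b" "b'' \<noteq> b'" using other_element[OF finite_kids b(3) b'] .
        show ?thesis
          by (rule gain[OF core112[OF l0 4(1) b(1) b(2)[symmetric] 4(2) b' b''] certificate_g112])
             (use 4 b b' b'' ka l0 noK noI[OF 4] in \<open>auto simp: core_simps\<close>)
      next
        case small: False
        obtain b where b: "b \<in> inner" "b \<noteq> a" using other_element[OF finite_inner two 4(1)] .
        obtain b' where b': "b' \<in> kids b" using innerD b by blast
        have kb: "kids b = {b'}" using singleton_kids[OF b'] small b by blast
        show ?thesis
        proof (cases "card inner \<ge> 3")
          case True
          obtain c where c: "c \<in> inner" "c \<noteq> a" "c \<noteq> b" using third_element[OF finite_inner True
            4(1) b(1)] .
          obtain c' where c': "c' \<in> kids c" using innerD c by blast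
          have kc: "kids c = {c'}" using singleton_kids[OF c'] small c by blast
          show ?thesis
            by (rule gain[OF core1111[OF l0 4(1) b(1) b(2)[symmetric] 4(2) b' c c'] certificate_g1111])
               (use 4 b b' c c' ka kb kc l0 noK noI[OF b(1) b'] noI[OF 4] noI[OF c(1) c'] in \<open>auto simp:
                 core_simps\<close>)
        next
          case in2: False
          have inn: "inner \<subseteq> {a, b}" by (rule subset_if_card) (use in2 4 b in auto)
          show ?thesis
          proof (cases "card leaves \<ge> 2")
            case True
            obtain k where k: "k \<in> leaves" "k \<noteq> l0" using other_element[OF fl True l0] .
            show ?thesis
              by (rule gain[OF core211[OF l0 4(1) b(1) b(2)[symmetric] 4(2) b' k] certificate_g211])
                 (use 4 b b' k ka kb l0 noK noI[OF b(1) b'] noI[OF 4] in \<open>auto simp: core_simps\<close>)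
          next
            case False
            have "leaves \<subseteq> {l0}" by (rule subset_if_card) (use fl False l0 in auto)
            then have "kids R \<subseteq> set [R, l0, a, v, b, b']" unfolding kR using inn by auto
            then show ?thesis
              by (intro gain[OF core111[OF l0 4(1) b(1) b(2)[symmetric] 4(2) b'] certificate_g111])
                 (use 4 b b' ka kb l0 noK noI[OF b(1) b'] noI[OF 4] in \<open>auto simp: core_simps\<close>)
          qed
        qed
      qed
    qed
  qed
qed

text \<open>Any three level 1 vertices with two leaves each give a core. If \<open>v\<close> is a
  vertex of this kind or a leaf of one, the core is built around it; if \<open>v\<close> is another
  level 1 vertex or a leaf there, it lies in a branch and the case \<open>None\<close>
  applies.\<close>

theorem depth2_gain_no_leaf:
  assumes J: "joinable T1 G u v" and v: "v \<in> pverts G"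
    and ne: "leaves = {}" and three: "card {c \<in> inner. card (kids c) \<ge> 2} \<ge> 3"
  shows "laplacian_energy (join_by_edge T1 G u v) \<ge> laplacian_energy T1 + 4 * real (graph_order G) / pi"
proof -
  define B where "B = {c \<in> inner. card (kids c) \<ge> 2}"
  have fB: "finite B" by (simp add: B_def)
  have noK: "kids z = {}" if "a \<in> B" "z \<in> kids a" for a z
    using that grandkids by (auto simp: B_def inner_def)
  \<comment> \<open>The core begins with a prescribed vertex \<open>a\<close> and leaf
    \<open>a1\<close>, so that \<open>v\<close> can be brought to position 1 or 2.\<close>
  have ch: thesis
    if a: "a \<in> B" "a1 \<in> kids a"
      and th: "\<And>a2 b b1 b2 c c1 c2. \<lbrakk>b \<in> B; c \<in> B; kids a1 = {} \<and> kids a2 = {}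
        \<and> kids b1 = {} \<and> kids b2 = {} \<and> kids c1 = {} \<and> kids c2 = {};
        core G R parent [R, a, a1, a2, b, b1, b2, c, c1, c2] [0, 0, 1, 1, 0, 4, 4, 0, 7, 7]\<rbrakk> \<Longrightarrow>
          thesis"
    for a a1 thesis
  proof -
    obtain b where b: "b \<in> B" "b \<noteq> a" using other_element[of B a] fB three a by (auto simp: B_def)
    obtain c where c: "c \<in> B" "c \<noteq> a" "c \<noteq> b" using third_element[of B a b] fB three a b by (auto
      simp: B_def)
    have two: "card (kids z) \<ge> 2" "z \<in> kids R" if "z \<in> B" for z using that by (auto simp: B_def inner_def)
    have pair: "\<exists>z1 z2. z1 \<in> kids z \<and> z2 \<in> kids z \<and> z1 \<noteq> z2" if "z \<in> B" for z
      using two(1)[OF that] by (metis card_le_Suc0_iff_eq finite_kids not_less_eq_eq numeral_2_eq_2)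
    obtain a2 where a2: "a2 \<in> kids a" "a2 \<noteq> a1" using other_element[OF finite_kids two(1)[OF a(1)] a(2)] .
    obtain b1 b2 where bb: "b1 \<in> kids b" "b2 \<in> kids b" "b1 \<noteq> b2" using pair[OF b(1)] by blast
    obtain c1 c2 where cc: "c1 \<in> kids c" "c2 \<in> kids c" "c1 \<noteq> c2" using pair[OF c(1)] by blast
    have kd: "z \<in> pverts G \<and> z \<noteq> R \<and> R \<noteq> z \<and> parent z = y" if "z \<in> kids y" for z y
      using kidsD[OF that] by metis
    have cross: "z \<noteq> R \<Longrightarrow> w \<noteq> R \<Longrightarrow> parent z \<noteq> parent w
      \<Longrightarrow> (z = w) = False" for z w by blast
    have C: "core G R parent [R, a, a1, a2, b, b1, b2, c, c1, c2] [0, 0, 1, 1, 0, 4, 4, 0, 7, 7]"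
      using cross a2(2) b(2) c(2,3) bb(3) cc(3) kd[OF two(2)[OF a(1)]] kd[OF two(2)[OF b(1)]] kd[OF two(2)[OF c(1)]]
        kd[OF a(2)] kd[OF a2(1)] kd[OF bb(1)] kd[OF bb(2)] kd[OF cc(1)] kd[OF cc(2)] root
      by (intro core_intro) (simp_all add: core_simps)
    have k: "kids a1 = {} \<and> kids a2 = {} \<and> kids b1 = {} \<and> kids b2 = {} \<and> kids c1 = {}
      \<and> kids c2 = {}"
      using noK[OF a] noK[OF a(1) a2(1)] noK[OF b(1) bb(1)] noK[OF b(1) bb(2)] noK[OF c(1) cc(1)] noK[OF c(1) cc(2)]
      by (intro conjI)
    show thesis by (rule th[OF b(1) c(1) k C])
  qed
  have "B \<noteq> {}" using three unfolding B_def by (metis card.empty not_numeral_le_zero)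
  then obtain a0 where a0: "a0 \<in> B" by blast
  then obtain a1 where a1: "a1 \<in> kids a0" by (auto simp: B_def inner_def)
  have outer: "laplacian_energy (join_by_edge T1 G u v) \<ge> laplacian_energy T1 + 4 * real (graph_order G) / pi"
    if z: "z \<in> inner" "z \<notin> B" "v = z \<or> v \<in> kids z" for z
  proof -
    obtain a2 b b1 b2 c c1 c2 where B: "b \<in> B" "c \<in> B"
      and k: "kids a1 = {} \<and> kids a2 = {} \<and> kids b1 = {} \<and> kids b2 = {} \<and> kids c1 = {}
        \<and> kids c2 = {}"
      and C: "core G R parent [R, a0, a1, a2, b, b1, b2, c, c1, c2] [0, 0, 1, 1, 0, 4, 4, 0, 7, 7]"
      by (rule ch[OF a0 a1])
    interpret C: core G R parent "[R, a0, a1, a2, b, b1, b2, c, c1, c2]" "[0, 0, 1, 1, 0, 4, 4, 0, 7, 7]" by (rule C)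
    have zk: "z \<in> kids R" "kids z \<noteq> {}" using z(1) by (simp_all add: inner_def)
    have "z \<noteq> x" if "x \<in> {R, a0, b, c} \<union> {a1, a2, b1, b2, c1, c2}" for x
      using that
    proof
      assume "x \<in> {R, a0, b, c}"
      then show ?thesis using kidsD[OF zk(1)] z(2) B a0 by blast
    next
      assume "x \<in> {a1, a2, b1, b2, c1, c2}"
      then have "kids x = {}" using k by blast
      then show ?thesis using zk(2) by metis
    qed
    then have "z \<notin> set [R, a0, a1, a2, b, b1, b2, c, c1, c2]" by auto
    then have zb: "z \<in> C.branches" using zk unfolding C.branches_def by blast
    have "v \<noteq> R \<and> (v \<in> C.branches \<or> parent v \<in> C.branches)"
      using z(3)
    proof
      assume "v = z"
      then show ?thesis using zb kidsD[OF zk(1)] by metis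
    next
      assume "v \<in> kids z"
      then show ?thesis using zb kidsD[of v z] by metis
    qed
    then show ?thesis
      by (intro C.certificate_gain[OF J certificate_no_leaf[of None]]) (use k in \<open>simp_all add:
        core_simps\<close>)
  qed
  from v show ?thesis
  proof (cases rule: vertex_cases)
    case 1
    obtain a2 b b1 b2 c c1 c2 where B: "b \<in> B" "c \<in> B"
      and k: "kids a1 = {} \<and> kids a2 = {} \<and> kids b1 = {} \<and> kids b2 = {} \<and> kids c1 = {}
        \<and> kids c2 = {}"
      and C: "core G R parent [R, a0, a1, a2, b, b1, b2, c, c1, c2] [0, 0, 1, 1, 0, 4, 4, 0, 7, 7]"
      by (rule ch[OF a0 a1])
    show ?thesis
      by (rule core.certificate_gain[OF C J certificate_no_leaf[of "Some 0"]])
         (use 1 k in \<open>simp_all add: core_simps\<close>)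
  next
    case 3
    show ?thesis
    proof (cases "v \<in> B")
      case True
      then obtain v1 where v1: "v1 \<in> kids v" by (auto simp: B_def inner_def)
      obtain a2 b b1 b2 c c1 c2 where B: "b \<in> B" "c \<in> B"
      and k: "kids v1 = {} \<and> kids a2 = {} \<and> kids b1 = {} \<and> kids b2 = {} \<and> kids c1 = {}
        \<and> kids c2 = {}"
        and C: "core G R parent [R, v, v1, a2, b, b1, b2, c, c1, c2] [0, 0, 1, 1, 0, 4, 4, 0, 7, 7]"
        by (rule ch[OF True v1])
      show ?thesis
        by (rule core.certificate_gain[OF C J certificate_no_leaf[of "Some 1"]])
           (use k in \<open>simp_all add: core_simps\<close>)
    qed (use outer[OF 3] in blast)
  next
    case (4 a)
    show ?thesis
    proof (cases "a \<in> B")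
      case True
      obtain a2 b b1 b2 c c1 c2 where B: "b \<in> B" "c \<in> B"
      and k: "kids v = {} \<and> kids a2 = {} \<and> kids b1 = {} \<and> kids b2 = {} \<and> kids c1 = {}
        \<and> kids c2 = {}"
        and C: "core G R parent [R, a, v, a2, b, b1, b2, c, c1, c2] [0, 0, 1, 1, 0, 4, 4, 0, 7, 7]"
        by (rule ch[OF True 4(2)])
      show ?thesis
        by (rule core.certificate_gain[OF C J certificate_no_leaf[of "Some 2"]])
           (use k in \<open>simp_all add: core_simps\<close>)
    qed (use outer[OF 4(1)] 4(2) in blast)
  qed (use ne in blast)
qed

end

section \<open>SNS-trees\<close>

fun sns_parent :: "sns_vertex \<Rightarrow> sns_vertex" where
  "sns_parent (Child_Leaf i j) = Child i"
| "sns_parent _ = Root"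

lemma sns_downward_arcs_parent:
  "sns_downward_arcs p ss = (\<lambda>z. (sns_parent z, z)) ` (pverts (sns_graph p ss) - {Root})"
  by (auto simp: sns_downward_arcs_def sns_graph_def image_iff)

text \<open>An isomorphism of digraphs consists of separate maps on vertices and on arcs. Here arcs
  are pairs of vertices, so the first map determines the second.\<close>

lemma graph_isomorphic_vertex_map:
  assumes "graph_isomorphic G H"
  obtains f where "inj_on f (pverts G)" "pverts H = f ` pverts G"
    and "parcs H = (\<lambda>(a, b). (f a, f b)) ` parcs G"
proof -
  obtain hom where hom: "pre_digraph.digraph_isomorphism (with_proj G) hom" "with_proj H = app_iso hom (with_proj G)"
    using assms unfolding graph_isomorphic_def digraph_iso_def by blast
  have th: "iso_tail hom = fst" "iso_head hom = snd"
    using arg_cong[OF hom(2), of tail] arg_cong[OF hom(2), of head] by simp_all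
  have arc: "iso_arcs hom e = (iso_verts hom (fst e), iso_verts hom (snd e))" if "e \<in> parcs G" for e
    using hom(1) that th unfolding pre_digraph.digraph_isomorphism_def by (metis prod.collapse with_proj_simps(2,4,5))
  show ?thesis
  proof (rule that[of "iso_verts hom"])
    show "inj_on (iso_verts hom) (pverts G)"
      using hom(1) unfolding pre_digraph.digraph_isomorphism_def by simp
    show "pverts H = iso_verts hom ` pverts G" using arg_cong[OF hom(2), of verts] by simp
    have "parcs H = iso_arcs hom ` parcs G" using arg_cong[OF hom(2), of arcs] by simp
    also have "\<dots> = (\<lambda>(a, b). (iso_verts hom a, iso_verts hom b)) ` parcs G"
      by (rule image_cong) (auto simp: arc)
    finally show "parcs H = (\<lambda>(a, b). (iso_verts hom a, iso_verts hom b)) ` parcs G" .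
  qed
qed

lemma graph_isomorphicI:
  assumes wf: "pair_wf_digraph G" and f: "inj_on f (pverts G)" "pverts H = f ` pverts G"
    "parcs H = (\<lambda>(a, b). (f a, f b)) ` parcs G"
  shows "graph_isomorphic G H"
proof -
  interpret pair_wf_digraph G by (rule wf)
  define hom where "hom = \<lparr>iso_verts = f, iso_arcs = (\<lambda>(a, b). (f a, f b)), iso_head = snd, iso_tail
    = fst\<rparr>"
  have "inj_on (\<lambda>(a, b). (f a, f b)) (parcs G)"
  proof (rule inj_onI)
    fix e e' assume e: "e \<in> parcs G" "e' \<in> parcs G"
      "(\<lambda>(a, b). (f a, f b)) e = (\<lambda>(a, b). (f a, f b)) e'"
    have "f (fst e) = f (fst e')" "f (snd e) = f (snd e')" using e(3) by (simp_all add: case_prod_beta)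
    then show "e = e'"
      using inj_onD[OF f(1)] arc_fst_in_verts[OF e(1)] arc_fst_in_verts[OF e(2)]
        arc_snd_in_verts[OF e(1)] arc_snd_in_verts[OF e(2)] by (metis prod.expand)
  qed
  then have "digraph_isomorphism hom"
    unfolding digraph_isomorphism_def using f(1) wf_digraph_axioms by (simp add: hom_def case_prod_beta)
  moreover have "with_proj H = app_iso hom (with_proj G)"
    using f by (simp add: with_proj_def app_iso_def hom_def)
  ultimately show ?thesis unfolding graph_isomorphic_def digraph_iso_def by blast
qed

lemma pair_wf_sns_graph: "pair_wf_digraph (sns_graph p ss)"
  by unfold_locales (auto simp: sns_graph_def sns_downward_arcs_def)

text \<open>The excluded families list the entries s_i >= 2 first, whereas a given description of
  the tree may have them in any order.\<close>

lemma sns_graph_permute: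
  assumes "mset ss = mset ss'"
  shows "graph_isomorphic (sns_graph p ss) (sns_graph p ss')"
proof -
  obtain f where f: "bij_betw f {..<length ss} {..<length ss'}" "\<forall>i<length ss. ss ! i = ss' ! f i"
  proof -
    obtain f where f: "f permutes {..<length ss'}" "permute_list f ss' = ss"
      using mset_eq_permutation[OF assms] .
    have len: "length ss = length ss'" using assms by (rule mset_eq_length)
    have "ss ! i = ss' ! f i" if "i < length ss" for i
      using f that len by (metis permute_list_nth)
    then show thesis using that[of f] permutes_imp_bij[OF f(1)] len by simp
  qed
  define g where "g z = (case z of Child i \<Rightarrow> Child (f i) | Child_Leaf i j \<Rightarrow> Child_Leaf (f i) j | _ \<Rightarrow> z)" for z
  have fi: "f i < length ss'" if "i < length ss" for i using f(1) that by (auto simp: bij_betw_def)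
  have inj: "i = j" if "f i = f j" "i < length ss" "j < length ss" for i j
    using f(1) that by (auto simp: bij_betw_def inj_on_def)
  have sur: "\<exists>i<length ss. j = f i" if "j < length ss'" for j
    using f(1) that by (auto simp: bij_betw_def image_iff)
  have V: "pverts (sns_graph p ss') = g ` pverts (sns_graph p ss)"
  proof (rule equalityI; rule subsetI)
    fix z assume z: "z \<in> pverts (sns_graph p ss')"
    show "z \<in> g ` pverts (sns_graph p ss)"
    proof (cases z)
      case (Child j)
      then obtain i where "i < length ss" "j = f i" using z sur by (auto simp: sns_graph_def)
      then show ?thesis using Child by (intro image_eqI[of _ _ "Child i"]) (auto simp: g_def sns_graph_def)
    next
      case (Child_Leaf j k)
      then obtain i where "i < length ss" "j = f i" "k < ss' ! j" using z sur by (auto simp: sns_graph_def)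
      then show ?thesis using Child_Leaf f(2)
        by (intro image_eqI[of _ _ "Child_Leaf i k"]) (auto simp: g_def sns_graph_def)
    next
      case Root
      then show ?thesis by (intro image_eqI[of _ _ Root]) (auto simp: g_def sns_graph_def)
    next
      case (Root_Leaf k)
      then show ?thesis using z by (intro image_eqI[of _ _ "Root_Leaf k"]) (auto simp: g_def sns_graph_def)
    qed
  qed (use fi f(2) in \<open>auto simp: g_def sns_graph_def\<close>)
  have I: "inj_on g (pverts (sns_graph p ss))"
  proof (rule inj_onI)
    fix z z' assume "z \<in> pverts (sns_graph p ss)" "z' \<in> pverts (sns_graph p ss)" "g z = g z'"
    then show "z = z'" by (cases z; cases z') (auto simp: g_def sns_graph_def intro: inj)
  qed
  have gp: "g (sns_parent z) = sns_parent (g z)" for z by (cases z) (auto simp: g_def)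
  have gR: "g z = Root \<longleftrightarrow> z = Root" for z by (cases z) (auto simp: g_def)
  have V': "pverts (sns_graph p ss') - {Root} = g ` (pverts (sns_graph p ss) - {Root})"
    unfolding V using gR by auto
  have D: "sns_downward_arcs p ss' = (\<lambda>(a, b). (g a, g b)) ` sns_downward_arcs p ss"
    unfolding sns_downward_arcs_parent V' by (simp add: image_image gp)
  have "parcs (sns_graph p ss') = (\<lambda>(a, b). (g a, g b)) ` parcs (sns_graph p ss)"
    unfolding sns_graph_def by (simp add: D image_Un) (auto simp: image_iff)
  then show ?thesis using graph_isomorphicI[OF pair_wf_sns_graph I V] by blast
qed

lemma mset_partition_ones:
  assumes "\<forall>s\<in>set ss. s \<ge> (1 :: nat)"
  shows "mset ss = mset (filter (\<lambda>s. s \<ge> 2) ss @ replicate (length ss - length (filter (\<lambda>s. s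
    \<ge> 2) ss)) 1)"
proof -
  have "mset ss = mset (filter (\<lambda>s. s \<ge> 2) ss) + mset (filter (\<lambda>s. \<not> s \<ge> 2) ss)"
    by (induction ss) auto
  moreover have "filter (\<lambda>s. \<not> s \<ge> 2) ss = replicate (length (filter (\<lambda>s. \<not> s
    \<ge> 2) ss)) 1"
    by (rule replicate_eqI) (use assms in fastforce)+
  moreover have "length (filter (\<lambda>s. \<not> s \<ge> 2) ss) = length ss - length (filter (\<lambda>s. s
    \<ge> 2) ss)"
    using sum_length_filter_compl[of "\<lambda>s. s \<ge> 2" ss] by simp
  ultimately show ?thesis by (metis mset_append)
qed

text \<open>With the entries of at least 2 moved to the front, all others are 1; having none, one or
  two large entries yields the three families in turn.\<close>

lemma excluded_trees:
  assumes iso: "graph_isomorphic G (sns_graph 0 ss)" and r: "length ss \<ge> 2"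
    and ones: "\<forall>s\<in>set ss. s \<ge> 1" and big: "length (filter (\<lambda>s. s \<ge> 2) ss) \<le> 2"
  shows "is_T4_tree G \<or> is_T'_tree G \<or> is_T''_tree G"
proof -
  define bs where "bs = filter (\<lambda>s. s \<ge> 2) ss"
  have bs2: "\<forall>s\<in>set bs. s \<ge> 2" by (simp add: bs_def)
  define ss' where "ss' = bs @ replicate (length ss - length bs) 1"
  have "mset ss = mset ss'" unfolding ss'_def bs_def by (rule mset_partition_ones[OF ones])
  then have "graph_isomorphic G (sns_graph 0 ss')"
    using iso sns_graph_permute digraph_iso_trans unfolding graph_isomorphic_def by blast
  moreover consider "bs = []" | s where "bs = [s]" | s s' where "bs = [s, s']"
  proof -
    have "length bs \<le> 2" using big by (simp add: bs_def)
    \<comment> \<open>\<open>remdups_adj.cases\<close> serves as the split into lists of length 0, 1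
      and at least 2.\<close>
    then show thesis using that by (cases bs rule: remdups_adj.cases) auto
  qed
  then show ?thesis
  proof cases
    case 1
    then have "ss' = replicate (length ss + 0) 1" by (simp add: ss'_def)
    then have "is_T4_tree G" unfolding is_T4_tree_def using calculation r by (metis add_0_right)
    then show ?thesis ..
  next
    case (2 s)
    then have "ss' = s # replicate (length ss - 1) 1" "s \<ge> 2" using bs2 by (simp_all add: ss'_def)
    then have "is_T'_tree G" unfolding is_T'_tree_def using calculation r by blast
    then show ?thesis by blast
  next
    case (3 s s')
    then have "ss' = s # s' # replicate (length ss - 2) 1" "s \<ge> 2" "s' \<ge> 2" using bs2 by (simp_all add: ss'_def)
    then have "is_T''_tree G" unfolding is_T''_tree_def using calculation r by blast
    then show ?thesis by blast
  qed
qed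

definition sns_kids :: "nat \<Rightarrow> nat list \<Rightarrow> sns_vertex \<Rightarrow> sns_vertex set" where
  "sns_kids p ss c = {z \<in> pverts (sns_graph p ss) - {Root}. sns_parent z = c}"

lemma sns_kids_simps:
  "sns_kids p ss Root = Root_Leaf ` {..<p} \<union> Child ` {..<length ss}"
  "sns_kids p ss (Root_Leaf k) = {}"
  "i < length ss \<Longrightarrow> sns_kids p ss (Child i) = Child_Leaf i ` {..<ss ! i}"
proof -
  show "sns_kids p ss Root = Root_Leaf ` {..<p} \<union> Child ` {..<length ss}"
    unfolding sns_kids_def sns_graph_def by (rule Set.set_eqI) (case_tac x; auto)
  show "sns_kids p ss (Root_Leaf k) = {}"
    unfolding sns_kids_def by (rule equals0I) (case_tac y; auto)
  show "i < length ss \<Longrightarrow> sns_kids p ss (Child i) = Child_Leaf i ` {..<ss ! i}"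
    unfolding sns_kids_def sns_graph_def by (rule Set.set_eqI) (case_tac x; auto)
qed

text \<open>The rooted structure is pulled back along the inverse \<open>g\<close> of the
  isomorphism. Beyond this structure only the sets of children are passed on, since they determine
  which level 1 vertices are leaves and how many leaves the others have.\<close>

lemma sns_depth2_tree:
  assumes "pair_graph G" and f: "inj_on f (pverts G)" "pverts (sns_graph p ss) = f ` pverts G"
    "parcs (sns_graph p ss) = (\<lambda>(a, b). (f a, f b)) ` parcs G"
  obtains g parent where "depth2_tree G (g Root) parent" "inj_on g (pverts (sns_graph p ss))"
    and "\<And>x. x \<in> pverts (sns_graph p ss) \<Longrightarrow> depth2_tree.kids G (g Root) parent (g x)
      = g ` sns_kids p ss x"
proof -
  interpret pair_graph G by fact
  let ?S = "sns_graph p ss"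
  define g where "g = the_inv_into (pverts G) f"
  define parent where "parent a = g (sns_parent (f a))" for a
  have gf: "g (f a) = a" if "a \<in> pverts G" for a using that f(1) by (simp add: g_def the_inv_into_f_f)
  have fg: "f (g x) = x" "g x \<in> pverts G" if x: "x \<in> pverts ?S" for x
  proof -
    obtain a where "a \<in> pverts G" "x = f a" using x f(2) by blast
    then show "f (g x) = x" "g x \<in> pverts G" using gf by metis+
  qed
  have Root: "Root \<in> pverts ?S" by (simp add: sns_graph_def)
  have sp: "sns_parent x \<in> pverts ?S" if "x \<in> pverts ?S" for x
    using that by (auto simp: sns_graph_def)
  have fV: "f a \<in> pverts ?S" if "a \<in> pverts G" for a using that f(2) by blast
  have gI: "inj_on g (pverts ?S)" by (rule inj_on_inverseI[of _ f]) (rule fg)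
  have gV: "pverts G = g ` pverts ?S"
    unfolding f(2) image_image using gf by (simp cong: image_cong)
  have V: "pverts G - {g Root} = g ` (pverts ?S - {Root})"
    unfolding gV using gI Root by (simp add: inj_on_image_set_diff)
  have "parcs G = (\<lambda>(x, y). (g x, g y)) ` parcs ?S"
  proof -
    have "(\<lambda>(x, y). (g x, g y)) ((\<lambda>(a, b). (f a, f b)) e) = e" if "e \<in> parcs G" for e
      using gf in_arcsD1[of "fst e" "snd e"] in_arcsD2[of "fst e" "snd e"] that by (cases e) simp
    then show ?thesis unfolding f(3) image_image by simp
  qed
  also have "\<dots> = (\<lambda>(x, y). (g x, g y)) ` (\<lambda>z. (sns_parent z, z)) ` (pverts ?S - {Root})
      \<union> (\<lambda>(x, y). (g x, g y)) ` (\<lambda>z. (z, sns_parent z)) ` (pverts ?S - {Root})"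
  proof -
    have "parcs ?S = (\<lambda>z. (sns_parent z, z)) ` (pverts ?S - {Root})
      \<union> ((\<lambda>z. (sns_parent z, z)) ` (pverts ?S - {Root}))\<inverse>"
      using sns_downward_arcs_parent[of p ss] by (simp add: sns_graph_def)
    also have "((\<lambda>z. (sns_parent z, z)) ` (pverts ?S - {Root}))\<inverse>
      = (\<lambda>z. (z, sns_parent z)) ` (pverts ?S - {Root})"
      by blast
    finally show ?thesis by (metis image_Un)
  qed
  also have "\<dots> = (\<lambda>z. (parent z, z)) ` (pverts G - {g Root})
    \<union> (\<lambda>z. (z, parent z)) ` (pverts G - {g Root})"
    unfolding V image_image
    by (rule arg_cong2[of _ _ _ _ "(\<union>)"]; rule image_cong) (simp_all add: parent_def fg)
  finally have arcs: "parcs G = (\<lambda>z. (parent z, z)) ` (pverts G - {g Root})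
    \<union> (\<lambda>z. (z, parent z)) ` (pverts G - {g Root})" .
  have D: "depth2_tree G (g Root) parent"
  proof (unfold_locales)
    show "g Root \<in> pverts G" using fg(2) Root .
    show "parcs G = (\<lambda>z. (parent z, z)) ` (pverts G - {g Root})
      \<union> (\<lambda>z. (z, parent z)) ` (pverts G - {g Root})"
      by (rule arcs)
    show "parent (parent z) = g Root" if "z \<in> pverts G" for z
    proof -
      have "parent (parent z) = g (sns_parent (sns_parent (f z)))"
        unfolding parent_def using fg(1)[OF sp[OF fV[OF that]]] by metis
      also have "sns_parent (sns_parent (f z)) = Root" by (cases "f z") auto
      finally show ?thesis .
    qed
  qed
  interpret D: depth2_tree G "g Root" parent by (rule D)
  have "D.kids (g x) = g ` sns_kids p ss x" if x: "x \<in> pverts ?S" for x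
  proof -
    have "parent (g y) = g x \<longleftrightarrow> sns_parent y = x" if "y \<in> pverts ?S" for y
      using gI sp[OF that] x by (simp add: parent_def fg that inj_on_eq_iff)
    then show ?thesis unfolding D.kids_def V sns_kids_def by blast
  qed
  then show thesis using that[OF D gI] by blast
qed

theorem sns_gain:
  assumes sns: "sns_tree_diam4 G" and ex: "\<not> is_T4_tree G" "\<not> is_T'_tree G" "\<not> is_T''_tree G"
    and J: "joinable T1 G u v" and v: "v \<in> pverts G"
  shows "laplacian_energy (join_by_edge T1 G u v) \<ge> laplacian_energy T1 + 4 * real (graph_order G) / pi"
proof -
  obtain p ss where ss: "length ss \<ge> 2" "card {i. i < length ss \<and> ss ! i \<noteq> 0} \<ge> 2"
    and iso: "graph_isomorphic G (sns_graph p ss)" and tree: "undirected_tree G"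
    using sns unfolding sns_tree_diam4_def by blast
  have "pair_graph G" using tree by (simp add: undirected_tree_def)
  obtain f where f: "inj_on f (pverts G)" "pverts (sns_graph p ss) = f ` pverts G"
    "parcs (sns_graph p ss) = (\<lambda>(a, b). (f a, f b)) ` parcs G"
    using graph_isomorphic_vertex_map[OF iso] by blast
  obtain g parent where D: "depth2_tree G (g Root) parent" and g: "inj_on g (pverts (sns_graph p ss))"
    and kids: "\<And>x. x \<in> pverts (sns_graph p ss) \<Longrightarrow> depth2_tree.kids G (g Root) parent (g x)
      = g ` sns_kids p ss x"
    using sns_depth2_tree[OF \<open>pair_graph G\<close> f] by blast
  interpret D: depth2_tree G "g Root" parent by (rule D)
  have ch: "Child i \<in> pverts (sns_graph p ss)" if "i < length ss" for i using that by (simp add: sns_graph_def)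
  have rt: "Root \<in> pverts (sns_graph p ss)" by (simp add: sns_graph_def)
  have kR: "D.kids (g Root) = g ` Root_Leaf ` {..<p} \<union> g ` Child ` {..<length ss}"
    unfolding kids[OF rt] sns_kids_simps image_Un ..
  have kC: "D.kids (g (Child i)) = g ` Child_Leaf i ` {..<ss ! i}" if "i < length ss" for i
    using kids[OF ch[OF that]] sns_kids_simps(3)[OF that] by metis
  have cC: "card (D.kids (g (Child i))) = ss ! i" if "i < length ss" for i
  proof -
    have "inj_on (\<lambda>j. g (Child_Leaf i j)) {..<ss ! i}"
    proof (rule inj_onI)
      fix j k assume j: "j \<in> {..<ss ! i}" "k \<in> {..<ss ! i}" "g (Child_Leaf i j) = g (Child_Leaf i k)"
      have "Child_Leaf i j = Child_Leaf i k"
        by (rule inj_onD[OF g j(3)]) (use j that in \<open>simp_all add: sns_graph_def\<close>)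
      then show "j = k" by simp
    qed
    then show ?thesis unfolding kC[OF that] image_image by (simp add: card_image)
  qed
  have cI: "card ((\<lambda>i. g (Child i)) ` {i. i < length ss \<and> Q i}) = card {i. i < length ss \<and> Q i}" for Q
  proof (rule card_image)
    show "inj_on (\<lambda>i. g (Child i)) {i. i < length ss \<and> Q i}"
    proof (rule inj_onI)
      fix i k assume i: "i \<in> {i. i < length ss \<and> Q i}" "k \<in> {i. i < length ss \<and> Q i}"
        "g (Child i) = g (Child k)"
      have "Child i = Child k" by (rule inj_onD[OF g i(3)]) (use i ch in blast)+
      then show "i = k" by simp
    qed
  qed
  have inner: "(\<lambda>i. g (Child i)) ` {i. i < length ss \<and> ss ! i \<noteq> 0} \<subseteq> D.inner"
  proof (rule subsetI)
    fix z assume "z \<in> (\<lambda>i. g (Child i)) ` {i. i < length ss \<and> ss ! i \<noteq> 0}"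
    then obtain i where i: "i < length ss" "ss ! i \<noteq> 0" "z = g (Child i)" by blast
    then show "z \<in> D.inner" unfolding D.inner_def using kR cC[OF i(1)] by auto
  qed
  have two: "card D.inner \<ge> 2"
    using card_mono[OF D.finite_inner inner] ss(2) unfolding cI by linarith
  show ?thesis
  proof (cases "D.leaves = {}")
    case False
    show ?thesis by (rule D.depth2_gain_leaf[OF J v two False])
  next
    case True
    \<comment> \<open>Leaves at the root have two sources, the p pendent vertices and the level 1
      vertices with s_i = 0; both are ruled out here.\<close>
    have p0: "p = 0"
    proof (rule ccontr)
      assume "p \<noteq> 0"
      then have "g (Root_Leaf 0) \<in> D.kids (g Root)" "Root_Leaf 0 \<in> pverts (sns_graph p ss)"
        unfolding kR by (auto simp: sns_graph_def)
      moreover have "D.kids (g (Root_Leaf 0)) = {}"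
        using kids[OF calculation(2)] sns_kids_simps(2) by (metis image_empty)
      ultimately show False using True by (auto simp: D.leaves_def)
    qed
    have "ss ! i \<ge> 1" if i: "i < length ss" for i
    proof (rule ccontr)
      assume "\<not> ss ! i \<ge> 1"
      then have "ss ! i = 0" by simp
      then have "D.kids (g (Child i)) = {}" using kC[OF i] by simp
      moreover have "g (Child i) \<in> D.kids (g Root)" unfolding kR using i by blast
      ultimately show False using True by (auto simp: D.leaves_def)
    qed
    then have ones: "\<forall>s\<in>set ss. s \<ge> 1" by (metis in_set_conv_nth)
    \<comment> \<open>With p = 0 and all s_i positive, fewer than three entries of at least 2 would
      make the tree one of the excluded ones.\<close>
    have "length (filter (\<lambda>s. s \<ge> 2) ss) \<ge> 3"
      using excluded_trees[OF iso[unfolded p0] ss(1) ones] ex by fastforce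
    then have big: "card {i. i < length ss \<and> ss ! i \<ge> 2} \<ge> 3" by (simp add: length_filter_conv_card)
    have "(\<lambda>i. g (Child i)) ` {i. i < length ss \<and> ss ! i
      \<ge> 2} \<subseteq> {c \<in> D.inner. card (D.kids c) \<ge> 2}"
    proof (rule subsetI)
      fix z assume "z \<in> (\<lambda>i. g (Child i)) ` {i. i < length ss \<and> ss ! i \<ge> 2}"
      then obtain i where i: "i < length ss" "ss ! i \<ge> 2" "z = g (Child i)" by blast
      then show "z \<in> {c \<in> D.inner. card (D.kids c) \<ge> 2}" using inner cC[OF i(1)] by fastforce
    qed
    then have "card {c \<in> D.inner. card (D.kids c) \<ge> 2} \<ge> 3"
      using card_mono[of "{c \<in> D.inner. card (D.kids c) \<ge> 2}"
        "(\<lambda>i. g (Child i)) ` {i. i < length ss \<and> ss ! i \<ge> 2}"]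
        big D.finite_inner unfolding cI by simp
    then show ?thesis by (rule D.depth2_gain_no_leaf[OF J v True])
  qed
qed

theorem theorem5p2:
  fixes T1 T2 T :: "'a pair_pre_digraph"
    and n1 n2 n r1 :: nat
    and u v :: 'a
  assumes "undirected_tree T1"
    and "graph_order T1 = n1"
    and "card (non_pendent_vertices T1) = r1"
    and "sns_tree_diam4 T2"
    and "graph_order T2 = n2"
    and "\<not> is_T4_tree T2"
    and "\<not> is_T'_tree T2"
    and "\<not> is_T''_tree T2"
    and "n1 \<ge> n2"
    and "n2 \<ge> 6"
    and "pverts T1 \<inter> pverts T2 = {}"
    and "u \<in> pverts T1"
    and "v \<in> pverts T2"
    and "T = join_by_edge T1 T2 u v"
    and "n = n1 + n2"
    and "n \<ge> 19"
    and "laplacian_sigma T1 = r1"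
    and "laplacian_energy T1 \<ge> 2 + 4 * real n1 / pi"
  shows "laplacian_energy T \<ge> 4 * real n / pi + 2 \<and>
         laplacian_energy T \<ge> laplacian_energy (path_graph n)"
proof -
  have tree2: "undirected_tree T2" using assms(4) by (simp add: sns_tree_diam4_def)
  have pg: "pair_graph T1" "pair_graph T2" using assms(1) tree2 by (simp_all add: undirected_tree_def)
  have "join_graphs T1 T2 u v"
    using pg assms(11-13) by (simp add: join_graphs_def join_graphs_axioms_def)
  moreover have "vertex_degree T1 u \<ge> 1"
    using undirected_tree_degree_pos assms by fastforce
  \<comment> \<open>Here the hypothesis that \<sigma>_1 equals r_1 enters; n1 >= n2 >= 6 makes the
    order large enough.\<close>
  moreover have "2 * laplacian_sigma T1 \<le> graph_order T1"
    by (rule sigma_le_half_order) (use assms in auto)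
  ultimately have "joinable T1 T2 u v"
    unfolding joinable_def using undirected_tree_card_arcs[OF assms(1)] undirected_tree_card_arcs[OF tree2] assms by
      simp
  from sns_gain[OF assms(4,6,7,8) this assms(13)]
  have "laplacian_energy T \<ge> laplacian_energy T1 + 4 * real n2 / pi" using assms(5,14) by simp
  moreover have "4 * real n / pi = 4 * real n1 / pi + 4 * real n2 / pi"
    using assms(15) by (simp add: add_divide_distrib distrib_left)
  ultimately have "laplacian_energy T \<ge> 4 * real n / pi + 2" using assms(18) by linarith
  moreover have "laplacian_energy (path_graph n) \<le> 4 * real n / pi + 2"
    by (rule laplacian_energy_path_le) (use assms(16) in simp)
  ultimately show ?thesis by linarith
qed

end
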